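(* Let $L$ be a two-sided real-valued Lévy process with characteristic triplet $(\gamma,\sigma^2,\nu)$ with respect to the truncation function $x1_{|x|\le 1}$. The well-balanced Ornstein-Uhlenbeck process $$X_t=\int_{-\infty}^{\infty} e^{-\lambda|t-s|}\,dL_s,\qquad t\ge 0,$$ is well-defined and infinitely divisible with characteristic triplet $(\gamma_X,\sigma_X^2,\nu_X)$ (with respect to the truncation function $x1_{|x|\le1}$) given by $$\gamma_X=\frac{2}{\lambda}\gamma+\frac{2}{\lambda}\Big(\int_1^\infty\nu(dx)-\int_{-\infty}^{-1}\nu(dx)\Big),\qquad \sigma_X^2=\frac{1}{\lambda}\sigma^2,$$ $$\nu_X(A)=(\nu\times\mathrm{Leb})\big\{(x,s)\in\mathbb{R}\times\mathbb{R}\;:\;x e^{-\lambda|t-s|}\in A\setminus\{0\}\big\},\qquad A\in\mathcal{B}(\mathbb{R}),$$ if and only if $\lambda>0$ and $$\int_{|x|>1}\log|x|\,\nu(dx)<\infty .$$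
   Context: A Lévy process $L=(L_t)_{t\ge0}$ with characteristic triplet $(\gamma,\sigma^2,\nu)$ satisfies $E(e^{iuL_t})=e^{t\psi(u)}$ with $\psi(u)=iu\gamma-\sigma^2\frac{u^2}{2}+\int_{-\infty}^\infty(e^{iux}-1-iux1_{|x|\le1})\,\nu(dx)$, where the Lévy measure $\nu$ satisfies $\int (1\wedge x^2)\,\nu(dx)<\infty$. The two-sided version is obtained from two independent copies $L^{(1)},L^{(2)}$ by $L_t=L^{(1)}_t$ for $t\ge0$ and $L_t=-L^{(2)}_{(-t)-}$ for $t<0$. An infinitely divisible random variable has characteristic triplet $(a,b,\rho)$ if the logarithm of its characteristic function is given by the same formula as $\psi$ with $(\gamma,\sigma^2,\nu)$ replaced by $(a,b,\rho)$. Integrals of deterministic functions over $\mathbb{R}$ with respect to $L$ are meant in the sense of Rajput and Rosinski: let $\Lambda$ be the independently scattered random measure on the bounded Borel sets of $\mathbb{R}$ associated with $L$ (so $\Lambda((a,b])=L_b-L_a$). For step functions $g=\sum_j c_j1_{A_j}$ with disjoint bounded Borel sets $A_j$ put $\int_A g\,d\Lambda=\sum_jc_j\Lambda(A\cap A_j)$. A measurable function $f:\mathbb{R}\to\mathbb{R}$ is called integrable if there is a sequence $(g_n)$ of step functions with $g_n\to f$ Lebesgue-a.e. and such that $\lim_n\int_Ag_n\,d\Lambda$ exists in probability for every $A\in\mathcal{B}(\mathbb{R})$; then $\int_{\mathbb{R}}f(s)\,dL_s:=\lim_n\int_{\mathbb{R}}g_n\,d\Lambda$. "Well-defined" means that for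 every $t\ge0$ the function $s\mapsto e^{-\lambda|t-s|}$ is integrable in this sense. $\mathrm{Leb}$ denotes Lebesgue measure on $\mathbb{R}$.
   Formalization: The case where L is identically zero (γ = 0, σ² = 0, ν = 0) and λ ≤ 0 is excluded: for λ < 0 the process X = 0 is well-defined with the stated triplet (0,0,0) although λ > 0 fails, and for λ = 0 the formulas are undefined. *)

theory Defs
  imports "HOL-Probability.Probability"
begin

section \<open>Characteristic triplets\<close>

definition levy_measure :: "real measure \<Rightarrow> bool" where
  "levy_measure \<nu> \<longleftrightarrow>
     sets \<nu> = sets borel \<and> emeasure \<nu> {0} = 0 \<and>
     (\<integral>\<^sup>+x. ennreal (min 1 (x^2)) \<partial>\<nu>) < \<infinity>"

definition levy_exponent :: "real \<Rightarrow> real \<Rightarrow> real measure \<Rightarrow> real \<Rightarrow> complex" where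
  "levy_exponent a b \<rho> u =
     \<i> * of_real (u * a) - of_real (b * u^2 / 2)
       + (CLINT x|\<rho>. iexp (u * x) - 1 - \<i> * of_real (u * x * indicator {-1..1} x))"

text \<open>
  The triplet has to be admissible (\<open>b \<ge> 0\<close> and \<open>\<rho>\<close> a Levy measure); in particular the
  Bochner integral in the exponent then converges. The exponent is continuous in \<open>u\<close> and vanishes
  at 0, so the equation below says that it is the (distinguished) logarithm of the characteristic
  function.
\<close>

definition has_char_triplet :: "real measure \<Rightarrow> real \<Rightarrow> real \<Rightarrow> real measure \<Rightarrow> bool" where
  "has_char_triplet \<mu> a b \<rho> \<longleftrightarrow>
     b \<ge> 0 \<and> levy_measure \<rho> \<and> (\<forall>u. char \<mu> u = exp (levy_exponent a b \<rho> u))"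

text \<open>For every \<open>n \<ge> 1\<close>, \<open>\<mu>\<close> is the law of the sum of \<open>n\<close> i.i.d. random variables.\<close>

definition infinitely_divisible :: "real measure \<Rightarrow> bool" where
  "infinitely_divisible \<mu> \<longleftrightarrow>
     (\<forall>n\<ge>1. \<exists>\<mu>'. real_distribution \<mu>' \<and>
        \<mu> = distr (\<Pi>\<^sub>M i\<in>{..<n::nat}. \<mu>') borel (\<lambda>x. \<Sum>i<n. x i))"


section \<open>Levy processes\<close>

text \<open>Only the values \<open>L t\<close> with \<open>t \<ge> 0\<close> are relevant.\<close>

definition levy_process ::
  "'a measure \<Rightarrow> (real \<Rightarrow> 'a \<Rightarrow> real) \<Rightarrow> real \<Rightarrow> real \<Rightarrow> real measure \<Rightarrow> bool" where
  "levy_process M L \<gamma> \<sigma>2 \<nu> \<longleftrightarrow>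
     prob_space M \<and>
     (\<forall>t\<ge>0. L t \<in> borel_measurable M) \<and>
     (AE \<omega> in M. L 0 \<omega> = 0) \<and>
     (\<forall>(n::nat) t. 0 \<le> t 0 \<and> (\<forall>i<n. t i < t (Suc i)) \<longrightarrow>
        prob_space.indep_vars M (\<lambda>_. borel) (\<lambda>i \<omega>. L (t (Suc i)) \<omega> - L (t i) \<omega>) {..<n}) \<and>
     (\<forall>s t. 0 \<le> s \<and> s \<le> t \<longrightarrow>
        distr M borel (\<lambda>\<omega>. L t \<omega> - L s \<omega>) = distr M borel (L (t - s))) \<and>
     (AE \<omega> in M. \<forall>t\<ge>0. continuous (at_right t) (\<lambda>s. L s \<omega>) \<and>
        (t > 0 \<longrightarrow> (\<exists>l. ((\<lambda>s. L s \<omega>) \<longlongrightarrow> l) (at_left t)))) \<and>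
     \<sigma>2 \<ge> 0 \<and> levy_measure \<nu> \<and>
     (\<forall>t\<ge>0. \<forall>u. char (distr M borel (L t)) u = exp (of_real t * levy_exponent \<gamma> \<sigma>2 \<nu> u))"

text \<open>
  Paths are cadlag only almost surely, so the left limits defining \<open>L t\<close> for \<open>t < 0\<close> need not exist
  on a null set; hence the defining relation is imposed almost surely (on one null set for all
  \<open>t\<close>), and measurability of each \<open>L t\<close> is required separately.
\<close>

definition two_sided_levy_process ::
  "'a measure \<Rightarrow> (real \<Rightarrow> 'a \<Rightarrow> real) \<Rightarrow> real \<Rightarrow> real \<Rightarrow> real measure \<Rightarrow> bool" where
  "two_sided_levy_process M L \<gamma> \<sigma>2 \<nu> \<longleftrightarrow>
     (\<exists>L1 L2. levy_process M L1 \<gamma> \<sigma>2 \<nu> \<and> levy_process M L2 \<gamma> \<sigma>2 \<nu> \<and>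
        prob_space.indep_var M
          (\<Pi>\<^sub>M t\<in>{0..}. borel) (\<lambda>\<omega>. \<lambda>t\<in>{0..}. L1 t \<omega>)
          (\<Pi>\<^sub>M t\<in>{0..}. borel) (\<lambda>\<omega>. \<lambda>t\<in>{0..}. L2 t \<omega>) \<and>
        (\<forall>t. L t \<in> borel_measurable M) \<and>
        (AE \<omega> in M. (\<forall>t\<ge>0. L t \<omega> = L1 t \<omega>) \<and>
           (\<forall>t<0. ((\<lambda>s. L2 s \<omega>) \<longlongrightarrow> - L t \<omega>) (at_left (- t)))))"


section \<open>Integration of deterministic functions (Rajput and Rosinski)\<close>

definition bounded_borel :: "real set set" where
  "bounded_borel = {A \<in> sets borel. bounded A}"

definition independently_scattered :: "'a measure \<Rightarrow> (real set \<Rightarrow> 'a \<Rightarrow> real) \<Rightarrow> bool" where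
  "independently_scattered M \<Lambda> \<longleftrightarrow>
     (\<forall>A\<in>bounded_borel. \<Lambda> A \<in> borel_measurable M) \<and>
     (\<forall>A :: nat \<Rightarrow> real set. range A \<subseteq> bounded_borel \<and> disjoint_family A \<longrightarrow>
        prob_space.indep_vars M (\<lambda>_. borel) (\<lambda>n. \<Lambda> (A n)) UNIV \<and>
        ((\<Union>n. A n) \<in> bounded_borel \<longrightarrow>
           (AE \<omega> in M. (\<lambda>n. \<Lambda> (A n) \<omega>) sums \<Lambda> (\<Union>n. A n) \<omega>)))"

definition associated_random_measure ::
  "'a measure \<Rightarrow> (real \<Rightarrow> 'a \<Rightarrow> real) \<Rightarrow> (real set \<Rightarrow> 'a \<Rightarrow> real) \<Rightarrow> bool" where
  "associated_random_measure M L \<Lambda> \<longleftrightarrow>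
     independently_scattered M \<Lambda> \<and>
     (\<forall>a b. a < b \<longrightarrow> (AE \<omega> in M. \<Lambda> {a<..b} \<omega> = L b \<omega> - L a \<omega>))"

text \<open>A step function \<open>\<Sum>\<^sub>j c\<^sub>j 1\<^bsub>B\<^sub>j\<^esub>\<close> is represented by the list of the pairs \<open>(c\<^sub>j, B\<^sub>j)\<close>.\<close>

type_synonym step = "(real \<times> real set) list"

definition is_step :: "step \<Rightarrow> bool" where
  "is_step g \<longleftrightarrow> (\<forall>(c, B)\<in>set g. B \<in> bounded_borel) \<and>
     sorted_wrt (\<lambda>(c, B) (c', B'). B \<inter> B' = {}) g"

definition step_fun :: "step \<Rightarrow> real \<Rightarrow> real" where
  "step_fun g s = (\<Sum>(c, B)\<leftarrow>g. c * indicator B s)"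

definition step_integral :: "(real set \<Rightarrow> 'a \<Rightarrow> real) \<Rightarrow> step \<Rightarrow> real set \<Rightarrow> 'a \<Rightarrow> real" where
  "step_integral \<Lambda> g A \<omega> = (\<Sum>(c, B)\<leftarrow>g. c * \<Lambda> (A \<inter> B) \<omega>)"

definition tendsto_in_prob :: "'a measure \<Rightarrow> (nat \<Rightarrow> 'a \<Rightarrow> real) \<Rightarrow> ('a \<Rightarrow> real) \<Rightarrow> bool" where
  "tendsto_in_prob M Y Z \<longleftrightarrow>
     Z \<in> borel_measurable M \<and>
     (\<forall>\<epsilon>>0. (\<lambda>n. measure M {\<omega> \<in> space M. \<bar>Y n \<omega> - Z \<omega>\<bar> > \<epsilon>}) \<longlonglongrightarrow> 0)"

definition approximating_steps ::
  "'a measure \<Rightarrow> (real set \<Rightarrow> 'a \<Rightarrow> real) \<Rightarrow> (real \<Rightarrow> real) \<Rightarrow> (nat \<Rightarrow> step) \<Rightarrow> bool" where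
  "approximating_steps M \<Lambda> f g \<longleftrightarrow>
     (\<forall>n. is_step (g n)) \<and>
     (AE s in lborel. (\<lambda>n. step_fun (g n) s) \<longlonglongrightarrow> f s) \<and>
     (\<forall>A\<in>sets borel. \<exists>Y. tendsto_in_prob M (\<lambda>n. step_integral \<Lambda> (g n) A) Y)"

definition rm_integrable ::
  "'a measure \<Rightarrow> (real set \<Rightarrow> 'a \<Rightarrow> real) \<Rightarrow> (real \<Rightarrow> real) \<Rightarrow> bool" where
  "rm_integrable M \<Lambda> f \<longleftrightarrow> f \<in> borel_measurable borel \<and> (\<exists>g. approximating_steps M \<Lambda> f g)"

text \<open>
  \<open>Z\<close> is a version of the integral of \<open>f\<close> over the real line. The integral is only determined up
  to null sets, hence a relation rather than a function.
\<close>

definition has_rm_integral ::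
  "'a measure \<Rightarrow> (real set \<Rightarrow> 'a \<Rightarrow> real) \<Rightarrow> (real \<Rightarrow> real) \<Rightarrow> ('a \<Rightarrow> real) \<Rightarrow> bool" where
  "has_rm_integral M \<Lambda> f Z \<longleftrightarrow>
     f \<in> borel_measurable borel \<and>
     (\<exists>g. approximating_steps M \<Lambda> f g \<and>
        tendsto_in_prob M (\<lambda>n. step_integral \<Lambda> (g n) UNIV) Z)"


section \<open>The well-balanced Ornstein-Uhlenbeck process\<close>

definition wbou_kernel :: "real \<Rightarrow> real \<Rightarrow> real \<Rightarrow> real" where
  "wbou_kernel lam t s = exp (- lam * \<bar>t - s\<bar>)"

text \<open>
  The integrals of \<open>\<nu>\<close> from \<open>1\<close> to \<open>\<infinity>\<close> and from \<open>-\<infinity>\<close> to \<open>-1\<close> exclude the end points \<open>1\<close> and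
  \<open>-1\<close>, in accordance with the truncation function \<open>x 1\<^bsub>|x| \<le> 1\<^esub>\<close>.
\<close>

definition wbou_drift :: "real \<Rightarrow> real \<Rightarrow> real measure \<Rightarrow> real" where
  "wbou_drift lam \<gamma> \<nu> =
     2 / lam * \<gamma> + 2 / lam * (measure \<nu> {1<..} - measure \<nu> {..<-1})"

definition wbou_levy_measure :: "real \<Rightarrow> real measure \<Rightarrow> real \<Rightarrow> real measure" where
  "wbou_levy_measure lam \<nu> t =
     measure_of UNIV (sets borel)
       (\<lambda>A. emeasure (\<nu> \<Otimes>\<^sub>M lborel) {(x, s). x * exp (- lam * \<bar>t - s\<bar>) \<in> A - {0}})"

end

theory Submission
  imports Defs "HOL-Real_Asymp.Real_Asymp"
begin

text \<open>
  Write \<open>\<psi>\<close> for the exponent of \<open>L\<close>. Characteristic functions of increments determine the law of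
  \<open>\<Lambda> B\<close> for every bounded Borel set \<open>B\<close>, so the integral of a step function \<open>g\<close> over \<open>A\<close> has
  characteristic function \<open>exp (\<integral>\<^bsub>A\<^esub> \<psi> (u * g s) ds)\<close>. The even function \<open>control\<close> dominates \<open>\<psi>\<close> and is
  finite in mean along \<open>f\<close> as soon as the logarithmic moment of \<open>\<nu>\<close> is finite; then step functions
  converging to \<open>f\<close> fast enough have almost surely convergent integrals, and the limit has exponent
  \<open>\<integral> \<psi> (u * f s) ds\<close>, which is computed by Fubini. That the limit does not depend on the
  approximating sequence follows from a gliding hump: if step functions \<open>k\<^sub>n\<close> tend to \<open>0\<close> a.e., there is
  a set \<open>A\<close> such that along one subsequence their integrals over \<open>A\<close>, and along another their integrals
  over \<open>- A\<close>, tend to \<open>0\<close>. Infinite divisibility holds because replacing \<open>lam\<close> by \<open>n * lam\<close>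
  divides the exponent by \<open>n\<close>.

  Conversely, if the stated \<open>\<nu>\<^sub>X\<close> is a Levy measure, then the logarithmic moment is finite for
  \<open>lam > 0\<close>, and \<open>\<nu> = 0\<close> for \<open>lam \<le> 0\<close>. In the latter case the kernel is at least \<open>1\<close>: a Gaussian part is
  excluded by Fatou's lemma and a drift by the gliding hump.
\<close>

section \<open>Convergence in probability and characteristic functions\<close>

text \<open>The definition of the integral requires one sequence of step functions to serve every
  Borel set \<open>A\<close>, but otherwise leaves the sequence arbitrary. Nothing is said about
  convergence in any mean sense, so two admissible sequences cannot be compared by an estimate. For
  existence a sequence may be chosen, and a fast one is taken. For uniqueness only convergence over
  all \<open>A\<close> is available; the gliding hump extracts two sets from it, which suffices
  because integrals over \<open>A\<close> and \<open>- A\<close> add up to the integral over the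
  line. The link between analysis and probability is a bound of \<open>norm (1 - char)\<close> by
  \<open>1 + u^2\<close> times a Lebesgue integral of \<open>control\<close>. A quantitative bound
  is needed, rather than mere continuity of characteristic functions, since Borel-Cantelli asks for
  summable tails. For infinite divisibility the n-th root of the law is the law of an integral
  against the same random measure, with a steeper kernel. Thus no law has to be constructed from its
  triplet.\<close>

lemma tendsto_in_prob_AE:
  assumes "prob_space M" and [measurable]: "\<And>n. X n \<in> borel_measurable M" "Y \<in> borel_measurable M"
    and lim: "AE \<omega> in M. (\<lambda>n. X n \<omega>) \<longlonglongrightarrow> Y \<omega>"
  shows "tendsto_in_prob M X Y"
  unfolding tendsto_in_prob_def
proof (intro conjI allI impI)
  fix \<epsilon> :: real assume e: "\<epsilon> > 0"
  interpret prob_space M by fact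
  have "(\<lambda>n. \<integral>\<omega>. indicator {\<omega>\<in>space M. \<bar>X n \<omega> - Y \<omega>\<bar> > \<epsilon>} \<omega> \<partial>M) \<longlonglongrightarrow> (\<integral>\<omega>. 0 \<partial>M :: real)"
  proof (rule integral_dominated_convergence[where w="\<lambda>_. 1"])
    show "AE \<omega> in M. (\<lambda>n. indicator {\<omega>\<in>space M. \<bar>X n \<omega> - Y \<omega>\<bar> > \<epsilon>} \<omega> :: real) \<longlonglongrightarrow> 0"
      using lim
    proof eventually_elim
      fix \<omega> assume "(\<lambda>n. X n \<omega>) \<longlonglongrightarrow> Y \<omega>"
      then have "\<forall>\<^sub>F n in sequentially. dist (X n \<omega>) (Y \<omega>) < \<epsilon>" using e by (rule tendstoD)
      then show "(\<lambda>n. indicator {\<omega>\<in>space M. \<bar>X n \<omega> - Y \<omega>\<bar> > \<epsilon>} \<omega> :: real) \<longlonglongrightarrow> 0"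
        by (intro tendsto_eventually) (auto elim!: eventually_mono simp: dist_real_def indicator_def)
    qed
  qed (auto simp: indicator_def)
  then show "(\<lambda>n. measure M {\<omega> \<in> space M. \<epsilon> < \<bar>X n \<omega> - Y \<omega>\<bar>}) \<longlonglongrightarrow> 0" by simp
qed fact

lemma tendsto_in_prob_subseq:
  "tendsto_in_prob M X Y \<Longrightarrow> strict_mono r \<Longrightarrow> tendsto_in_prob M (\<lambda>n. X (r n)) Y"
  unfolding tendsto_in_prob_def
  by (auto dest: LIMSEQ_subseq_LIMSEQ[where f=r, unfolded comp_def])

lemma tendsto_in_prob_cong_AE:
  assumes "prob_space M" and [measurable]: "\<And>n. X n \<in> borel_measurable M" "\<And>n. X' n \<in> borel_measurable M"
    and "\<And>n. AE \<omega> in M. X n \<omega> = X' n \<omega>" and lim: "tendsto_in_prob M X Y"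
  shows "tendsto_in_prob M X' Y"
proof -
  have [measurable]: "Y \<in> borel_measurable M" using lim by (simp add: tendsto_in_prob_def)
  have "measure M {\<omega> \<in> space M. \<epsilon> < \<bar>X n \<omega> - Y \<omega>\<bar>} = measure M {\<omega> \<in> space M. \<epsilon> < \<bar>X' n \<omega> - Y \<omega>\<bar>}" for n \<epsilon>
    using assms(4)[of n] by (intro measure_eq_AE) (auto elim!: eventually_mono)
  then show ?thesis using lim by (simp add: tendsto_in_prob_def)
qed

lemma tendsto_in_prob_diff:
  assumes "prob_space M" and [measurable]: "\<And>n. X n \<in> borel_measurable M" "\<And>n. X' n \<in> borel_measurable M"
    and lim: "tendsto_in_prob M X Y" "tendsto_in_prob M X' Y'"
  shows "tendsto_in_prob M (\<lambda>n \<omega>. X n \<omega> - X' n \<omega>) (\<lambda>\<omega>. Y \<omega> - Y' \<omega>)"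
proof -
  interpret prob_space M by fact
  have [measurable]: "Y \<in> borel_measurable M" "Y' \<in> borel_measurable M" using lim by (simp_all add: tendsto_in_prob_def)
  show ?thesis unfolding tendsto_in_prob_def
  proof (intro conjI allI impI)
    fix \<epsilon> :: real assume e: "\<epsilon> > 0"
    let ?P = "\<lambda>n. measure M {\<omega> \<in> space M. \<epsilon> / 2 < \<bar>X n \<omega> - Y \<omega>\<bar>}"
    let ?Q = "\<lambda>n. measure M {\<omega> \<in> space M. \<epsilon> / 2 < \<bar>X' n \<omega> - Y' \<omega>\<bar>}"
    show "(\<lambda>n. measure M {\<omega> \<in> space M. \<epsilon> < \<bar>X n \<omega> - X' n \<omega> - (Y \<omega> - Y' \<omega>)\<bar>}) \<longlonglongrightarrow> 0"
    proof (rule tendsto_sandwich[OF _ _ tendsto_const, where h="\<lambda>n. ?P n + ?Q n"])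
      show "(\<lambda>n. ?P n + ?Q n) \<longlonglongrightarrow> 0"
        using lim half_gt_zero[OF e] by (intro tendsto_add_zero) (simp_all only: tendsto_in_prob_def)
      have "measure M {\<omega> \<in> space M. \<epsilon> < \<bar>X n \<omega> - X' n \<omega> - (Y \<omega> - Y' \<omega>)\<bar>} \<le>
          measure M ({\<omega> \<in> space M. \<epsilon> / 2 < \<bar>X n \<omega> - Y \<omega>\<bar>} \<union> {\<omega> \<in> space M. \<epsilon> / 2 < \<bar>X' n \<omega> - Y' \<omega>\<bar>})" for n
        by (intro finite_measure_mono) (auto simp: abs_if split: if_splits)
      also have "\<dots> n \<le> ?P n + ?Q n" for n by (intro measure_Un_le) auto
      finally show "\<forall>\<^sub>F n in sequentially. measure M {\<omega> \<in> space M. \<epsilon> < \<bar>X n \<omega> - X' n \<omega> - (Y \<omega> - Y' \<omega>)\<bar>} \<le> ?P n + ?Q n"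
        by simp
    qed auto
  qed auto
qed

lemma norm_iexp_diff_le: "norm (iexp x - iexp y) \<le> \<bar>x - y\<bar>"
proof -
  have "iexp x - iexp y = iexp y * (iexp (x - y) - 1)"
    by (simp add: algebra_simps flip: exp_add)
  then have "norm (iexp x - iexp y) = norm (iexp (x - y) - 1)" by (simp add: norm_mult)
  also have "\<dots> \<le> \<bar>x - y\<bar>" using iexp_approx1[of "x - y" 0] by simp
  finally show ?thesis .
qed

lemma norm_iexp_diff_le2: "norm (iexp x - iexp y) \<le> 2"
  using norm_triangle_ineq4[of "iexp x" "iexp y"] by simp

lemma char_tendsto_in_prob:
  assumes "prob_space M" and [measurable]: "\<And>n. X n \<in> borel_measurable M"
    and lim: "tendsto_in_prob M X Y"
  shows "(\<lambda>n. char (distr M borel (X n)) u) \<longlonglongrightarrow> char (distr M borel Y) u"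
proof -
  interpret prob_space M by fact
  have [measurable]: "Y \<in> borel_measurable M" using lim by (simp_all add: tendsto_in_prob_def)
  have int: "integrable M (\<lambda>\<omega>. iexp (u * Z \<omega>))" if [measurable]: "Z \<in> borel_measurable M" for Z
    by (intro integrable_const_bound[where B=1]) auto
  have bound: "norm (char (distr M borel (X n)) u - char (distr M borel Y) u) \<le>
      \<bar>u\<bar> * \<delta> + 2 * measure M {\<omega> \<in> space M. \<delta> < \<bar>X n \<omega> - Y \<omega>\<bar>}" if d: "\<delta> > 0" for \<delta> n
  proof -
    let ?S = "{\<omega> \<in> space M. \<delta> < \<bar>X n \<omega> - Y \<omega>\<bar>}"
    have "char (distr M borel (X n)) u - char (distr M borel Y) u
       = (CLINT \<omega>|M. iexp (u * X n \<omega>) - iexp (u * Y \<omega>))"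
      by (simp add: char_def integral_distr int Bochner_Integration.integral_diff del: of_real_mult)
    also have "norm \<dots> \<le> (\<integral>\<omega>. norm (iexp (u * X n \<omega>) - iexp (u * Y \<omega>)) \<partial>M)"
      by (rule integral_norm_bound)
    also have "\<dots> \<le> (\<integral>\<omega>. \<bar>u\<bar> * \<delta> + 2 * indicator ?S \<omega> \<partial>M)"
    proof (rule integral_mono)
      fix \<omega> assume w: "\<omega> \<in> space M"
      show "norm (iexp (u * X n \<omega>) - iexp (u * Y \<omega>)) \<le> \<bar>u\<bar> * \<delta> + 2 * indicator ?S \<omega>"
      proof (cases "\<omega> \<in> ?S")
        case True
        then show ?thesis using norm_iexp_diff_le2[of "u * X n \<omega>" "u * Y \<omega>"] d
          by (simp add: add_increasing)
      next
        case False
        have "norm (iexp (u * X n \<omega>) - iexp (u * Y \<omega>)) \<le> \<bar>u * X n \<omega> - u * Y \<omega>\<bar>" by (rule norm_iexp_diff_le)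
        also have "\<dots> = \<bar>u\<bar> * \<bar>X n \<omega> - Y \<omega>\<bar>" by (simp add: abs_mult flip: right_diff_distrib)
        also have "\<dots> \<le> \<bar>u\<bar> * \<delta>" using False w by (intro mult_left_mono) auto
        finally show ?thesis using False by simp
      qed
    qed (auto intro!: integrable_norm Bochner_Integration.integrable_diff Bochner_Integration.integrable_add integrable_mult_right int simp: emeasure_eq_measure simp del: of_real_mult)
    also have "\<dots> = \<bar>u\<bar> * \<delta> + 2 * measure M ?S"
      by (subst Bochner_Integration.integral_add) (auto simp: prob_space emeasure_eq_measure intro!: integrable_mult_right)
    finally show ?thesis .
  qed
  show ?thesis unfolding LIMSEQ_iff
  proof (intro allI impI)
    fix r :: real assume r: "r > 0"
    \<comment> \<open>The summand 1 keeps the denominator positive at \<open>u = 0\<close>. Each of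
      the two error terms is then at most \<open>r / 2\<close>.\<close>
    define \<delta> where "\<delta> = r / (2 * (\<bar>u\<bar> + 1))"
    have d: "\<delta> > 0" using r by (simp add: \<delta>_def)
    have ud: "\<bar>u\<bar> * \<delta> \<le> r / 2" using r by (simp add: \<delta>_def field_simps)
    have "(\<lambda>n. measure M {\<omega> \<in> space M. \<delta> < \<bar>X n \<omega> - Y \<omega>\<bar>}) \<longlonglongrightarrow> 0"
      using lim d by (simp add: tendsto_in_prob_def)
    then have "\<forall>\<^sub>F n in sequentially. measure M {\<omega> \<in> space M. \<delta> < \<bar>X n \<omega> - Y \<omega>\<bar>} < r / 4"
      using r by (intro order_tendstoD) auto
    then obtain N where N: "\<And>n. n \<ge> N \<Longrightarrow> measure M {\<omega> \<in> space M. \<delta> < \<bar>X n \<omega> - Y \<omega>\<bar>} < r / 4"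
      by (auto simp: eventually_sequentially)
    show "\<exists>N. \<forall>n\<ge>N. norm (char (distr M borel (X n)) u - char (distr M borel Y) u) < r"
    proof (intro exI allI impI)
      fix n assume "n \<ge> N"
      from N[OF this] show "norm (char (distr M borel (X n)) u - char (distr M borel Y) u) < r"
        using bound[OF d, of n] ud by linarith
    qed
  qed
qed

lemma AE_eq_const_if_char:
  assumes "prob_space M" and [measurable]: "Y \<in> borel_measurable M"
    and c: "\<And>u. char (distr M borel Y) u = iexp (u * c)"
  shows "AE \<omega> in M. Y \<omega> = c"
proof -
  interpret prob_space M by fact
  have "distr M borel Y = distr M borel (\<lambda>_. c)"
  proof (rule Levy_uniqueness)
    show "real_distribution (distr M borel Y)" "real_distribution (distr M borel (\<lambda>_. c))"
      using prob_space.real_distribution_distr[OF assms(1), of Y] prob_space.real_distribution_distr[OF assms(1), of "\<lambda>_. c"] by simp_all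
    show "char (distr M borel Y) = char (distr M borel (\<lambda>_. c))"
      by (rule ext) (simp add: c, simp add: char_def integral_return)
  qed
  moreover have "AE x in distr M borel (\<lambda>_. c). x = c" by (subst AE_distr_iff) auto
  ultimately have "AE x in distr M borel Y. x = c" by (simp only:)
  then show ?thesis by (subst (asm) AE_distr_iff) auto
qed

section \<open>From bounds on characteristic functions to almost sure convergence\<close>

text \<open>
  Averaging \<open>1 - char\<close> against the normal law with standard deviation \<open>\<delta>\<close> gives the
  expectation of \<open>1 - exp (- (\<delta> Z)\<^sup>2 / 2)\<close>, which controls the tail of \<open>Z\<close>.
\<close>

lemma tail_bound_char:
  assumes "prob_space M" and [measurable]: "Z \<in> borel_measurable M"
    and C: "\<And>u. norm (1 - char (distr M borel Z) u) \<le> (1 + u^2) * C" and e: "\<epsilon> > 0"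
  shows "measure M {\<omega>\<in>space M. \<bar>Z \<omega>\<bar> > \<epsilon>} \<le> (2 + 4 / \<epsilon>^2) * C"
proof -
  interpret prob_space M by fact
  let ?N = "std_normal_distribution"
  interpret N: real_distribution ?N by (rule real_dist_normal_dist)
  interpret P: pair_prob_space ?N M ..
  \<comment> \<open>With this scale, \<open>|Z| > \<epsilon>\<close> implies
    \<open>(\<delta> * Z)^2 / 2 \<ge> 1\<close>, where \<open>1 - exp (-1) \<ge> 1 / 2\<close>
    causes the factor 2 of the bound. The factor
    \<open>1 + \<delta>^2 = 1 + 2 / \<epsilon>^2\<close> is the mean of
    \<open>1 + (\<delta> * x)^2\<close> under the standard normal law.\<close>
  define \<delta> where "\<delta> = sqrt 2 / \<epsilon>"
  have d2: "\<delta>^2 = 2 / \<epsilon>^2" using e by (simp add: \<delta>_def power_divide)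
  have d: "\<delta> > 0" using e by (simp add: \<delta>_def)
  have intP: "integrable (?N \<Otimes>\<^sub>M M) (\<lambda>(x, \<omega>). iexp (\<delta> * x * Z \<omega>))"
    by (intro P.integrable_const_bound[where B=1]) (auto simp: case_prod_beta simp del: of_real_mult)
  have C0: "C \<ge> 0" using C[of 0] norm_ge_zero[of "1 - char (distr M borel Z) 0"] by (simp del: norm_ge_zero)
  have ch: "char (distr M borel Z) u = (CLINT \<omega>|M. iexp (u * Z \<omega>))" for u
    by (simp add: char_def integral_distr)
  have "(CLINT x|?N. char (distr M borel Z) (\<delta> * x)) = (CLINT \<omega>|M. CLINT x|?N. iexp (\<delta> * x * Z \<omega>))"
    unfolding ch using P.Fubini_integral[of "\<lambda>x \<omega>. iexp (\<delta> * x * Z \<omega>)"] intP by simp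
  also have "\<dots> = (CLINT \<omega>|M. complex_of_real (exp (- ((\<delta> * Z \<omega>)^2) / 2)))"
  proof (intro Bochner_Integration.integral_cong refl)
    fix \<omega>
    have "(CLINT x|?N. iexp (\<delta> * x * Z \<omega>)) = char ?N (\<delta> * Z \<omega>)"
      unfolding char_def by (simp add: mult_ac)
    then show "(CLINT x|?N. iexp (\<delta> * x * Z \<omega>)) = complex_of_real (exp (- ((\<delta> * Z \<omega>)^2) / 2))"
      by (simp add: char_std_normal_distribution)
  qed
  also have "\<dots> = complex_of_real (\<integral>\<omega>. exp (- ((\<delta> * Z \<omega>)^2) / 2) \<partial>M)"
    by (rule integral_complex_of_real)
  finally have eq: "(CLINT x|?N. char (distr M borel Z) (\<delta> * x)) = complex_of_real (\<integral>\<omega>. exp (- ((\<delta> * Z \<omega>)^2) / 2) \<partial>M)" .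
  interpret DZ: real_distribution "distr M borel Z" by (auto intro!: real_distribution_distr)
  have intc: "integrable ?N (\<lambda>x. char (distr M borel Z) (\<delta> * x))"
    by (intro N.integrable_const_bound[where B=1]) (auto intro: DZ.cmod_char_le_1)
  have inte: "integrable M (\<lambda>\<omega>. exp (- ((\<delta> * Z \<omega>)^2) / 2))"
    by (intro integrable_const_bound[where B=1]) auto
  have "1 - (\<integral>\<omega>. exp (- ((\<delta> * Z \<omega>)^2) / 2) \<partial>M) = norm (complex_of_real (1 - (\<integral>\<omega>. exp (- ((\<delta> * Z \<omega>)^2) / 2) \<partial>M)))"
  proof -
    have "(\<integral>\<omega>. exp (- ((\<delta> * Z \<omega>)^2) / 2) \<partial>M) \<le> (\<integral>\<omega>. 1 \<partial>M)"
      by (intro integral_mono inte) auto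
    then show ?thesis by (simp add: prob_space del: of_real_diff)
  qed
  also have "complex_of_real (1 - (\<integral>\<omega>. exp (- ((\<delta> * Z \<omega>)^2) / 2) \<partial>M)) = (CLINT x|?N. 1 - char (distr M borel Z) (\<delta> * x))"
    using intc N.prob_space by (simp add: eq)
  also have "norm \<dots> \<le> (\<integral>x. norm (1 - char (distr M borel Z) (\<delta> * x)) \<partial>?N)" by (rule integral_norm_bound)
  also have "\<dots> \<le> (\<integral>x. (1 + \<delta>^2 * x^2) * C \<partial>?N)"
    using C[of "\<delta> * x" for x] integrable_std_normal_distribution_moment[of 2] intc N.prob_space
    by (intro integral_mono) (auto simp: power_mult_distrib)
  also have "\<dots> = (1 + \<delta>^2) * C"
    using std_normal_distribution_even_moments[of 1] N.prob_space by (simp add: fact_numeral)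
  finally have main: "1 - (\<integral>\<omega>. exp (- ((\<delta> * Z \<omega>)^2) / 2) \<partial>M) \<le> (1 + \<delta>^2) * C" .
  have "measure M {\<omega>\<in>space M. \<bar>Z \<omega>\<bar> > \<epsilon>} = (\<integral>\<omega>. indicator {\<omega>\<in>space M. \<bar>Z \<omega>\<bar> > \<epsilon>} \<omega> \<partial>M)" by simp
  also have "\<dots> \<le> (\<integral>\<omega>. 2 * (1 - exp (- ((\<delta> * Z \<omega>)^2) / 2)) \<partial>M)"
  proof (rule integral_mono)
    fix \<omega>
    show "indicator {\<omega>\<in>space M. \<bar>Z \<omega>\<bar> > \<epsilon>} \<omega> \<le> 2 * (1 - exp (- ((\<delta> * Z \<omega>)^2) / 2))"
    proof (cases "\<bar>Z \<omega>\<bar> > \<epsilon>")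
      case True
      have "\<epsilon>^2 \<le> (Z \<omega>)^2" using True e by (simp add: abs_le_square_iff[symmetric])
      then have "(\<delta> * Z \<omega>)^2 / 2 \<ge> 1" using e by (simp add: power_mult_distrib d2 field_simps)
      then have "exp (- ((\<delta> * Z \<omega>)^2) / 2) \<le> exp (-1)" by simp
      also have "exp (-1 :: real) \<le> 1 / 2" using exp_ge_add_one_self[of 1] by (simp add: exp_minus field_simps)
      finally show ?thesis by (auto simp: indicator_def)
    qed (auto simp: indicator_def)
  qed (use inte in \<open>auto simp: emeasure_eq_measure intro!: integrable_mult_right\<close>)
  also have "\<dots> = 2 * (1 - (\<integral>\<omega>. exp (- ((\<delta> * Z \<omega>)^2) / 2) \<partial>M))"
    using inte by (simp add: prob_space)
  also have "\<dots> \<le> 2 * ((1 + \<delta>^2) * C)" using main by simp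
  also have "\<dots> = (2 + 4 / \<epsilon>^2) * C" by (simp add: d2 algebra_simps)
  finally show ?thesis .
qed

text \<open>By Borel-Cantelli the increments are eventually below a geometric sequence, and
  \<open>X n\<close> is \<open>X 0\<close> plus the telescoping sum of its increments.\<close>

lemma AE_convergent_if_summable:
  assumes "prob_space M" and [measurable]: "\<And>n. X n \<in> borel_measurable M"
    and s: "summable (\<lambda>n. measure M {\<omega>\<in>space M. \<bar>X (Suc n) \<omega> - X n \<omega>\<bar> > (1/2::real)^n})"
  shows "AE \<omega> in M. convergent (\<lambda>n. X n \<omega>)"
proof -
  interpret prob_space M by fact
  let ?A = "\<lambda>n. {\<omega>\<in>space M. \<bar>X (Suc n) \<omega> - X n \<omega>\<bar> > (1/2::real)^n}"
  have "AE \<omega> in M. \<forall>\<^sub>F n in sequentially. \<omega> \<in> space M - ?A n"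
  proof (rule borel_cantelli_AE1)
    show "summable (\<lambda>n. measure M (?A n))" by fact
  qed (auto simp: emeasure_eq_measure)
  then show ?thesis
  proof eventually_elim
    fix \<omega> assume "\<forall>\<^sub>F n in sequentially. \<omega> \<in> space M - ?A n"
    then have ev: "\<forall>\<^sub>F n in sequentially. norm (X (Suc n) \<omega> - X n \<omega>) \<le> (1/2)^n"
      by (auto elim!: eventually_mono)
    have "summable (\<lambda>n. X (Suc n) \<omega> - X n \<omega>)"
      by (rule summable_comparison_test_ev[OF ev]) (simp add: summable_geometric)
    then have "convergent (\<lambda>n. \<Sum>i<n. X (Suc i) \<omega> - X i \<omega>)"
      by (simp add: summable_iff_convergent)
    then have "convergent (\<lambda>n. X 0 \<omega> + (\<Sum>i<n. X (Suc i) \<omega> - X i \<omega>))"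
      by (intro convergent_add convergent_const)
    then show "convergent (\<lambda>n. X n \<omega>)" by (simp only: sum_lessThan_telescope[of "\<lambda>n. X n \<omega>"]) simp
  qed
qed

section \<open>A gliding hump for null sequences of integrable functions\<close>

text \<open>
  A gliding hump: the sets \<open>E j\<close> below exhaust the line, and \<open>n\<^sub>i\<close> and \<open>j\<^sub>i\<close> are chosen alternately so
  that \<open>q n\<^sub>i\<close> is concentrated on \<open>E j\<^bsub>i+1\<^esub> - E j\<^sub>i\<close>. The set \<open>A\<close> collects every other shell.
\<close>

lemma split_null_sequence:
  fixes q :: "nat \<Rightarrow> real \<Rightarrow> real"
  assumes int: "\<And>n. integrable lborel (q n)" and nonneg: "\<And>n s. 0 \<le> q n s"
    and lim: "AE s in lborel. (\<lambda>n. q n s) \<longlonglongrightarrow> 0"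
  obtains A r r' where "A \<in> sets borel" "strict_mono r" "strict_mono r'"
    "(\<lambda>i. LINT s:A|lborel. q (r i) s) \<longlonglongrightarrow> 0" "(\<lambda>i. LINT s:-A|lborel. q (r' i) s) \<longlonglongrightarrow> 0"
proof -
  have [measurable]: "q n \<in> borel_measurable borel" for n using int[of n] by auto
  \<comment> \<open>On \<open>E j\<close> all the \<open>q n\<close> share the bound
    \<open>j\<close> and a bounded domain, so dominated convergence in \<open>n\<close> applies
    there. Off \<open>E j\<close>, each single \<open>q n\<close> dominates itself as
    \<open>j\<close> grows. The sets exhaust the line up to a null set because convergent sequences
    are bounded.\<close>
  define E where "E j = {s. \<bar>s\<bar> \<le> real j \<and> (\<forall>n. q n s \<le> real j)}" for j
  have [measurable]: "E j \<in> sets borel" for j unfolding E_def by measurable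
  have E_mono: "E i \<subseteq> E j" if "i \<le> j" for i j unfolding E_def using that by (auto intro: order_trans[of _ "real i"])
  have E_ev: "AE s in lborel. \<forall>\<^sub>F j in sequentially. s \<in> E j"
    using lim
  proof eventually_elim
    fix s assume lim_s: "(\<lambda>n. q n s) \<longlonglongrightarrow> 0"
    obtain K where K: "\<And>n. \<bar>q n s\<bar> \<le> K"
      using convergent_imp_Bseq[OF convergentI[OF lim_s]] unfolding Bseq_def by auto
    obtain j where j: "real j \<ge> max K \<bar>s\<bar>" using real_arch_simple by blast
    have "q n s \<le> real j" for n using K[of n] j by linarith
    then have "s \<in> E j" using j by (auto simp: E_def)
    then show "\<forall>\<^sub>F j in sequentially. s \<in> E j"
      using E_mono by (auto simp: eventually_sequentially)
  qed
  have le: "(LINT s:S|lborel. q n s) \<le> (LINT s:U|lborel. q n s) + (LINT s:V|lborel. q n s)"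
    if "S \<subseteq> U \<union> V" and [measurable]: "S \<in> sets borel" "U \<in> sets borel" "V \<in> sets borel" for S U V n
  proof -
    have i: "integrable lborel (\<lambda>s. indicator T s * q n s)" if [measurable]: "T \<in> sets borel" for T
      using integrable_mult_indicator[of T lborel "q n"] int by simp
    have "(LINT s:S|lborel. q n s) \<le> (\<integral>s. indicator U s * q n s + indicator V s * q n s \<partial>lborel)"
      unfolding set_lebesgue_integral_def real_scaleR_def
      by (intro integral_mono i Bochner_Integration.integrable_add)
        (use that nonneg in \<open>auto simp: indicator_def\<close>)
    then show ?thesis by (simp add: set_lebesgue_integral_def i)
  qed
  have in_E: "(\<lambda>n. LINT s:E j|lborel. q n s) \<longlonglongrightarrow> 0" for j
  proof -
    have "(\<lambda>n. LINT s:E j|lborel. q n s) \<longlonglongrightarrow> (\<integral>s. 0 \<partial>(lborel :: real measure))"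
      unfolding set_lebesgue_integral_def real_scaleR_def
    proof (rule integral_dominated_convergence[where w="\<lambda>s. real j * indicator {- real j..real j} s"])
      show "AE s in lborel. (\<lambda>n. indicator (E j) s * q n s) \<longlonglongrightarrow> 0"
        using lim by eventually_elim (auto intro!: tendsto_mult_right_zero)
      show "AE s in lborel. norm (indicator (E j) s * q n s) \<le> real j * indicator {- real j..real j} s" for n
        using nonneg by (intro AE_I2) (auto simp: indicator_def E_def abs_le_iff)
    qed auto
    then show ?thesis by simp
  qed
  have off_E: "(\<lambda>j. LINT s:-E j|lborel. q n s) \<longlonglongrightarrow> 0" for n
  proof -
    have "(\<lambda>j. LINT s:-E j|lborel. q n s) \<longlonglongrightarrow> (\<integral>s. 0 \<partial>(lborel :: real measure))"
      unfolding set_lebesgue_integral_def real_scaleR_def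
    proof (rule integral_dominated_convergence[where w="q n"])
      show "AE s in lborel. (\<lambda>j. indicator (- E j) s * q n s) \<longlonglongrightarrow> 0"
        using E_ev by eventually_elim (auto intro!: tendsto_eventually elim!: eventually_mono)
      show "AE s in lborel. norm (indicator (- E j) s * q n s) \<le> q n s" for j
        using nonneg by (intro AE_I2) (auto simp: indicator_def)
    qed (use int in auto)
    then show ?thesis by simp
  qed
  \<comment> \<open>A state is a pair \<open>(n, j)\<close>. The invariant says that
    \<open>q n\<close> has little mass on \<open>E j\<close>; the relation to the next state says
    that the next \<open>E\<close> leaves little mass of the same \<open>q n\<close> outside. Given
    a state, the next \<open>j\<close> is chosen for the old \<open>n\<close>, and then the next
    \<open>n\<close> for the new \<open>j\<close>.\<close>
  have "\<exists>f. \<forall>i. (LINT s:E (snd (f i))|lborel. q (fst (f i)) s) \<le> 1 / real (Suc i) \<and>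
      (fst (f i) < fst (f (Suc i)) \<and> snd (f i) \<le> snd (f (Suc i)) \<and>
       (LINT s:-E (snd (f (Suc i)))|lborel. q (fst (f i)) s) \<le> 1 / real (Suc i))"
  proof (rule dependent_nat_choice)
    have ev: "\<forall>\<^sub>F n in sequentially. (LINT s:E j|lborel. q n s) < 1 / real (Suc i)" for i j
      using in_E[of j] by (rule order_tendstoD) auto
    show "\<exists>x. (LINT s:E (snd x)|lborel. q (fst x) s) \<le> 1 / real (Suc 0)"
    proof -
      obtain n where "(LINT s:E 0|lborel. q n s) < 1 / real (Suc 0)"
        using ev[of 0 0] by (auto simp: eventually_sequentially)
      then show ?thesis by (intro exI[of _ "(n, 0)"]) auto
    qed
    fix x :: "nat \<times> nat" and i
    have "\<forall>\<^sub>F j in sequentially. (LINT s:-E j|lborel. q (fst x) s) < 1 / real (Suc i)"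
      using off_E[of "fst x"] by (rule order_tendstoD) auto
    then have "\<forall>\<^sub>F j in sequentially. (LINT s:-E j|lborel. q (fst x) s) < 1 / real (Suc i) \<and> snd x \<le> j"
      using eventually_ge_at_top by (rule eventually_conj)
    then obtain j where j: "(LINT s:-E j|lborel. q (fst x) s) < 1 / real (Suc i)" "snd x \<le> j"
      by (auto simp: eventually_sequentially)
    have "\<forall>\<^sub>F n in sequentially. (LINT s:E j|lborel. q n s) < 1 / real (Suc (Suc i)) \<and> fst x < n"
      using ev eventually_gt_at_top by (rule eventually_conj)
    then obtain n where "(LINT s:E j|lborel. q n s) < 1 / real (Suc (Suc i))" "fst x < n"
      by (auto simp: eventually_sequentially)
    then show "\<exists>y. (LINT s:E (snd y)|lborel. q (fst y) s) \<le> 1 / real (Suc (Suc i)) \<and>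
        fst x < fst y \<and> snd x \<le> snd y \<and> (LINT s:-E (snd y)|lborel. q (fst x) s) \<le> 1 / real (Suc i)"
      using j by (intro exI[of _ "(n, j)"]) auto
  qed
  then obtain f where F: "\<forall>i. (LINT s:E (snd (f i))|lborel. q (fst (f i)) s) \<le> 1 / real (Suc i) \<and>
      (fst (f i) < fst (f (Suc i)) \<and> snd (f i) \<le> snd (f (Suc i)) \<and>
       (LINT s:-E (snd (f (Suc i)))|lborel. q (fst (f i)) s) \<le> 1 / real (Suc i))" ..
  have f: "(LINT s:E (snd (f i))|lborel. q (fst (f i)) s) \<le> 1 / real (Suc i)"
      "fst (f i) < fst (f (Suc i))" "snd (f i) \<le> snd (f (Suc i))"
      "(LINT s:-E (snd (f (Suc i)))|lborel. q (fst (f i)) s) \<le> 1 / real (Suc i)" for i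
    using F[rule_format, of i] by simp_all
  define n where "n i = fst (f i)" for i
  define j where "j i = snd (f i)" for i
  have n: "strict_mono n" using f(2) by (simp add: strict_mono_Suc_iff n_def)
  have "j i \<le> j k" if "i \<le> k" for i k
    by (rule lift_Suc_mono_le[of j, OF _ that]) (simp add: f(3) j_def)
  then have Ej: "E (j i) \<subseteq> E (j k)" if "i \<le> k" for i k using that by (intro E_mono)
  \<comment> \<open>\<open>A\<close> consists of the even-numbered shells. The odd-numbered
    \<open>q (n i)\<close> concentrate on odd shells, hence off \<open>A\<close>, and the
    even-numbered ones on \<open>A\<close> itself, hence off \<open>- A\<close>. This decides which
    subsequence belongs to which set.\<close>
  define A where "A = (\<Union>i. E (j (Suc (2 * i))) - E (j (2 * i)))"
  have [measurable]: "A \<in> sets borel" unfolding A_def by measurable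
  have small: "(\<lambda>i. LINT s:S|lborel. q (n (k i)) s) \<longlonglongrightarrow> 0"
    if k: "strict_mono k" and S: "\<And>i. S \<subseteq> E (j (k i)) \<union> - E (j (Suc (k i)))" and [measurable]: "S \<in> sets borel" for S k
  proof (rule tendsto_sandwich[OF _ _ tendsto_const])
    have "(LINT s:S|lborel. q (n i) s) \<le> 2 / real (Suc i)" if "i \<in> range k" for i
    proof -
      have "(LINT s:S|lborel. q (n i) s) \<le> (LINT s:E (j i)|lborel. q (n i) s) + (LINT s:-E (j (Suc i))|lborel. q (n i) s)"
        using that S by (intro le) auto
      also have "\<dots> \<le> 2 / real (Suc i)" using f(1)[of i] f(4)[of i] by (simp add: n_def j_def)
      finally show ?thesis .
    qed
    then show "\<forall>\<^sub>F i in sequentially. (LINT s:S|lborel. q (n (k i)) s) \<le> 2 / real (Suc (k i))" by simp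
    have "(\<lambda>i. 2 / real (Suc i)) \<longlonglongrightarrow> 0"
      using tendsto_mult_right_zero[OF LIMSEQ_inverse_real_of_nat, of 2] by (simp add: divide_inverse)
    from LIMSEQ_subseq_LIMSEQ[OF this k] show "(\<lambda>i. 2 / real (Suc (k i))) \<longlonglongrightarrow> 0" by (simp add: comp_def)
    show "\<forall>\<^sub>F i in sequentially. 0 \<le> (LINT s:S|lborel. q (n (k i)) s)"
      by (auto intro!: always_eventually Bochner_Integration.integral_nonneg mult_nonneg_nonneg nonneg simp: set_lebesgue_integral_def)
  qed
  show thesis
  proof
    show "A \<in> sets borel" by simp
    show "strict_mono (\<lambda>i. n (Suc (2 * i)))" "strict_mono (\<lambda>i. n (2 * i))"
      using n by (auto simp: strict_mono_def)
    show "(\<lambda>i. LINT s:A|lborel. q (n (Suc (2 * i))) s) \<longlonglongrightarrow> 0"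
    proof (rule small)
      show "A \<subseteq> E (j (Suc (2 * m))) \<union> - E (j (Suc (Suc (2 * m))))" for m
      proof
        fix x assume "x \<in> A"
        then obtain i where i: "x \<in> E (j (Suc (2 * i)))" "x \<notin> E (j (2 * i))" by (auto simp: A_def)
        show "x \<in> E (j (Suc (2 * m))) \<union> - E (j (Suc (Suc (2 * m))))"
          using i Ej[of "Suc (2 * i)" "Suc (2 * m)"] Ej[of "Suc (Suc (2 * m))" "2 * i"]
          by (cases "i \<le> m") auto
      qed
    qed (auto simp: strict_mono_def)
    show "(\<lambda>i. LINT s:-A|lborel. q (n (2 * i)) s) \<longlonglongrightarrow> 0"
      by (rule small) (auto simp: strict_mono_def A_def)
  qed
qed

section \<open>Levy exponents\<close>

text \<open>Here \<open>x\<close> is a jump and \<open>y\<close> its multiplier. The two cases are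
  the second-order Taylor bound for compensated jumps and the bound of
  \<open>norm (iexp (x * y) - 1)\<close> for the others. Unlike the integrand itself, this bound is
  increasing in \<open>|y|\<close>, so a bound on the multiplier yields an integrable
  majorant.\<close>

definition levy_kernel :: "real \<Rightarrow> real \<Rightarrow> real" where
  "levy_kernel x y = (if \<bar>x\<bar> \<le> 1 then x^2 * y^2 else min 2 \<bar>x * y\<bar>)"

definition levy_integrand :: "real \<Rightarrow> real \<Rightarrow> complex" where
  "levy_integrand u x = iexp (u * x) - 1 - \<i> * of_real (u * x * indicator {-1..1} x)"

lemma levy_exponent_eq:
  "levy_exponent a b \<rho> u = \<i> * of_real (u * a) - of_real (b * u^2 / 2) + (CLINT x|\<rho>. levy_integrand u x)"
  by (simp add: levy_exponent_def levy_integrand_def)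

lemma levy_kernel_measurable [measurable]:
  "(\<lambda>(x, y). levy_kernel x y) \<in> borel_measurable (borel \<Otimes>\<^sub>M borel)"
  unfolding levy_kernel_def by measurable

lemma levy_integrand_measurable [measurable]:
  "(\<lambda>(u, x). levy_integrand u x) \<in> borel_measurable (borel \<Otimes>\<^sub>M borel)"
  unfolding levy_integrand_def by measurable

lemma levy_kernel_nonneg: "0 \<le> levy_kernel x y"
  by (auto simp: levy_kernel_def)

lemma levy_kernel_0 [simp]: "levy_kernel x 0 = 0"
  by (auto simp: levy_kernel_def)

lemma levy_kernel_le_min: "levy_kernel x y \<le> (2 + y^2) * min 1 (x^2)"
proof (cases "\<bar>x\<bar> \<le> 1")
  case True
  then have "x^2 \<le> 1" by (simp add: abs_square_le_1)
  then show ?thesis using True by (simp add: levy_kernel_def algebra_simps)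
next
  case False
  then have "x^2 \<ge> 1" by (metis abs_square_le_1 linear)
  then show ?thesis using False by (simp add: levy_kernel_def min_le_iff_disj add_increasing2)
qed

lemma levy_kernel_mono: "\<bar>y\<bar> \<le> \<bar>z\<bar> \<Longrightarrow> levy_kernel x y \<le> levy_kernel x z"
  by (cases "\<bar>x\<bar> \<le> 1")
    (auto simp: levy_kernel_def abs_le_square_iff[symmetric] abs_mult intro!: mult_left_mono min.coboundedI2)

lemma abs_le_one_plus_square: "\<bar>u::real\<bar> \<le> 1 + u^2"
  using zero_le_power2[of "\<bar>u\<bar> - 1"] zero_le_power2[of u] unfolding power2_diff by simp

lemma levy_kernel_scale: "levy_kernel x (u * y) \<le> (1 + u^2) * levy_kernel x y"
proof (cases "\<bar>x\<bar> \<le> 1")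
  case True
  then show ?thesis by (simp add: levy_kernel_def power_mult_distrib algebra_simps)
next
  case False
  have "\<bar>u\<bar> * \<bar>x * y\<bar> \<le> (1 + u^2) * \<bar>x * y\<bar>" by (intro mult_right_mono abs_le_one_plus_square) auto
  then have "min 2 (\<bar>u\<bar> * \<bar>x * y\<bar>) \<le> min ((1 + u^2) * 2) ((1 + u^2) * \<bar>x * y\<bar>)"
    by (intro min.mono) auto
  also have "\<dots> = (1 + u^2) * min 2 \<bar>x * y\<bar>" by (simp add: mult_min_right)
  finally show ?thesis using False by (simp add: levy_kernel_def abs_mult mult_ac)
qed

lemma norm_levy_integrand_le: "norm (levy_integrand u x) \<le> levy_kernel x u"
proof (cases "\<bar>x\<bar> \<le> 1")
  case True
  then have "norm (levy_integrand u x) = norm (iexp (u * x) - (\<Sum>k\<le>1. (\<i> * of_real (u * x))^k / fact k))"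
    by (simp add: levy_integrand_def indicator_def abs_le_iff algebra_simps)
  also have "\<dots> \<le> \<bar>u * x\<bar>^2 / 2"
    using iexp_approx1[of "u * x" 1] by (simp add: numeral_2_eq_2 del: of_real_mult)
  also have "\<dots> \<le> levy_kernel x u" using True by (simp add: levy_kernel_def power_mult_distrib mult.commute)
  finally show ?thesis .
next
  case False
  then have x0: "indicator {-1..1} x = (0::real)" by (auto simp: indicator_def)
  have "norm (iexp (u * x) - 1) \<le> \<bar>u * x\<bar>" using iexp_approx1[of "u * x" 0] by simp
  moreover have "norm (iexp (u * x) - 1) \<le> 2"
    using norm_triangle_ineq4[of "iexp (u * x)" 1] by simp
  ultimately show ?thesis
    using False by (simp add: levy_kernel_def levy_integrand_def x0 mult.commute)
qed

text \<open>This transfers integrability of \<open>levy_kernel\<close> to the truncated second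
  moment of the scaled jump \<open>x * y\<close>. For \<open>|x| > 1\<close> it rests on
  \<open>min 1 (z^2) \<le> |z|\<close>.\<close>

lemma min_le_levy_kernel:
  assumes "\<bar>y\<bar> \<le> 1" shows "min 1 ((x * y)^2) \<le> levy_kernel x y"
proof (cases "\<bar>x\<bar> \<le> 1")
  case True
  then show ?thesis by (simp add: levy_kernel_def power_mult_distrib)
next
  case False
  have "min 1 ((x * y)^2) \<le> \<bar>x * y\<bar>"
  proof (cases "\<bar>x * y\<bar> \<le> 1")
    case True
    then have "\<bar>x * y\<bar> * \<bar>x * y\<bar> \<le> \<bar>x * y\<bar> * 1" by (intro mult_left_mono) auto
    then show ?thesis by (simp add: power2_eq_square min_le_iff_disj)
  qed (auto simp: min_le_iff_disj)
  then show ?thesis using False by (simp add: levy_kernel_def min_le_iff_disj)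
qed

text \<open>The exponentials agree, so only the two compensators remain.\<close>

lemma levy_integrand_truncation:
  "levy_integrand (u * y) x - levy_integrand u (x * y) =
    \<i> * of_real (u * (x * y * (indicator {-1..1} (x * y) - indicator {-1..1} x)))"
proof -
  have "levy_integrand (u * y) x = iexp (u * (x * y)) - 1 - \<i> * of_real (u * (x * y) * indicator {-1..1} x)"
    by (simp add: levy_integrand_def mult_ac)
  then show ?thesis
    unfolding levy_integrand_def by (simp only: of_real_mult of_real_diff) (simp only: ring_distribs mult.assoc, simp)
qed

text \<open>The left half-plane is convex and contains 0, and the derivative of \<open>exp\<close>
  has norm at most 1 on it.\<close>

lemma norm_one_minus_exp_le: "Re z \<le> 0 \<Longrightarrow> norm (1 - exp z) \<le> norm z"
proof -
  assume z: "Re z \<le> 0"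
  have "norm (exp z - exp 0) \<le> 1 * norm (z - 0)"
  proof (rule field_differentiable_bound[where S="{w. Re w \<le> 0}" and f'=exp])
    show "convex {w. Re w \<le> 0}" by (rule convex_halfspace_Re_le)
    show "(exp has_field_derivative exp w) (at w within {w. Re w \<le> 0})" for w
      by (rule DERIV_exp[THEN has_field_derivative_at_within])
  qed (use z in auto)
  then show ?thesis by (simp add: norm_minus_commute)
qed

section \<open>The characteristic exponent and a modular dominating it\<close>

locale levy_triplet =
  fixes a b :: real and \<nu> :: "real measure"
  assumes b_nonneg: "0 \<le> b" and levy: "levy_measure \<nu>"
begin

lemma sets_nu [measurable_cong, simp]: "sets \<nu> = sets borel"
  using levy by (simp add: levy_measure_def)

lemma integrable_min: "integrable \<nu> (\<lambda>x. min 1 (x^2))"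
  using levy by (intro integrableI_nonneg) (auto simp: levy_measure_def)

text \<open>Fubini with Lebesgue measure needs this. By Markov's inequality the level sets of
  \<open>min 1 (x^2)\<close> have finite mass; they miss only the point 0, which is a null set and
  is added to the cover separately.\<close>

sublocale nu: sigma_finite_measure \<nu>
proof
  let ?A = "\<lambda>n::nat. {x. 1 / real (Suc n) \<le> min 1 (x^2)}"
  have fin: "emeasure \<nu> (?A n) \<noteq> \<infinity>" for n
  proof -
    have "emeasure \<nu> (?A n) = (\<integral>\<^sup>+x. indicator (?A n) x \<partial>\<nu>)" by simp
    also have "\<dots> \<le> (\<integral>\<^sup>+x. ennreal (real (Suc n)) * ennreal (min 1 (x^2)) \<partial>\<nu>)"
    proof (intro nn_integral_mono)
      fix x :: real
      have "indicator (?A n) x \<le> real (Suc n) * min 1 (x^2)"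
        by (auto simp: indicator_def divide_le_eq mult.commute mult_min_right simp del: of_nat_Suc)
      then have "ennreal (indicator (?A n) x) \<le> ennreal (real (Suc n) * min 1 (x^2))" by (rule ennreal_leI)
      then show "indicator (?A n) x \<le> ennreal (real (Suc n)) * ennreal (min 1 (x^2))"
        by (simp add: ennreal_mult ennreal_indicator del: of_nat_Suc)
    qed
    also have "\<dots> = ennreal (real (Suc n)) * (\<integral>\<^sup>+x. ennreal (min 1 (x^2)) \<partial>\<nu>)"
      by (intro nn_integral_cmult) auto
    also have "\<dots> < \<infinity>" using levy by (auto simp: levy_measure_def ennreal_mult_less_top)
    finally show ?thesis by simp
  qed
  have cover: "x \<in> (\<Union>n. ?A n)" if "x \<noteq> 0" for x
  proof -
    have "0 < min 1 (x^2)" using that by auto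
    then obtain n where "inverse (real (Suc n)) < min 1 (x^2)" using reals_Archimedean by blast
    then show ?thesis by (auto simp: inverse_eq_divide intro!: exI[of _ n])
  qed
  have space: "space \<nu> = UNIV" using sets_eq_imp_space_eq[OF sets_nu] by simp
  show "\<exists>A. countable A \<and> A \<subseteq> sets \<nu> \<and> \<Union> A = space \<nu> \<and> (\<forall>a\<in>A. emeasure \<nu> a \<noteq> \<infinity>)"
    using fin cover levy
    by (intro exI[of _ "insert {0} (range ?A)"]) (auto simp: space levy_measure_def)
qed

text \<open>It acts as a modular for integrands: increasing in \<open>|y|\<close>, continuous at 0
  and subadditive up to a constant. The drift, Gaussian and jump parts of the exponent are bounded
  separately, so cancellation between them is given up.\<close>

definition control :: "real \<Rightarrow> real" where
  "control y = \<bar>a\<bar> * \<bar>y\<bar> + b * y^2 + (\<integral>x. levy_kernel x y \<partial>\<nu>)"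

abbreviation \<psi> :: "real \<Rightarrow> complex" where
  "\<psi> \<equiv> levy_exponent a b \<nu>"

lemma integrable_levy_kernel: "integrable \<nu> (\<lambda>x. levy_kernel x y)"
proof (rule Bochner_Integration.integrable_bound)
  show "integrable \<nu> (\<lambda>x. (2 + y^2) * min 1 (x^2))" by (intro integrable_mult_right integrable_min)
  show "AE x in \<nu>. norm (levy_kernel x y) \<le> norm ((2 + y^2) * min 1 (x^2))"
    using levy_kernel_le_min levy_kernel_nonneg by (intro AE_I2) (simp add: abs_of_nonneg)
qed simp

lemma integrable_levy_integrand: "complex_integrable \<nu> (levy_integrand u)"
  by (rule Bochner_Integration.integrable_bound[OF integrable_levy_kernel[of u]])
    (auto simp: norm_levy_integrand_le levy_kernel_nonneg)

lemma psi_0 [simp]: "\<psi> 0 = 0"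
  by (simp add: levy_exponent_def)

lemma control_0 [simp]: "control 0 = 0"
  by (simp add: control_def)

lemma control_nonneg: "0 \<le> control y"
  using b_nonneg by (auto simp: control_def levy_kernel_nonneg intro!: add_nonneg_nonneg Bochner_Integration.integral_nonneg)

lemma control_mono:
  assumes "\<bar>y\<bar> \<le> \<bar>z\<bar>" shows "control y \<le> control z"
proof -
  have "(\<integral>x. levy_kernel x y \<partial>\<nu>) \<le> (\<integral>x. levy_kernel x z \<partial>\<nu>)"
    by (intro integral_mono integrable_levy_kernel levy_kernel_mono assms)
  moreover have "\<bar>a\<bar> * \<bar>y\<bar> \<le> \<bar>a\<bar> * \<bar>z\<bar>" using assms by (intro mult_left_mono) auto
  moreover have "b * y^2 \<le> b * z^2" using assms b_nonneg by (intro mult_left_mono) (auto simp: abs_le_square_iff)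
  ultimately show ?thesis by (simp add: control_def)
qed

text \<open>The factor \<open>1 + u^2\<close> covers both the linear growth (drift, large jumps) and
  the quadratic growth (Gaussian part, small jumps). Being polynomial, it can be averaged against
  the normal law in \<open>tail_bound_char\<close>.\<close>

lemma control_scale: "control (u * y) \<le> (1 + u^2) * control y"
proof -
  have "(\<integral>x. levy_kernel x (u * y) \<partial>\<nu>) \<le> (\<integral>x. (1 + u^2) * levy_kernel x y \<partial>\<nu>)"
    by (intro integral_mono integrable_levy_kernel integrable_mult_right levy_kernel_scale)
  moreover have "\<bar>a\<bar> * \<bar>u * y\<bar> \<le> (1 + u^2) * (\<bar>a\<bar> * \<bar>y\<bar>)"
    using mult_right_mono[OF abs_le_one_plus_square[of u], of "\<bar>a\<bar> * \<bar>y\<bar>"] by (simp add: abs_mult mult_ac)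
  moreover have "b * (u * y)^2 \<le> (1 + u^2) * (b * y^2)"
    using b_nonneg by (simp add: power_mult_distrib algebra_simps)
  ultimately show ?thesis unfolding control_def distrib_left by simp
qed

text \<open>The constant is \<open>1 + 2^2\<close>, since \<open>|y + z|\<close> is at most twice
  the larger of \<open>|y|\<close> and \<open>|z|\<close>.\<close>

lemma control_add: "control (y + z) \<le> 5 * (control y + control z)"
proof -
  have "control (y + z) \<le> control (2 * max \<bar>y\<bar> \<bar>z\<bar>)" by (intro control_mono) auto
  also have "\<dots> \<le> 5 * control (max \<bar>y\<bar> \<bar>z\<bar>)" using control_scale[of 2] by simp
  also have "control (max \<bar>y\<bar> \<bar>z\<bar>) \<le> control y + control z"
    using control_mono[of "\<bar>y\<bar>" y] control_mono[of "\<bar>z\<bar>" z] control_nonneg[of y] control_nonneg[of z]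
    by (auto simp: max_def)
  finally show ?thesis by simp
qed

lemma control_measurable [measurable]: "control \<in> borel_measurable borel"
  unfolding control_def by measurable

lemma psi_measurable [measurable]: "\<psi> \<in> borel_measurable borel"
  unfolding levy_exponent_eq by measurable

lemma tendsto_control_0:
  assumes "y \<longlonglongrightarrow> 0" shows "(\<lambda>n. control (y n)) \<longlonglongrightarrow> 0"
proof -
  obtain K where K: "\<And>n. \<bar>y n\<bar> \<le> K" using convergent_imp_Bseq[OF convergentI[OF assms]] unfolding Bseq_def by auto
  have "(\<lambda>n. \<integral>x. levy_kernel x (y n) \<partial>\<nu>) \<longlonglongrightarrow> (\<integral>x. 0 \<partial>\<nu>)"
  proof (rule integral_dominated_convergence[where w="\<lambda>x. levy_kernel x K"])
    show "AE x in \<nu>. (\<lambda>n. levy_kernel x (y n)) \<longlonglongrightarrow> 0"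
    proof (rule AE_I2)
      fix x
      show "(\<lambda>n. levy_kernel x (y n)) \<longlonglongrightarrow> 0"
      proof (cases "\<bar>x\<bar> \<le> 1")
        case True
        have "(\<lambda>n. x^2 * (y n)^2) \<longlonglongrightarrow> 0"
          by (intro tendsto_mult_right_zero tendsto_null_power assms) simp
        moreover have "(\<lambda>n. levy_kernel x (y n)) = (\<lambda>n. x^2 * (y n)^2)" using True by (simp add: levy_kernel_def)
        ultimately show ?thesis by (simp only:)
      next
        case False
        have "(\<lambda>n. min 2 \<bar>x * y n\<bar>) \<longlonglongrightarrow> min 2 \<bar>x * 0\<bar>" by (intro tendsto_intros assms)
        moreover have "(\<lambda>n. levy_kernel x (y n)) = (\<lambda>n. min 2 \<bar>x * y n\<bar>)" using False by (simp add: levy_kernel_def)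
        ultimately show ?thesis by simp
      qed
    qed
    show "AE x in \<nu>. norm (levy_kernel x (y n)) \<le> levy_kernel x K" for n
      using K[of n] by (intro AE_I2) (auto simp: levy_kernel_nonneg intro!: levy_kernel_mono)
  qed (auto intro: integrable_levy_kernel)
  then have "(\<lambda>n. \<integral>x. levy_kernel x (y n) \<partial>\<nu>) \<longlonglongrightarrow> 0" by simp
  then show ?thesis unfolding control_def
    by (intro tendsto_add_zero tendsto_mult_right_zero tendsto_rabs_zero tendsto_null_power assms) auto
qed

lemma tendsto_psi:
  assumes y: "y \<longlonglongrightarrow> u" shows "(\<lambda>n. \<psi> (y n)) \<longlonglongrightarrow> \<psi> u"
proof -
  obtain K where K: "\<And>n. \<bar>y n\<bar> \<le> K" using convergent_imp_Bseq[OF convergentI[OF assms]] unfolding Bseq_def by auto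
  have "(\<lambda>n. CLINT x|\<nu>. levy_integrand (y n) x) \<longlonglongrightarrow> (CLINT x|\<nu>. levy_integrand u x)"
  proof (rule integral_dominated_convergence[where w="\<lambda>x. levy_kernel x K"])
    show "AE x in \<nu>. (\<lambda>n. levy_integrand (y n) x) \<longlonglongrightarrow> levy_integrand u x"
      unfolding levy_integrand_def by (intro AE_I2 tendsto_intros y)
    show "AE x in \<nu>. norm (levy_integrand (y n) x) \<le> levy_kernel x K" for n
      using K[of n] by (intro AE_I2 order_trans[OF norm_levy_integrand_le]) (auto intro!: levy_kernel_mono)
  qed (auto intro: integrable_levy_kernel)
  then show ?thesis unfolding levy_exponent_eq by (intro tendsto_intros y) simp_all
qed

lemma norm_psi_le: "norm (\<psi> u) \<le> control u"
proof -
  have "norm (CLINT x|\<nu>. levy_integrand u x) \<le> (\<integral>x. levy_kernel x u \<partial>\<nu>)"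
    by (rule order_trans[OF integral_norm_bound])
      (intro integral_mono integrable_norm integrable_levy_integrand integrable_levy_kernel norm_levy_integrand_le)
  moreover have "norm (\<i> * of_real (u * a) - complex_of_real (b * u^2 / 2)) \<le> \<bar>a\<bar> * \<bar>u\<bar> + b * u^2"
    using b_nonneg
    by (intro order_trans[OF norm_triangle_ineq4] add_mono) (auto simp: norm_mult norm_divide norm_power)
  ultimately show ?thesis unfolding levy_exponent_eq control_def by (intro order_trans[OF norm_triangle_ineq]) simp
qed

lemma norm_psi_scale_le: "norm (\<psi> (u * y)) \<le> (1 + u^2) * control y"
  using norm_psi_le control_scale order_trans by blast

lemma Re_psi_nonpos: "Re (\<psi> u) \<le> 0"
proof -
  have "Re (CLINT x|\<nu>. levy_integrand u x) = (\<integral>x. Re (levy_integrand u x) \<partial>\<nu>)"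
    by (rule integral_Re[OF integrable_levy_integrand, symmetric])
  also have "\<dots> \<le> (\<integral>x. 0 \<partial>\<nu>)"
    by (intro integral_mono integrable_Re integrable_levy_integrand) (auto simp: levy_integrand_def Re_exp)
  finally have "Re (CLINT x|\<nu>. levy_integrand u x) \<le> 0" by simp
  moreover have "0 \<le> b * u^2 / 2" using b_nonneg by simp
  ultimately show ?thesis by (simp add: levy_exponent_eq)
qed

lemma integrable_psi:
  assumes "integrable N (\<lambda>s. control (g s))" and [measurable]: "g \<in> borel_measurable N"
  shows "complex_integrable N (\<lambda>s. \<psi> (u * g s))"
proof (rule Bochner_Integration.integrable_bound)
  show "integrable N (\<lambda>s. (1 + u^2) * control (g s))" using assms by simp
  show "AE s in N. norm (\<psi> (u * g s)) \<le> norm ((1 + u^2) * control (g s))"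
    using norm_psi_scale_le control_nonneg by (simp add: abs_of_nonneg)
qed simp

lemma norm_integral_psi_le:
  assumes "integrable N (\<lambda>s. control (g s))" and "g \<in> borel_measurable N"
  shows "norm (CLINT s|N. \<psi> (u * g s)) \<le> (1 + u^2) * (\<integral>s. control (g s) \<partial>N)"
proof -
  have "norm (CLINT s|N. \<psi> (u * g s)) \<le> (\<integral>s. (1 + u^2) * control (g s) \<partial>N)"
    by (rule order_trans[OF integral_norm_bound])
      (intro integral_mono integrable_norm integrable_psi integrable_mult_right assms norm_psi_scale_le)
  then show ?thesis by simp
qed

lemma norm_one_minus_exp_integral_psi_le:
  assumes "integrable N (\<lambda>s. control (g s))" and "g \<in> borel_measurable N"
  shows "norm (1 - exp (CLINT s|N. \<psi> (u * g s))) \<le> (1 + u^2) * (\<integral>s. control (g s) \<partial>N)"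
proof -
  have "Re (CLINT s|N. \<psi> (u * g s)) = (\<integral>s. Re (\<psi> (u * g s)) \<partial>N)"
    by (rule integral_Re[OF integrable_psi[OF assms], symmetric])
  also have "\<dots> \<le> (\<integral>s. 0 \<partial>N)"
    by (intro integral_mono integrable_Re integrable_psi assms) (auto simp: Re_psi_nonpos)
  finally have "Re (CLINT s|N. \<psi> (u * g s)) \<le> 0" by simp
  then show ?thesis
    by (rule order_trans[OF norm_one_minus_exp_le norm_integral_psi_le[OF assms]])
qed

end

section \<open>The law of the random measure\<close>

text \<open>At negative times the process is known only through left limits of \<open>L2\<close>.
  There \<open>L y - L x\<close> is an almost sure limit of increments of \<open>L2\<close> from
  just before \<open>- y\<close> to just before \<open>- x\<close>, and characteristic functions
  pass to the limit. Intervals having 0 in their interior are left to a later splitting at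
  0.\<close>

lemma char_increment:
  assumes L: "two_sided_levy_process M L \<gamma> \<sigma>2 \<nu>" and xy: "x < y" and sign: "0 \<le> x \<or> y \<le> 0"
  shows "char (distr M borel (\<lambda>\<omega>. L y \<omega> - L x \<omega>)) u = exp (of_real (y - x) * levy_exponent \<gamma> \<sigma>2 \<nu> u)"
proof -
  obtain L1 L2 where L1: "levy_process M L1 \<gamma> \<sigma>2 \<nu>" and L2: "levy_process M L2 \<gamma> \<sigma>2 \<nu>"
    and Lm [measurable]: "\<And>t. L t \<in> borel_measurable M"
    and ae: "AE \<omega> in M. (\<forall>t\<ge>0. L t \<omega> = L1 t \<omega>) \<and> (\<forall>t<0. ((\<lambda>s. L2 s \<omega>) \<longlongrightarrow> - L t \<omega>) (at_left (- t)))"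
    using L unfolding two_sided_levy_process_def by blast
  have incr: "char (distr M borel (\<lambda>\<omega>. K p \<omega> - K q \<omega>)) u = exp (of_real (p - q) * levy_exponent \<gamma> \<sigma>2 \<nu> u)"
    if "levy_process M K \<gamma> \<sigma>2 \<nu>" "0 \<le> q" "q \<le> p" for K p q
  proof -
    have "distr M borel (\<lambda>\<omega>. K p \<omega> - K q \<omega>) = distr M borel (K (p - q))"
      using that by (auto simp: levy_process_def)
    then show ?thesis using that by (simp add: levy_process_def)
  qed
  show ?thesis
  proof (cases "0 \<le> x")
    case True
    have "distr M borel (\<lambda>\<omega>. L y \<omega> - L x \<omega>) = distr M borel (\<lambda>\<omega>. L1 y \<omega> - L1 x \<omega>)"
    proof (rule distr_cong_AE)
      show "AE \<omega> in M. L y \<omega> - L x \<omega> = L1 y \<omega> - L1 x \<omega>"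
        using ae by eventually_elim (use True xy in simp)
      have "L1 y \<in> borel_measurable M" "L1 x \<in> borel_measurable M"
        using L1 True xy by (auto simp: levy_process_def)
      then show "(\<lambda>\<omega>. L1 y \<omega> - L1 x \<omega>) \<in> M \<rightarrow>\<^sub>M borel" by simp
    qed auto
    then show ?thesis using incr[OF L1] True xy by simp
  next
    case False
    then have y: "y \<le> 0" using sign by simp
    have P: "prob_space M" using L1 by (simp add: levy_process_def)
    \<comment> \<open>The factor \<open>1 / (n + 2)\<close> is strictly below 1, which keeps
      \<open>p n\<close> and \<open>q n\<close> nonnegative. If \<open>y = 0\<close> there is no
      left limit to take: \<open>q n\<close> is exactly 0, where both one-sided processes vanish
      almost surely.\<close>
    define \<epsilon> where "\<epsilon> n = (if y < 0 then - y else - x) * inverse (real (Suc (Suc n)))" for n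
    define p where "p n = - x - \<epsilon> n" for n
    define q where "q n = (if y < 0 then - y - \<epsilon> n else 0)" for n
    have "(\<lambda>n. (if y < 0 then - y else - x) * inverse (real (Suc (Suc n)))) \<longlonglongrightarrow> 0"
      by (intro tendsto_mult_right_zero LIMSEQ_Suc[OF LIMSEQ_inverse_real_of_nat])
    then have eps: "\<epsilon> \<longlonglongrightarrow> 0" unfolding \<epsilon>_def .
    have eps_pos: "0 < \<epsilon> n" for n using False xy by (auto simp: \<epsilon>_def intro!: mult_pos_pos)
    have eps_less: "\<epsilon> n < (if y < 0 then - y else - x)" for n
      using False xy by (auto simp: \<epsilon>_def field_simps mult_less_0_iff add_neg_neg simp del: of_nat_Suc intro!: mult_neg_pos)
    have q0: "0 \<le> q n" "q n \<le> p n" for n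
      using eps_less[of n] y xy by (auto simp: p_def q_def split: if_splits)
    have [measurable]: "L2 (p n) \<in> borel_measurable M" "L2 (q n) \<in> borel_measurable M" for n
      using L2 q0[of n] by (auto simp: levy_process_def)
    have left: "filterlim (\<lambda>n. z - \<epsilon> n) (at_left z) sequentially" for z
      using tendsto_diff[OF tendsto_const eps, of z] eps_pos less_imp_neq[OF eps_pos, symmetric]
      by (auto simp: filterlim_at intro!: always_eventually)
    have "tendsto_in_prob M (\<lambda>n \<omega>. L2 (p n) \<omega> - L2 (q n) \<omega>) (\<lambda>\<omega>. L y \<omega> - L x \<omega>)"
    proof (rule tendsto_in_prob_AE[OF P])
      have "AE \<omega> in M. L1 0 \<omega> = 0" "AE \<omega> in M. L2 0 \<omega> = 0" using L1 L2 by (auto simp: levy_process_def)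
      then show "AE \<omega> in M. (\<lambda>n. L2 (p n) \<omega> - L2 (q n) \<omega>) \<longlonglongrightarrow> L y \<omega> - L x \<omega>"
        using ae
      proof eventually_elim
        fix \<omega> assume 0: "L1 0 \<omega> = 0" "L2 0 \<omega> = 0"
          and lim: "(\<forall>t\<ge>0. L t \<omega> = L1 t \<omega>) \<and> (\<forall>t<0. ((\<lambda>s. L2 s \<omega>) \<longlongrightarrow> - L t \<omega>) (at_left (- t)))"
        have *: "(\<lambda>n. L2 (- t - \<epsilon> n) \<omega>) \<longlonglongrightarrow> - L t \<omega>" if "t < 0" for t
          using lim that by (intro filterlim_compose[OF _ left]) auto
        have "(\<lambda>n. L2 (q n) \<omega>) \<longlonglongrightarrow> - L y \<omega>"
        proof (cases "y < 0")
          case True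
          then show ?thesis using *[of y] by (simp add: q_def)
        next
          case False
          then have "y = 0" using y by simp
          then show ?thesis using 0 lim by (simp add: q_def)
        qed
        moreover have "(\<lambda>n. L2 (p n) \<omega>) \<longlonglongrightarrow> - L x \<omega>" using * False by (auto simp: p_def)
        ultimately show "(\<lambda>n. L2 (p n) \<omega> - L2 (q n) \<omega>) \<longlonglongrightarrow> L y \<omega> - L x \<omega>"
          using tendsto_diff by fastforce
      qed
    qed auto
    then have "(\<lambda>n. char (distr M borel (\<lambda>\<omega>. L2 (p n) \<omega> - L2 (q n) \<omega>)) u) \<longlonglongrightarrow> char (distr M borel (\<lambda>\<omega>. L y \<omega> - L x \<omega>)) u"
      by (rule char_tendsto_in_prob[OF P, rotated]) auto
    moreover have "(\<lambda>n. exp (of_real (p n - q n) * levy_exponent \<gamma> \<sigma>2 \<nu> u)) \<longlonglongrightarrow> exp (of_real (y - x) * levy_exponent \<gamma> \<sigma>2 \<nu> u)"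
    proof (intro tendsto_exp tendsto_mult tendsto_of_real tendsto_const)
      have "(\<lambda>n. q n) \<longlonglongrightarrow> - y" using y tendsto_diff[OF tendsto_const eps, of "- y"]
        by (cases "y < 0") (simp_all add: q_def)
      moreover have "(\<lambda>n. p n) \<longlonglongrightarrow> - x" using tendsto_diff[OF tendsto_const eps, of "- x"] by (auto simp: p_def)
      ultimately show "(\<lambda>n. p n - q n) \<longlonglongrightarrow> y - x" using tendsto_diff by fastforce
    qed
    ultimately show ?thesis unfolding incr[OF L2 q0] by (rule LIMSEQ_unique)
  qed
qed

lemma bounded_borel_measurable: "A \<in> bounded_borel \<Longrightarrow> A \<in> sets borel"
  by (simp add: bounded_borel_def)

lemma bounded_borel_intros [simp, intro]:
  "{} \<in> bounded_borel" "{x<..y} \<in> bounded_borel"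
  "A \<in> bounded_borel \<Longrightarrow> B \<in> bounded_borel \<Longrightarrow> A \<union> B \<in> bounded_borel"
  "A \<in> sets borel \<Longrightarrow> B \<in> bounded_borel \<Longrightarrow> A \<inter> B \<in> bounded_borel"
  "A \<in> bounded_borel \<Longrightarrow> B \<in> sets borel \<Longrightarrow> A \<inter> B \<in> bounded_borel"
  "A \<in> bounded_borel \<Longrightarrow> B \<in> sets borel \<Longrightarrow> A - B \<in> bounded_borel"
  by (auto simp: bounded_borel_def bounded_Int bounded_diff)

section \<open>Additivity, independence and characteristic functions of the random measure\<close>

locale scattered_measure = prob_space M for M :: "'a measure" +
  fixes \<Lambda> :: "real set \<Rightarrow> 'a \<Rightarrow> real"
  assumes scattered: "independently_scattered M \<Lambda>"
begin

lemma Lambda_measurable [measurable]: "A \<in> bounded_borel \<Longrightarrow> \<Lambda> A \<in> borel_measurable M"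
  using scattered by (simp add: independently_scattered_def)

lemma Lambda_indep:
  "range A \<subseteq> bounded_borel \<Longrightarrow> disjoint_family A \<Longrightarrow> indep_vars (\<lambda>_. borel) (\<lambda>n. \<Lambda> (A n)) (UNIV :: nat set)"
  using scattered by (simp add: independently_scattered_def)

lemma Lambda_sums:
  "range A \<subseteq> bounded_borel \<Longrightarrow> disjoint_family A \<Longrightarrow> (\<Union>n::nat. A n) \<in> bounded_borel \<Longrightarrow>
    AE \<omega> in M. (\<lambda>n. \<Lambda> (A n) \<omega>) sums \<Lambda> (\<Union>n. A n) \<omega>"
  using scattered by (simp add: independently_scattered_def)

text \<open>Countable additivity of the constant sequence of empty sets gives a convergent series
  with constant terms.\<close>

lemma Lambda_empty: "AE \<omega> in M. \<Lambda> {} \<omega> = 0"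
proof -
  have "AE \<omega> in M. (\<lambda>n::nat. \<Lambda> {} \<omega>) sums \<Lambda> (\<Union>n::nat. {}) \<omega>"
    by (rule Lambda_sums) (auto simp: disjoint_family_on_def)
  then show ?thesis by eventually_elim (use summable_const_iff sums_summable in blast)
qed

lemma Lambda_Un:
  assumes "A \<in> bounded_borel" "B \<in> bounded_borel" "A \<inter> B = {}"
  shows "AE \<omega> in M. \<Lambda> (A \<union> B) \<omega> = \<Lambda> A \<omega> + \<Lambda> B \<omega>"
proof -
  \<comment> \<open>Additivity is given for infinite sequences. Padding with \<open>{}\<close> is
    harmless by \<open>Lambda_empty\<close>.\<close>
  let ?S = "\<lambda>n::nat. if n = 0 then A else if n = 1 then B else {}"
  have un: "(\<Union>n. ?S n) = A \<union> B" by (auto split: if_splits intro: exI[of _ 0] exI[of _ 1])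
  have "AE \<omega> in M. (\<lambda>n. \<Lambda> (?S n) \<omega>) sums \<Lambda> (\<Union>n. ?S n) \<omega>"
    by (rule Lambda_sums) (use assms un in \<open>auto simp: disjoint_family_on_def\<close>)
  then show ?thesis using Lambda_empty
  proof eventually_elim
    fix \<omega> assume s: "(\<lambda>n. \<Lambda> (?S n) \<omega>) sums \<Lambda> (\<Union>n. ?S n) \<omega>" and 0: "\<Lambda> {} \<omega> = 0"
    have "(\<lambda>n. \<Lambda> (?S n) \<omega>) sums (\<Sum>n\<in>{0,1}. \<Lambda> (?S n) \<omega>)"
      by (rule sums_finite) (use 0 in auto)
    then show "\<Lambda> (A \<union> B) \<omega> = \<Lambda> A \<omega> + \<Lambda> B \<omega>"
      using sums_unique2[OF s[unfolded un]] by simp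
  qed
qed

lemma char_Lambda_empty: "char (distr M borel (\<Lambda> {})) u = 1"
proof -
  have "distr M borel (\<Lambda> {}) = distr M borel (\<lambda>_. 0)"
    using Lambda_empty by (intro distr_cong_AE) auto
  then show ?thesis by (simp add: char_def integral_return)
qed

lemma char_Lambda_Un:
  assumes "A \<in> bounded_borel" "B \<in> bounded_borel" "A \<inter> B = {}"
  shows "char (distr M borel (\<Lambda> (A \<union> B))) u = char (distr M borel (\<Lambda> A)) u * char (distr M borel (\<Lambda> B)) u"
proof -
  let ?S = "\<lambda>n::nat. if n = 0 then A else if n = 1 then B else {}"
  have "indep_vars (\<lambda>_. borel) (\<lambda>n. \<Lambda> (?S n)) UNIV"
    by (rule Lambda_indep) (use assms in \<open>auto simp: disjoint_family_on_def\<close>)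
  then have "indep_vars (\<lambda>_. borel) (\<lambda>n. \<Lambda> (?S n)) {0, 1}" by (rule indep_vars_subset) simp
  from char_distr_sum[OF this, of u]
  have "char (distr M borel (\<lambda>\<omega>. \<Lambda> A \<omega> + \<Lambda> B \<omega>)) u = char (distr M borel (\<Lambda> A)) u * char (distr M borel (\<Lambda> B)) u"
    by simp
  moreover have "distr M borel (\<Lambda> (A \<union> B)) = distr M borel (\<lambda>\<omega>. \<Lambda> A \<omega> + \<Lambda> B \<omega>)"
    using Lambda_Un[OF assms] assms by (intro distr_cong_AE) auto
  ultimately show ?thesis by simp
qed

lemma char_Lambda_UN:
  assumes A: "range A \<subseteq> bounded_borel" "disjoint_family A" "(\<Union>n::nat. A n) \<in> bounded_borel"
  shows "(\<lambda>n. \<Prod>i<n. char (distr M borel (\<Lambda> (A i))) u) \<longlonglongrightarrow> char (distr M borel (\<Lambda> (\<Union>n. A n))) u"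
proof -
  have [measurable]: "\<Lambda> (A i) \<in> borel_measurable M" for i using A(1) by (intro Lambda_measurable) auto
  have "tendsto_in_prob M (\<lambda>n \<omega>. \<Sum>i<n. \<Lambda> (A i) \<omega>) (\<Lambda> (\<Union>n. A n))"
    using Lambda_sums[OF A] A by (intro tendsto_in_prob_AE) (auto simp: sums_def prob_space_axioms)
  then have "(\<lambda>n. char (distr M borel (\<lambda>\<omega>. \<Sum>i<n. \<Lambda> (A i) \<omega>)) u) \<longlonglongrightarrow> char (distr M borel (\<Lambda> (\<Union>n. A n))) u"
    by (rule char_tendsto_in_prob[OF prob_space_axioms, rotated]) auto
  moreover have "char (distr M borel (\<lambda>\<omega>. \<Sum>i<n. \<Lambda> (A i) \<omega>)) u = (\<Prod>i<n. char (distr M borel (\<Lambda> (A i))) u)" for n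
    by (intro char_distr_sum indep_vars_subset[OF Lambda_indep[OF A(1,2)]]) auto
  ultimately show ?thesis by simp
qed

end

locale levy_random_measure = scattered_measure M \<Lambda> + levy_triplet a b \<nu>
  for M :: "'a measure" and \<Lambda> a b \<nu> +
  assumes char_interval: "x < y \<Longrightarrow> char (distr M borel (\<Lambda> {x<..y})) u = exp (of_real (y - x) * levy_exponent a b \<nu> u)"
begin

text \<open>The sets satisfying the formula form a Dynkin system containing the half-open intervals,
  which are stable under intersection. Everything is intersected with a window \<open>?I\<close>
  around \<open>B\<close>, because complements would otherwise leave the bounded sets on which
  \<open>\<Lambda>\<close> is controlled.\<close>

lemma char_Lambda:
  assumes B: "B \<in> bounded_borel"
  shows "char (distr M borel (\<Lambda> B)) u = exp (of_real (measure lborel B) * \<psi> u)"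
proof -
  obtain N where N: "N > 0" "B \<subseteq> {-N<..N}"
  proof -
    have "bounded B" using B by (simp add: bounded_borel_def)
    then obtain K where K: "K > 0" "\<And>x. x \<in> B \<Longrightarrow> \<bar>x\<bar> \<le> K" by (auto simp: bounded_pos)
    have "B \<subseteq> {-(K + 1)<..K + 1}" using K(2) by (force simp: abs_le_iff)
    then show ?thesis using that[of "K + 1"] K(1) by simp
  qed
  let ?I = "{-N<..N}"
  define P where "P S \<longleftrightarrow> char (distr M borel (\<Lambda> (S \<inter> ?I))) u = exp (of_real (measure lborel (S \<inter> ?I)) * \<psi> u)" for S
  have B': "B \<in> sigma_sets UNIV (range (\<lambda>(a, b). {a <.. b::real}))"
    using bounded_borel_measurable[OF B] unfolding borel_sigma_sets_Ioc by simp
  have meas: "S \<in> sets borel" if "S \<in> sigma_sets UNIV (range (\<lambda>(a, b). {a <.. b::real}))" for S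
    using that unfolding borel_sigma_sets_Ioc by simp
  have fin: "S \<inter> ?I \<in> fmeasurable lborel" if "S \<in> sets borel" for S
    by (rule fmeasurableI2[of ?I]) (use that N in \<open>auto intro!: fmeasurableI simp: emeasure_lborel_Ioc\<close>)
  have "P B"
  proof (rule sigma_sets_induct_disjoint[OF _ _ B', where P=P])
    have "{a<..b} \<inter> {c<..d} = {max a c<..min b d}" for a b c d :: real by auto
    then show "Int_stable (range (\<lambda>(a, b). {a <.. b::real}))"
      unfolding Int_stable_def by (auto simp: image_iff)
  next
    fix A :: "real set" assume "A \<in> range (\<lambda>(a, b). {a <.. b})"
    then obtain x y where "A = {x<..y}" by auto
    then have eq: "A \<inter> ?I = {max x (-N)<..min y N}" by auto
    show "P A"
    proof (cases "max x (-N) < min y N")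
      case True
      then show ?thesis unfolding P_def eq using char_interval[OF True] by simp
    next
      case False
      then have "A \<inter> ?I = {}" unfolding eq by (intro greaterThanAtMost_empty) (use False in linarith)
      then show ?thesis unfolding P_def by (simp add: char_Lambda_empty)
    qed
  next
    show "P {}" unfolding P_def by (simp add: char_Lambda_empty)
  next
    fix A :: "real set" assume A: "A \<in> sigma_sets UNIV (range (\<lambda>(a, b). {a <.. b}))" "P A"
    let ?A = "A \<inter> ?I" and ?C = "(UNIV - A) \<inter> ?I"
    have m: "A \<in> sets borel" "UNIV - A \<in> sets borel" using meas[OF A(1)] by auto
    have I: "?I = ?A \<union> ?C" "?A \<inter> ?C = {}" by auto
    have bb: "?A \<in> bounded_borel" "?C \<in> bounded_borel" using m by auto
    have "exp (of_real (measure lborel ?I) * \<psi> u) = char (distr M borel (\<Lambda> ?I)) u"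
      using char_interval[of "-N" N] N by simp
    also have "\<dots> = char (distr M borel (\<Lambda> ?A)) u * char (distr M borel (\<Lambda> ?C)) u"
      by (subst I(1)) (intro char_Lambda_Un bb I)
    also have "char (distr M borel (\<Lambda> ?A)) u = exp (of_real (measure lborel ?A) * \<psi> u)" using A(2) by (simp add: P_def)
    also have "measure lborel ?I = measure lborel ?A + measure lborel ?C"
      by (subst I(1)) (intro measure_Un3[THEN trans] fin m, use I in simp)
    \<comment> \<open>\<open>exp\<close> never vanishes, so the factor belonging to
      \<open>?A\<close> cancels and the factor of the complement is determined.\<close>
    finally have "exp (of_real (measure lborel ?A) * \<psi> u) * exp (of_real (measure lborel ?C) * \<psi> u)
      = exp (of_real (measure lborel ?A) * \<psi> u) * char (distr M borel (\<Lambda> ?C)) u"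
      by (simp add: algebra_simps exp_add)
    then show "P (UNIV - A)" by (simp add: P_def)
  next
    fix A :: "nat \<Rightarrow> real set"
    assume A: "disjoint_family A" "range A \<subseteq> sigma_sets UNIV (range (\<lambda>(a, b). {a <.. b}))" "\<And>i. P (A i)"
    have m: "A i \<in> sets borel" for i using A(2) meas by auto
    have un: "(\<Union>i. A i) \<inter> ?I = (\<Union>i. A i \<inter> ?I)" by auto
    have dis: "disjoint_family (\<lambda>i. A i \<inter> ?I)" using A(1) by (auto simp: disjoint_family_on_def)
    have "(\<lambda>n. \<Prod>i<n. char (distr M borel (\<Lambda> (A i \<inter> ?I))) u) \<longlonglongrightarrow> char (distr M borel (\<Lambda> (\<Union>i. A i \<inter> ?I))) u"
      using m by (intro char_Lambda_UN dis) (auto simp flip: un)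
    moreover have "(\<lambda>n. exp (of_real (\<Sum>i<n. measure lborel (A i \<inter> ?I)) * \<psi> u)) \<longlonglongrightarrow> exp (of_real (measure lborel (\<Union>i. A i \<inter> ?I)) * \<psi> u)"
    proof (intro tendsto_intros)
      have "(\<lambda>i. measure lborel (A i \<inter> ?I)) sums measure lborel (\<Union>i. A i \<inter> ?I)"
      proof (rule measure_UNION)
        have "(\<Union>i. A i) \<in> sets borel" using m by auto
        from fin[OF this] show "emeasure lborel (\<Union>i. A i \<inter> ?I) \<noteq> \<infinity>"
          by (auto simp: fmeasurable_def)
      qed (use m dis in auto)
      then show "(\<lambda>n. \<Sum>i<n. measure lborel (A i \<inter> ?I)) \<longlonglongrightarrow> measure lborel (\<Union>i. A i \<inter> ?I)"
        by (simp add: sums_def)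
    qed
    moreover have "(\<Prod>i<n. char (distr M borel (\<Lambda> (A i \<inter> ?I))) u) = exp (of_real (\<Sum>i<n. measure lborel (A i \<inter> ?I)) * \<psi> u)" for n
      using A(3) by (simp add: P_def exp_sum sum_distrib_right)
    ultimately show "P (\<Union>i. A i)" unfolding P_def un using LIMSEQ_unique by auto
  qed auto
  moreover have "B \<inter> ?I = B" using N by auto
  ultimately show ?thesis by (simp add: P_def)
qed

end

lemma levy_random_measureI:
  assumes L: "two_sided_levy_process M L \<gamma> \<sigma>2 \<nu>" and \<Lambda>: "associated_random_measure M L \<Lambda>"
  shows "levy_random_measure M \<Lambda> \<gamma> \<sigma>2 \<nu>"
proof -
  obtain L1 where L1: "levy_process M L1 \<gamma> \<sigma>2 \<nu>" and Lm [measurable]: "\<And>t. L t \<in> borel_measurable M"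
    using L unfolding two_sided_levy_process_def by blast
  interpret prob_space M using L1 by (simp add: levy_process_def)
  interpret scattered_measure M \<Lambda>
    by unfold_locales (use \<Lambda> in \<open>simp add: associated_random_measure_def\<close>)
  have *: "char (distr M borel (\<Lambda> {x<..y})) u = exp (of_real (y - x) * levy_exponent \<gamma> \<sigma>2 \<nu> u)"
    if xy: "x < y" and sign: "0 \<le> x \<or> y \<le> 0" for x y u
  proof -
    have "distr M borel (\<Lambda> {x<..y}) = distr M borel (\<lambda>\<omega>. L y \<omega> - L x \<omega>)"
      using \<Lambda> xy by (intro distr_cong_AE) (auto simp: associated_random_measure_def)
    then show ?thesis using char_increment[OF L that] by simp
  qed
  show ?thesis
  proof
    show "0 \<le> \<sigma>2" "levy_measure \<nu>" using L1 by (auto simp: levy_process_def)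
    show "char (distr M borel (\<Lambda> {x<..y})) u = exp (of_real (y - x) * levy_exponent \<gamma> \<sigma>2 \<nu> u)" if "x < y" for x y u
    proof (cases "0 \<le> x \<or> y \<le> 0")
      case False
      \<comment> \<open>An interval across 0 is cut at 0, and independence of
        \<open>\<Lambda>\<close> on the two pieces multiplies the characteristic functions.\<close>
      then have eq: "{x<..y} = {x<..0} \<union> {0<..y}" "{x<..0} \<inter> {0<..y} = {}" by auto
      show ?thesis using *[of x 0 u] *[of 0 y u] False unfolding eq(1)
        by (subst char_Lambda_Un[OF _ _ eq(2)]) (auto simp: algebra_simps simp flip: exp_add)
    qed (use * that in auto)
  qed
qed

section \<open>Integrals of step functions\<close>

text \<open>Differences of step functions are formed by appending lists, which destroys
  disjointness. The calculus therefore admits overlapping sets, and disjointness is restored only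
  where independence is invoked.\<close>

definition bounded_steps :: "step \<Rightarrow> bool" where
  "bounded_steps g \<longleftrightarrow> (\<forall>p\<in>set g. snd p \<in> bounded_borel)"

definition scale_step :: "real \<Rightarrow> step \<Rightarrow> step" where
  "scale_step r g = map (\<lambda>(c, B). (r * c, B)) g"

text \<open>This adds \<open>c\<close> times the indicator of \<open>B\<close> to a disjoint list
  \<open>h\<close> by refinement: the part of \<open>B\<close> outside \<open>h\<close>, then the
  overlaps with summed coefficients, then the rest of \<open>h\<close>.\<close>

definition add_step :: "real \<Rightarrow> real set \<Rightarrow> step \<Rightarrow> step" where
  "add_step c B h = (c, B - \<Union> (snd ` set h)) #
     map (\<lambda>(d, D). (d + c, D \<inter> B)) h @ map (\<lambda>(d, D). (d, D - B)) h"

primrec disjointify :: "step \<Rightarrow> step" where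
  "disjointify [] = []"
| "disjointify (p # g) = add_step (fst p) (snd p) (disjointify g)"

lemma bounded_steps_simps [simp]:
  "bounded_steps []"
  "bounded_steps (p # g) \<longleftrightarrow> snd p \<in> bounded_borel \<and> bounded_steps g"
  "bounded_steps (g @ h) \<longleftrightarrow> bounded_steps g \<and> bounded_steps h"
  "bounded_steps (scale_step r g) \<longleftrightarrow> bounded_steps g"
  by (auto simp: bounded_steps_def scale_step_def)

lemma is_step_bounded: "is_step g \<Longrightarrow> bounded_steps g"
  by (auto simp: is_step_def bounded_steps_def)

lemma step_fun_simps [simp]:
  "step_fun [] s = 0"
  "step_fun (p # g) s = fst p * indicator (snd p) s + step_fun g s"
  "step_fun (g @ h) s = step_fun g s + step_fun h s"
  by (auto simp: step_fun_def split: prod.split)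

lemma step_integral_simps [simp]:
  "step_integral F [] A \<omega> = 0"
  "step_integral F (p # g) A \<omega> = fst p * F (A \<inter> snd p) \<omega> + step_integral F g A \<omega>"
  "step_integral F (g @ h) A \<omega> = step_integral F g A \<omega> + step_integral F h A \<omega>"
  by (auto simp: step_integral_def split: prod.split)

lemma step_fun_scale [simp]: "step_fun (scale_step r g) s = r * step_fun g s"
  by (induction g) (simp_all add: scale_step_def split_beta distrib_left)

lemma step_integral_scale [simp]: "step_integral F (scale_step r g) A \<omega> = r * step_integral F g A \<omega>"
  by (induction g) (simp_all add: scale_step_def split_beta distrib_left)

text \<open>Evaluation at a point is integration against the additive set function
  \<open>indicator\<close>. Hence one lemma on disjointification serves both step functions and
  their integrals.\<close>

lemma step_fun_eq_step_integral: "step_fun g s = step_integral indicator g UNIV s"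
  by (induction g) auto

lemma is_step_Cons:
  "is_step (p # g) \<longleftrightarrow> snd p \<in> bounded_borel \<and> (\<forall>p'\<in>set g. snd p \<inter> snd p' = {}) \<and> is_step g"
  unfolding is_step_def split_beta by auto

lemma step_fun_measurable: "bounded_steps g \<Longrightarrow> step_fun g \<in> borel_measurable borel"
proof (induction g)
  case Nil
  have "step_fun [] = (\<lambda>s. 0)" by (rule ext) simp
  then show ?case by simp
next
  case (Cons p g)
  then have [measurable]: "step_fun g \<in> borel_measurable borel" "snd p \<in> sets borel"
    by (auto dest: bounded_borel_measurable)
  have "step_fun (p # g) = (\<lambda>s. fst p * indicator (snd p) s + step_fun g s)" by (rule ext) simp
  then show ?case by simp
qed

lemma step_fun_bound:
  assumes "bounded_steps g"
  obtains K R where "0 \<le> K" "\<And>s. \<bar>step_fun g s\<bar> \<le> K * indicator {-R..R} s"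
proof -
  have "\<exists>K R. 0 \<le> K \<and> (\<forall>s. \<bar>step_fun g s\<bar> \<le> K * indicator {-R..R} s)"
    using assms
  proof (induction g)
    case (Cons p g)
    then obtain K R where K: "0 \<le> K" "\<And>s. \<bar>step_fun g s\<bar> \<le> K * indicator {-R..R} s" by auto
    have "bounded (snd p)" using Cons.prems by (simp add: bounded_borel_def)
    then obtain R' where R': "\<And>s. s \<in> snd p \<Longrightarrow> \<bar>s\<bar> \<le> R'" by (auto simp: bounded_iff)
    have "\<bar>step_fun (p # g) s\<bar> \<le> (\<bar>fst p\<bar> + K) * indicator {-(max R R')..max R R'} s" for s
    proof -
      have "\<bar>step_fun (p # g) s\<bar> \<le> \<bar>fst p\<bar> * indicator (snd p) s + K * indicator {-R..R} s"
        using K(2)[of s] by (auto intro: order_trans[OF abs_triangle_ineq] simp: abs_mult)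
      also have "\<dots> \<le> \<bar>fst p\<bar> * indicator {-(max R R')..max R R'} s + K * indicator {-(max R R')..max R R'} s"
        using K(1) R'[of s] by (intro add_mono mult_left_mono) (auto simp: indicator_def abs_le_iff)
      finally show ?thesis by (simp add: algebra_simps)
    qed
    then show ?case using K(1) by (intro exI[of _ "\<bar>fst p\<bar> + K"] exI[of _ "max R R'"]) auto
  qed (auto intro: exI[of _ 0])
  then show ?thesis using that by blast
qed

section \<open>Replacing a list of weighted sets by a disjoint one\<close>

lemma is_step_add_step:
  assumes h: "is_step h" and B: "B \<in> bounded_borel"
  shows "is_step (add_step c B h)"
proof -
  have U: "\<Union> (snd ` set h) \<in> sets borel"
    using h by (intro sets.finite_Union) (auto simp: is_step_def dest!: bounded_borel_measurable)
  have mem: "\<forall>(d, D)\<in>set h. D \<in> bounded_borel" and srt: "sorted_wrt (\<lambda>(c, B) (c', B'). B \<inter> B' = {}) h"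
    using h by (auto simp: is_step_def)
  note B' = bounded_borel_measurable[OF B]
  have "sorted_wrt (\<lambda>(c, B) (c', B'). B \<inter> B' = {}) (map (\<lambda>(d, D). (d + c, D \<inter> B)) h)"
    "sorted_wrt (\<lambda>(c, B) (c', B'). B \<inter> B' = {}) (map (\<lambda>(d, D). (d, D - B)) h)"
    unfolding sorted_wrt_map by (rule sorted_wrt_mono_rel[OF _ srt]; auto)+
  then show ?thesis
    unfolding is_step_def add_step_def
    using mem U B B' by (auto simp: sorted_wrt_append)
qed

lemma is_step_disjointify: "bounded_steps g \<Longrightarrow> is_step (disjointify g)"
  by (induction g) (auto intro: is_step_add_step, simp add: is_step_def)

text \<open>\<open>F\<close> need only be additive almost everywhere on disjoint sets, and the lists
  are finite, so the exceptional null sets can be collected. The two auxiliary facts split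
  \<open>A \<inter> B\<close> along the sets of \<open>h\<close>, and the sets of \<open>h\<close>
  along \<open>B\<close>.\<close>

lemma step_integral_add_step:
  assumes add: "\<And>X Y. X \<in> bounded_borel \<Longrightarrow> Y \<in> bounded_borel \<Longrightarrow> X \<inter> Y = {} \<Longrightarrow>
      AE \<omega> in N. F (X \<union> Y) \<omega> = F X \<omega> + F Y \<omega>"
    and h: "is_step h" and B: "B \<in> bounded_borel" and A: "A \<in> sets borel"
  shows "AE \<omega> in N. step_integral F (add_step c B h) A \<omega> = c * F (A \<inter> B) \<omega> + step_integral F h A \<omega>"
proof -
  have one: "AE \<omega> in N. F (A \<inter> B) \<omega> = F (A \<inter> (B - \<Union> (snd ` set h))) \<omega> + (\<Sum>p\<leftarrow>h. F (A \<inter> (snd p \<inter> B)) \<omega>)"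
    using h B
  proof (induction h arbitrary: B)
    case (Cons p h)
    let ?D = "snd p"
    have D: "?D \<in> bounded_borel" and dis: "\<And>p'. p' \<in> set h \<Longrightarrow> ?D \<inter> snd p' = {}" and h: "is_step h"
      using Cons.prems(1) by (auto simp: is_step_Cons)
    note Dm = bounded_borel_measurable[OF D]
    have "AE \<omega> in N. F ((A \<inter> (?D \<inter> B)) \<union> (A \<inter> (B - ?D))) \<omega> = F (A \<inter> (?D \<inter> B)) \<omega> + F (A \<inter> (B - ?D)) \<omega>"
      using D Dm A Cons.prems(2) by (intro add) (auto dest: bounded_borel_measurable)
    moreover have "(A \<inter> (?D \<inter> B)) \<union> (A \<inter> (B - ?D)) = A \<inter> B" by auto
    ultimately have "AE \<omega> in N. F (A \<inter> B) \<omega> = F (A \<inter> (?D \<inter> B)) \<omega> + F (A \<inter> (B - ?D)) \<omega>" by simp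
    moreover have "AE \<omega> in N. F (A \<inter> (B - ?D)) \<omega> = F (A \<inter> (B - ?D - \<Union> (snd ` set h))) \<omega> +
        (\<Sum>p\<leftarrow>h. F (A \<inter> (snd p \<inter> (B - ?D))) \<omega>)"
      using Cons.prems(2) Dm h by (intro Cons.IH) auto
    \<comment> \<open>The induction hypothesis was used for \<open>B - ?D\<close>. The remaining
      sets are disjoint from \<open>?D\<close>, so their overlaps with \<open>B\<close> are
      unaffected.\<close>
    moreover have "(\<Sum>p\<leftarrow>h. F (A \<inter> (snd p \<inter> (B - ?D))) \<omega>) = (\<Sum>p\<leftarrow>h. F (A \<inter> (snd p \<inter> B)) \<omega>)" for \<omega>
    proof -
      have "snd p' \<inter> (B - ?D) = snd p' \<inter> B" if "p' \<in> set h" for p' using dis[OF that] by auto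
      then show ?thesis by (intro arg_cong[where f=sum_list] map_cong refl) simp
    qed
    moreover have "B - ?D - \<Union> (snd ` set h) = B - \<Union> (snd ` set (p # h))" by auto
    ultimately show ?case by (auto elim: eventually_elim2)
  qed simp
  have two: "AE \<omega> in N. (\<Sum>p\<leftarrow>h. fst p * F (A \<inter> (snd p \<inter> B)) \<omega>) + (\<Sum>p\<leftarrow>h. fst p * F (A \<inter> (snd p - B)) \<omega>)
      = step_integral F h A \<omega>"
    using h
  proof (induction h)
    case (Cons p h)
    let ?D = "snd p"
    have "AE \<omega> in N. F ((A \<inter> (?D \<inter> B)) \<union> (A \<inter> (?D - B))) \<omega> = F (A \<inter> (?D \<inter> B)) \<omega> + F (A \<inter> (?D - B)) \<omega>"
      using Cons.prems B A by (intro add) (auto simp: is_step_Cons dest: bounded_borel_measurable)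
    moreover have "(A \<inter> (?D \<inter> B)) \<union> (A \<inter> (?D - B)) = A \<inter> ?D" by auto
    ultimately have "AE \<omega> in N. F (A \<inter> ?D) \<omega> = F (A \<inter> (?D \<inter> B)) \<omega> + F (A \<inter> (?D - B)) \<omega>" by simp
    moreover have "AE \<omega> in N. (\<Sum>p\<leftarrow>h. fst p * F (A \<inter> (snd p \<inter> B)) \<omega>) + (\<Sum>p\<leftarrow>h. fst p * F (A \<inter> (snd p - B)) \<omega>)
      = step_integral F h A \<omega>" using Cons by (auto simp: is_step_Cons)
    ultimately show ?case
      by eventually_elim (simp add: algebra_simps)
  qed simp
  have map1: "step_integral F (map (\<lambda>(d, D). (d + c, D \<inter> B)) g) A \<omega> =
      (\<Sum>p\<leftarrow>g. fst p * F (A \<inter> (snd p \<inter> B)) \<omega>) + c * (\<Sum>p\<leftarrow>g. F (A \<inter> (snd p \<inter> B)) \<omega>)" for g \<omega>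
    by (induction g) (auto simp: algebra_simps)
  have map2: "step_integral F (map (\<lambda>(d, D). (d, D - B)) g) A \<omega> = (\<Sum>p\<leftarrow>g. fst p * F (A \<inter> (snd p - B)) \<omega>)" for g \<omega>
    by (induction g) auto
  show ?thesis using one two
    by eventually_elim (simp add: add_step_def map1 map2 algebra_simps)
qed

lemma step_integral_disjointify:
  assumes add: "\<And>X Y. X \<in> bounded_borel \<Longrightarrow> Y \<in> bounded_borel \<Longrightarrow> X \<inter> Y = {} \<Longrightarrow>
      AE \<omega> in N. F (X \<union> Y) \<omega> = F X \<omega> + F Y \<omega>"
    and g: "bounded_steps g" and A: "A \<in> sets borel"
  shows "AE \<omega> in N. step_integral F (disjointify g) A \<omega> = step_integral F g A \<omega>"
  using g
proof (induction g)
  case (Cons p g)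
  then have "AE \<omega> in N. step_integral F (disjointify g) A \<omega> = step_integral F g A \<omega>" by simp
  moreover have "AE \<omega> in N. step_integral F (add_step (fst p) (snd p) (disjointify g)) A \<omega> =
      fst p * F (A \<inter> snd p) \<omega> + step_integral F (disjointify g) A \<omega>"
    using Cons.prems by (intro step_integral_add_step add is_step_disjointify A) auto
  ultimately show ?case by eventually_elim simp
qed simp

lemma step_fun_disjointify:
  assumes "bounded_steps g" shows "step_fun (disjointify g) s = step_fun g s"
proof -
  \<comment> \<open>Under the counting measure, almost everywhere means everywhere.\<close>
  have "AE s in count_space UNIV. step_integral indicator (disjointify g) UNIV s = (step_integral indicator g UNIV s :: real)"
    by (rule step_integral_disjointify)
      (use assms in \<open>auto simp: AE_count_space indicator_def disjoint_iff\<close>)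
  then show ?thesis by (simp add: AE_count_space step_fun_eq_step_integral)
qed

text \<open>By disjointness at most one summand is nonzero at \<open>s\<close>; where there is none,
  \<open>\<phi> 0 = 0\<close> is used.\<close>

lemma fun_step_fun:
  fixes \<phi> :: "real \<Rightarrow> 'b::real_vector"
  assumes "is_step g" "\<phi> 0 = 0"
  shows "\<phi> (step_fun g s) = (\<Sum>p\<leftarrow>g. indicator (snd p) s *\<^sub>R \<phi> (fst p))"
  using assms(1)
proof (induction g)
  case (Cons p g)
  have zero: "step_fun g s = 0" if "\<forall>p'\<in>set g. s \<notin> snd p'" for g
    using that by (induction g) auto
  have zero': "(\<Sum>p\<leftarrow>g. indicator (snd p) s *\<^sub>R \<phi> (fst p)) = 0" if "\<forall>p'\<in>set g. s \<notin> snd p'" for g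
    using that by (induction g) auto
  show ?case
  proof (cases "s \<in> snd p")
    case True
    then have "\<forall>p'\<in>set g. s \<notin> snd p'" using Cons.prems by (auto simp: is_step_Cons)
    then show ?thesis using True by (simp add: zero zero')
  next
    case False
    then show ?thesis using Cons by (simp add: is_step_Cons)
  qed
qed (use assms in simp)

section \<open>Characteristic functions of integrals of step functions\<close>

context scattered_measure
begin

lemma step_integral_measurable:
  assumes "bounded_steps g" "A \<in> sets borel" shows "step_integral \<Lambda> g A \<in> borel_measurable M"
  using assms(1)
proof (induction g)
  case Nil
  have "step_integral \<Lambda> [] A = (\<lambda>\<omega>. 0)" by (rule ext) simp
  then show ?case by simp
next
  case (Cons p g)
  then have [measurable]: "step_integral \<Lambda> g A \<in> borel_measurable M" "\<Lambda> (A \<inter> snd p) \<in> borel_measurable M"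
    using assms(2) by auto
  have "step_integral \<Lambda> (p # g) A = (\<lambda>\<omega>. fst p * \<Lambda> (A \<inter> snd p) \<omega> + step_integral \<Lambda> g A \<omega>)" by (rule ext) simp
  then show ?case by simp
qed

lemma step_integral_split:
  assumes "bounded_steps g" and A: "A \<in> sets borel"
  shows "AE \<omega> in M. step_integral \<Lambda> g UNIV \<omega> = step_integral \<Lambda> g A \<omega> + step_integral \<Lambda> g (- A) \<omega>"
  using assms(1)
proof (induction g)
  case (Cons p g)
  let ?D = "snd p"
  have "AE \<omega> in M. \<Lambda> ((A \<inter> ?D) \<union> (- A \<inter> ?D)) \<omega> = \<Lambda> (A \<inter> ?D) \<omega> + \<Lambda> (- A \<inter> ?D) \<omega>"
    using Cons.prems A by (intro Lambda_Un) auto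
  moreover have "(A \<inter> ?D) \<union> (- A \<inter> ?D) = ?D" by auto
  ultimately have "AE \<omega> in M. \<Lambda> ?D \<omega> = \<Lambda> (A \<inter> ?D) \<omega> + \<Lambda> (- A \<inter> ?D) \<omega>" by simp
  moreover have "AE \<omega> in M. step_integral \<Lambda> g UNIV \<omega> = step_integral \<Lambda> g A \<omega> + step_integral \<Lambda> g (- A) \<omega>"
    using Cons by simp
  ultimately show ?case by eventually_elim (simp add: algebra_simps)
qed simp

end

context levy_random_measure
begin

lemma char_step_integral_disjoint:
  assumes g: "is_step g" and A: "A \<in> sets borel"
  shows "char (distr M borel (step_integral \<Lambda> g A)) u = exp (CLINT s|lborel. \<psi> (u * (indicator A s * step_fun g s)))"
proof -
  let ?n = "length g"
  define c where "c i = fst (g ! i)" for i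
  define B where "B i = snd (g ! i)" for i
  \<comment> \<open>Independence is available for sequences indexed by all naturals, so the finite
    list is continued by empty sets.\<close>
  define S where "S i = (if i < ?n then A \<inter> B i else {})" for i
  have Bb: "B i \<in> bounded_borel" if "i < ?n" for i
    using is_step_bounded[OF g] that by (simp add: B_def bounded_steps_def)
  have Sb: "S i \<in> bounded_borel" for i using Bb A by (auto simp: S_def)
  have srt: "B i \<inter> B j = {}" if "i < j" "j < ?n" for i j
    using g that by (auto simp: is_step_def B_def sorted_wrt_iff_nth_less split_beta)
  have "disjoint_family S"
    unfolding disjoint_family_on_def
  proof (intro ballI impI)
    fix i j :: nat assume "i \<noteq> j"
    then consider "i < j" | "j < i" by linarith
    then show "S i \<inter> S j = {}" using srt[of i j] srt[of j i] by cases (auto simp: S_def)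
  qed
  then have "indep_vars (\<lambda>_. borel) (\<lambda>i. \<Lambda> (S i)) UNIV" using Sb by (intro Lambda_indep) auto
  then have "indep_vars (\<lambda>_. borel) (\<lambda>i. (*) (c i) \<circ> \<Lambda> (S i)) UNIV" by (rule indep_vars_compose) simp
  then have ind: "indep_vars (\<lambda>_. borel) (\<lambda>i \<omega>. c i * \<Lambda> (S i) \<omega>) {..<?n}"
    unfolding comp_def by (rule indep_vars_subset) simp
  have list_sum: "(\<Sum>p\<leftarrow>g. G (fst p) (snd p)) = (\<Sum>i<?n. G (c i) (B i))" for G :: "real \<Rightarrow> real set \<Rightarrow> 'c::comm_monoid_add"
    by (simp add: sum_list_sum_nth c_def B_def atLeast0LessThan)
  have "step_integral \<Lambda> g A = (\<lambda>\<omega>. \<Sum>i<?n. c i * \<Lambda> (S i) \<omega>)"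
  proof
    fix \<omega>
    show "step_integral \<Lambda> g A \<omega> = (\<Sum>i<?n. c i * \<Lambda> (S i) \<omega>)"
      using list_sum[of "\<lambda>c B. c * \<Lambda> (A \<inter> B) \<omega>"] by (simp add: step_integral_def case_prod_unfold S_def)
  qed
  then have "char (distr M borel (step_integral \<Lambda> g A)) u = (\<Prod>i<?n. char (distr M borel (\<lambda>\<omega>. c i * \<Lambda> (S i) \<omega>)) u)"
    by (simp add: char_distr_sum[OF ind])
  also have "\<dots> = (\<Prod>i<?n. exp (of_real (measure lborel (S i)) * \<psi> (u * c i)))"
  proof (intro prod.cong refl)
    fix i
    have "char (distr M borel (\<lambda>\<omega>. c i * \<Lambda> (S i) \<omega>)) u = char (distr M borel (\<Lambda> (S i))) (u * c i)"
      using Sb by (simp add: char_def integral_distr mult_ac)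
    then show "char (distr M borel (\<lambda>\<omega>. c i * \<Lambda> (S i) \<omega>)) u = exp (of_real (measure lborel (S i)) * \<psi> (u * c i))"
      by (simp add: char_Lambda[OF Sb])
  qed
  also have "\<dots> = exp (\<Sum>i<?n. of_real (measure lborel (S i)) * \<psi> (u * c i))"
    by (simp add: exp_sum)
  also have "(\<Sum>i<?n. of_real (measure lborel (S i)) * \<psi> (u * c i)) = (\<Sum>i<?n. CLINT s|lborel. indicator (S i) s *\<^sub>R \<psi> (u * c i))"
    by (simp add: scaleR_conv_of_real)
  also have "\<dots> = (CLINT s|lborel. \<Sum>i<?n. indicator (S i) s *\<^sub>R \<psi> (u * c i))"
  proof (rule Bochner_Integration.integral_sum[symmetric])
    fix i
    have "emeasure lborel (S i) < \<infinity>"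
      using Sb[of i] by (auto simp: bounded_borel_def intro!: emeasure_bounded_finite[simplified])
    then show "complex_integrable lborel (\<lambda>s. indicator (S i) s *\<^sub>R \<psi> (u * c i))"
      using Sb[of i] by (intro integrable_scaleR_left) (auto simp: bounded_borel_def)
  qed
  also have "\<dots> = (CLINT s|lborel. \<psi> (u * (indicator A s * step_fun g s)))"
  proof (intro Bochner_Integration.integral_cong refl)
    fix s
    have "\<psi> (u * (indicator A s * step_fun g s)) = (\<Sum>p\<leftarrow>g. indicator (snd p) s *\<^sub>R \<psi> (u * (indicator A s * fst p)))"
      by (rule fun_step_fun[OF g]) simp
    also have "\<dots> = (\<Sum>i<?n. indicator (B i) s *\<^sub>R \<psi> (u * (indicator A s * c i)))"
      by (rule list_sum[of "\<lambda>c B. indicator B s *\<^sub>R \<psi> (u * (indicator A s * c))"])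
    also have "\<dots> = (\<Sum>i<?n. indicator (S i) s *\<^sub>R \<psi> (u * c i))"
      by (intro sum.cong refl) (auto simp: S_def indicator_def)
    finally show "(\<Sum>i<?n. indicator (S i) s *\<^sub>R \<psi> (u * c i)) = \<psi> (u * (indicator A s * step_fun g s))" by simp
  qed
  finally show ?thesis .
qed

lemma char_step_integral:
  assumes g: "bounded_steps g" and A: "A \<in> sets borel"
  shows "char (distr M borel (step_integral \<Lambda> g A)) u = exp (CLINT s|lborel. \<psi> (u * (indicator A s * step_fun g s)))"
proof -
  have "distr M borel (step_integral \<Lambda> g A) = distr M borel (step_integral \<Lambda> (disjointify g) A)"
  proof (intro distr_cong_AE)
    show "AE \<omega> in M. step_integral \<Lambda> g A \<omega> = step_integral \<Lambda> (disjointify g) A \<omega>"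
      using step_integral_disjointify[where F=\<Lambda> and N=M, OF _ g A] Lambda_Un by (auto simp: eq_commute)
  qed (auto intro!: step_integral_measurable is_step_bounded is_step_disjointify assms)
  then show ?thesis
    by (simp add: char_step_integral_disjoint is_step_disjointify step_fun_disjointify g A)
qed

lemma control_indicator: "control (indicator A s * x) = indicator A s * control x"
  by (auto simp: indicator_def)

lemma integrable_control_step:
  assumes g: "bounded_steps g" shows "integrable lborel (\<lambda>s. control (step_fun g s))"
proof -
  obtain K R where K: "0 \<le> K" "\<And>s. \<bar>step_fun g s\<bar> \<le> K * indicator {-R..R} s"
    using step_fun_bound[OF g] by blast
  have [measurable]: "step_fun g \<in> borel_measurable borel" by (rule step_fun_measurable[OF g])
  show ?thesis
  proof (rule Bochner_Integration.integrable_bound)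
    show "integrable lborel (\<lambda>s. control K * indicator {-R..R} s)"
      by (intro integrable_mult_right integrable_real_indicator) (auto simp: emeasure_lborel_Icc_eq)
    have "control (step_fun g s) \<le> control (indicator {-R..R} s * K)" for s
      using K by (intro control_mono) (auto simp: mult.commute)
    then show "AE s in lborel. norm (control (step_fun g s)) \<le> norm (control K * indicator {-R..R} s)"
      using control_nonneg by (intro AE_I2) (simp add: control_indicator mult.commute[of "control K"])
  qed simp
qed

text \<open>This converts smallness of a Lebesgue integral into closeness of a random variable to 0:
  through the tail bound in the existence proof, and through the limit of \<open>char\<close> in the
  uniqueness proof.\<close>

lemma char_step_integral_near_1:
  assumes g: "bounded_steps g" and A: "A \<in> sets borel"
  shows "norm (1 - char (distr M borel (step_integral \<Lambda> g A)) u) \<le> (1 + u^2) * (LINT s:A|lborel. control (step_fun g s))"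
proof -
  have [measurable]: "step_fun g \<in> borel_measurable borel" by (rule step_fun_measurable[OF g])
  have "integrable lborel (\<lambda>s. control (indicator A s * step_fun g s))"
    using integrable_mult_indicator[OF _ integrable_control_step[OF g], of A] A by (simp add: control_indicator)
  then have "norm (1 - exp (CLINT s|lborel. \<psi> (u * (indicator A s * step_fun g s)))) \<le>
      (1 + u^2) * (\<integral>s. control (indicator A s * step_fun g s) \<partial>lborel)"
    using A by (intro norm_one_minus_exp_integral_psi_le) auto
  then show ?thesis by (simp add: char_step_integral[OF g A] control_indicator set_lebesgue_integral_def)
qed

end

section \<open>Existence and uniqueness of the integral\<close>

lemma tendsto_in_prob_zero:
  assumes P: "prob_space M" and X: "\<And>n. X n \<in> borel_measurable M" and lim: "tendsto_in_prob M X Y"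
    and char: "\<And>u. (\<lambda>n. char (distr M borel (X n)) u) \<longlonglongrightarrow> 1"
  shows "AE \<omega> in M. Y \<omega> = 0"
proof (rule AE_eq_const_if_char[OF P])
  show "Y \<in> borel_measurable M" using lim by (simp add: tendsto_in_prob_def)
  show "char (distr M borel Y) u = iexp (u * 0)" for u
    using LIMSEQ_unique[OF char_tendsto_in_prob[OF P X lim] char] by simp
qed

text \<open>The dyadic approximation from below, cut off in space as well as in value so that the
  level sets are bounded. Staying between 0 and \<open>f\<close> is what makes
  \<open>control (f s)\<close> a majorant later.\<close>

lemma exists_step_approximation:
  fixes f :: "real \<Rightarrow> real"
  assumes [measurable]: "f \<in> borel_measurable borel" and f: "\<And>s. 0 \<le> f s"
  obtains h where "\<And>n. is_step (h n)" "\<And>s. (\<lambda>n. step_fun (h n) s) \<longlonglongrightarrow> f s"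
    "\<And>n s. 0 \<le> step_fun (h n) s" "\<And>n s. step_fun (h n) s \<le> f s"
proof -
  define level where "level n s = nat \<lfloor>2^n * f s\<rfloor>" for n :: nat and s
  have [measurable]: "level n \<in> measurable borel (count_space UNIV)" for n
    unfolding level_def by measurable
  define B where "B n k = {s. \<bar>s\<bar> \<le> real n \<and> level n s = k}" for n :: nat and k
  \<comment> \<open>The \<open>n * 2^n\<close> levels cover the values below \<open>n\<close>; where
    \<open>f s\<close> is \<open>n\<close> or more, \<open>h n\<close> is 0.\<close>
  define h where "h n = map (\<lambda>k. (real k / 2^n, B n k)) [0..<n * 2^n]" for n :: nat
  have Bb: "B n k \<in> bounded_borel" for n k
  proof -
    have "B n k \<in> sets borel" unfolding B_def by measurable
    moreover have "bounded (B n k)" unfolding bounded_iff B_def by auto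
    ultimately show ?thesis by (simp add: bounded_borel_def)
  qed
  have "sorted_wrt (\<lambda>(c, B) (c', B'). B \<inter> B' = {}) (h n)" for n
    unfolding h_def sorted_wrt_map sorted_wrt_iff_nth_less by (auto simp: B_def)
  then have step: "is_step (h n)" for n
    unfolding is_step_def using Bb by (auto simp: h_def)
  have h_eq: "step_fun (h n) s = (if \<bar>s\<bar> \<le> real n \<and> level n s < n * 2^n then real (level n s) / 2^n else 0)" for n s
  proof -
    have "step_fun (h n) s = (\<Sum>k<n * 2^n. real k / 2^n * indicator (B n k) s)"
      by (simp add: step_fun_def h_def comp_def interv_sum_list_conv_sum_set_nat atLeast0LessThan)
    also have "\<dots> = (\<Sum>k<n * 2^n. if k = level n s then (if \<bar>s\<bar> \<le> real n then real k / 2^n else 0) else 0)"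
      by (intro sum.cong refl) (auto simp: B_def indicator_def)
    also have "\<dots> = (if \<bar>s\<bar> \<le> real n \<and> level n s < n * 2^n then real (level n s) / 2^n else 0)"
      by simp
    finally show ?thesis .
  qed
  have level: "real (level n s) \<le> 2^n * f s" "2^n * f s < real (level n s) + 1" for n s
    using f[of s] by (auto simp: level_def)
  have le: "real (level n s) / 2^n \<le> f s" for n s using level(1)[of n s] by (simp add: field_simps)
  show ?thesis
  proof
    show "is_step (h n)" for n by (rule step)
    show "0 \<le> step_fun (h n) s" for n s by (simp add: h_eq)
    show "step_fun (h n) s \<le> f s" for n s using le f by (simp add: h_eq)
    show "(\<lambda>n. step_fun (h n) s) \<longlonglongrightarrow> f s" for s
    proof (rule tendsto_sandwich)
      show "\<forall>\<^sub>F n in sequentially. step_fun (h n) s \<le> f s" using le f by (simp add: h_eq)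
      have "(\<lambda>n. f s - (1 / 2) ^ n) \<longlonglongrightarrow> f s - 0" by (intro tendsto_intros) auto
      then show "(\<lambda>n. f s - (1 / 2) ^ n) \<longlonglongrightarrow> f s" by simp
      obtain N where N: "max \<bar>s\<bar> (f s) < real N" using reals_Archimedean2 by blast
      show "\<forall>\<^sub>F n in sequentially. f s - (1 / 2) ^ n \<le> step_fun (h n) s"
        unfolding eventually_sequentially
      proof (intro exI allI impI)
        fix n assume "N \<le> n"
        then have n: "\<bar>s\<bar> < real n" "f s < real n" using N by linarith+
        have "real (level n s) < real (n * 2^n)"
        proof -
          have "real (level n s) \<le> 2^n * f s" by (rule level)
          also have "\<dots> < 2^n * real n" by (intro mult_strict_left_mono n) simp
          finally show ?thesis by (simp add: mult.commute)
        qed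
        then have "step_fun (h n) s = real (level n s) / 2^n" using n(1) by (simp add: h_eq del: of_nat_mult)
        also have "f s - (1 / 2) ^ n \<le> real (level n s) / 2^n"
        proof -
          have "(f s - (1 / 2) ^ n) * 2^n = 2^n * f s - 1" by (simp add: algebra_simps power_divide)
          then show ?thesis using level(2)[of n s] by (simp add: pos_le_divide_eq)
        qed
        finally show "f s - (1 / 2) ^ n \<le> step_fun (h n) s" .
      qed
    qed simp
  qed
qed

context levy_random_measure
begin

text \<open>
  The approximating steps are chosen so fast that for every \<open>A\<close> the integrals over \<open>A\<close> converge
  almost surely, by the tail bound and Borel-Cantelli.
\<close>

lemma integral_exists:
  assumes f [measurable]: "f \<in> borel_measurable borel" and f0: "\<And>s. 0 \<le> f s"
    and int: "integrable lborel (\<lambda>s. control (f s))"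
  obtains g X where "approximating_steps M \<Lambda> f g" "tendsto_in_prob M (\<lambda>n. step_integral \<Lambda> (g n) UNIV) X"
    "\<And>u. char (distr M borel X) u = exp (CLINT s|lborel. \<psi> (u * f s))"
proof -
  obtain h where h: "\<And>n. is_step (h n)" and lim: "\<And>s. (\<lambda>n. step_fun (h n) s) \<longlonglongrightarrow> f s"
    and h0: "\<And>n s. 0 \<le> step_fun (h n) s" and hf: "\<And>n s. step_fun (h n) s \<le> f s"
    using exists_step_approximation[OF f f0] by blast
  have [measurable]: "step_fun (h n) \<in> borel_measurable borel" for n
    by (rule step_fun_measurable[OF is_step_bounded[OF h]])
  define e where "e n = (\<integral>s. control (f s - step_fun (h n) s) \<partial>lborel)" for n
  have int_e: "integrable lborel (\<lambda>s. control (f s - step_fun (h n) s))" for n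
    by (rule Bochner_Integration.integrable_bound[OF int])
      (use control_nonneg h0 hf f0 in \<open>auto intro!: AE_I2 control_mono simp: abs_of_nonneg\<close>)
  have "e \<longlonglongrightarrow> (\<integral>s. 0 \<partial>(lborel :: real measure))"
    unfolding e_def
  proof (rule integral_dominated_convergence[where w="\<lambda>s. control (f s)"])
    show "AE s in lborel. (\<lambda>n. control (f s - step_fun (h n) s)) \<longlonglongrightarrow> 0"
    proof (intro AE_I2 tendsto_control_0)
      show "(\<lambda>n. f s - step_fun (h n) s) \<longlonglongrightarrow> 0" for s
        using tendsto_diff[OF tendsto_const lim, of "f s" s] by simp
    qed
  qed (use int control_nonneg h0 hf f0 in \<open>auto intro!: AE_I2 control_mono simp: abs_of_nonneg\<close>)
  then have e0: "e \<longlonglongrightarrow> 0" by simp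
  \<comment> \<open>The rate is dictated by the tail bound: the threshold \<open>(1/2)^n\<close>
    brings in a factor of order \<open>4^n\<close>, which leaves the summable
    \<open>(1/4)^n\<close>.\<close>
  have "\<exists>m\<ge>n. e m \<le> (1/16)^n" for n
  proof -
    have "\<forall>\<^sub>F m in sequentially. e m < (1/16)^n \<and> n \<le> m"
      by (intro eventually_conj eventually_ge_at_top order_tendstoD(2)[OF e0]) simp
    then obtain m where "e m < (1/16)^n" "n \<le> m" by (auto simp: eventually_sequentially)
    then show ?thesis by (intro exI[of _ m]) simp
  qed
  then have "\<exists>r. \<forall>n. n \<le> r n \<and> e (r n) \<le> (1/16)^n" by (intro choice) auto
  then obtain r where r: "\<And>n. n \<le> r n" "\<And>n. e (r n) \<le> (1/16)^n" by auto
  define g where "g n = h (r n)" for n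
  have g: "is_step (g n)" for n by (simp add: g_def h)
  note gb = is_step_bounded[OF g]
  have "filterlim r at_top sequentially"
    by (rule filterlim_at_top_mono[OF filterlim_ident]) (use r(1) in auto)
  then have glim: "(\<lambda>n. step_fun (g n) s) \<longlonglongrightarrow> f s" for s
    unfolding g_def by (rule filterlim_compose[OF lim])
  have [measurable]: "step_fun (g n) \<in> borel_measurable borel" for n by (simp add: g_def)
  define d where "d n = g (Suc n) @ scale_step (-1) (g n)" for n
  have db: "bounded_steps (d n)" for n by (simp add: d_def gb)
  have d_small: "(LINT s:A|lborel. control (step_fun (d n) s)) \<le> 10 * (1/16)^n" if A: "A \<in> sets borel" for A n
  proof -
    have "(LINT s:A|lborel. control (step_fun (d n) s)) \<le>
        (\<integral>s. 5 * (control (f s - step_fun (g n) s) + control (f s - step_fun (g (Suc n)) s)) \<partial>lborel)"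
      unfolding set_lebesgue_integral_def
    proof (rule integral_mono)
      show "integrable lborel (\<lambda>s. indicator A s *\<^sub>R control (step_fun (d n) s))"
        using A by (intro integrable_mult_indicator integrable_control_step db) simp
      show "integrable lborel (\<lambda>s. 5 * (control (f s - step_fun (g n) s) + control (f s - step_fun (g (Suc n)) s)))"
        using int_e by (simp add: g_def)
      fix s
      \<comment> \<open>The increment is compared through \<open>f\<close>, so that smallness of the
        two errors \<open>e (r n)\<close> and \<open>e (r (Suc n))\<close> can be used.\<close>
      have "control (step_fun (d n) s) = control ((f s - step_fun (g n) s) + (-1) * (f s - step_fun (g (Suc n)) s))"
        by (simp add: d_def algebra_simps)
      also have "\<dots> \<le> 5 * (control (f s - step_fun (g n) s) + control ((-1) * (f s - step_fun (g (Suc n)) s)))"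
        by (rule control_add)
      also have "control ((-1) * (f s - step_fun (g (Suc n)) s)) \<le> control (f s - step_fun (g (Suc n)) s)"
        by (intro control_mono) simp
      finally have "control (step_fun (d n) s) \<le> 5 * (control (f s - step_fun (g n) s) + control (f s - step_fun (g (Suc n)) s))"
        by simp
      then show "indicator A s *\<^sub>R control (step_fun (d n) s) \<le>
          5 * (control (f s - step_fun (g n) s) + control (f s - step_fun (g (Suc n)) s))"
        using control_nonneg by (simp add: indicator_def add_nonneg_nonneg)
    qed
    also have "\<dots> = 5 * (e (r n) + e (r (Suc n)))"
      using int_e by (simp add: e_def g_def)
    also have "\<dots> \<le> 5 * ((1/16)^n + (1/16)^Suc n)" by (intro mult_left_mono add_mono r) auto
    also have "\<dots> \<le> 10 * (1/16)^n" by simp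
    finally show ?thesis .
  qed
  \<comment> \<open>The exceptional null set may depend on \<open>A\<close>, but \<open>g\<close>
    does not: its speed was measured over the whole line, which bounds the integral over each
    \<open>A\<close>.\<close>
  have conv: "AE \<omega> in M. convergent (\<lambda>n. step_integral \<Lambda> (g n) A \<omega>)" if A: "A \<in> sets borel" for A
  proof (rule AE_convergent_if_summable[OF prob_space_axioms])
    show "step_integral \<Lambda> (g n) A \<in> borel_measurable M" for n
      by (rule step_integral_measurable[OF gb A])
    have tail: "measure M {\<omega>\<in>space M. \<bar>step_integral \<Lambda> (g (Suc n)) A \<omega> - step_integral \<Lambda> (g n) A \<omega>\<bar> > (1/2)^n} \<le> 60 * (1/4)^n" for n
    proof -
      have eq: "step_integral \<Lambda> (g (Suc n)) A \<omega> - step_integral \<Lambda> (g n) A \<omega> = step_integral \<Lambda> (d n) A \<omega>" for \<omega>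
        by (simp add: d_def)
      have "measure M {\<omega>\<in>space M. \<bar>step_integral \<Lambda> (d n) A \<omega>\<bar> > (1/2)^n} \<le> (2 + 4 / ((1/2)^n)^2) * (10 * (1/16)^n)"
      proof (rule tail_bound_char[OF prob_space_axioms])
        show "step_integral \<Lambda> (d n) A \<in> borel_measurable M" by (rule step_integral_measurable[OF db A])
        show "norm (1 - char (distr M borel (step_integral \<Lambda> (d n) A)) u) \<le> (1 + u^2) * (10 * (1/16)^n)" for u
          by (rule order_trans[OF char_step_integral_near_1[OF db A]]) (intro mult_left_mono d_small A, simp)
      qed simp
      also have "\<dots> = 20 * (1/16)^n + 40 * (1/4)^n"
      proof -
        have "((1/2)^n)^2 = (1/4::real)^n" by (simp add: power2_eq_square flip: power_mult_distrib)
        moreover have "(1/16::real)^n = (1/4)^n * (1/4)^n" by (simp flip: power_mult_distrib)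
        ultimately show ?thesis by (simp add: field_simps)
      qed
      also have "\<dots> \<le> 60 * (1/4)^n" using power_mono[of "1/16::real" "1/4" n] by simp
      finally show ?thesis unfolding eq by simp
    qed
    show "summable (\<lambda>n. measure M {\<omega>\<in>space M. \<bar>step_integral \<Lambda> (g (Suc n)) A \<omega> - step_integral \<Lambda> (g n) A \<omega>\<bar> > (1/2)^n})"
    proof (rule summable_comparison_test'[where g="\<lambda>n. 60 * (1/4)^n" and N=0])
      show "summable (\<lambda>n. 60 * (1/4 :: real)^n)" by (intro summable_mult summable_geometric) simp
    qed (use tail in simp)
  qed
  define Y where "Y A \<omega> = lim (\<lambda>n. step_integral \<Lambda> (g n) A \<omega>)" for A \<omega>
  have Y: "tendsto_in_prob M (\<lambda>n. step_integral \<Lambda> (g n) A) (Y A)" if A: "A \<in> sets borel" for A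
  proof (rule tendsto_in_prob_AE[OF prob_space_axioms])
    have [measurable]: "step_integral \<Lambda> (g n) A \<in> borel_measurable M" for n
      by (rule step_integral_measurable[OF gb A])
    then show "step_integral \<Lambda> (g n) A \<in> borel_measurable M" for n .
    show "Y A \<in> borel_measurable M" unfolding Y_def by measurable
    show "AE \<omega> in M. (\<lambda>n. step_integral \<Lambda> (g n) A \<omega>) \<longlonglongrightarrow> Y A \<omega>"
      using conv[OF A] by eventually_elim (simp add: Y_def convergent_LIMSEQ_iff)
  qed
  show ?thesis
  proof
    show "approximating_steps M \<Lambda> f g"
      unfolding approximating_steps_def using g glim Y by auto
    show "tendsto_in_prob M (\<lambda>n. step_integral \<Lambda> (g n) UNIV) (Y UNIV)" by (rule Y) simp
    fix u
    have "(\<lambda>n. char (distr M borel (step_integral \<Lambda> (g n) UNIV)) u) \<longlonglongrightarrow> char (distr M borel (Y UNIV)) u"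
      by (rule char_tendsto_in_prob[OF prob_space_axioms _ Y]) (auto intro: step_integral_measurable gb)
    moreover have "(\<lambda>n. exp (CLINT s|lborel. \<psi> (u * step_fun (g n) s))) \<longlonglongrightarrow> exp (CLINT s|lborel. \<psi> (u * f s))"
    proof (intro tendsto_exp integral_dominated_convergence[where w="\<lambda>s. (1 + u^2) * control (f s)"])
      show "AE s in lborel. (\<lambda>n. \<psi> (u * step_fun (g n) s)) \<longlonglongrightarrow> \<psi> (u * f s)"
        by (intro AE_I2 tendsto_psi tendsto_mult_left glim)
      have "norm (\<psi> (u * step_fun (g n) s)) \<le> (1 + u^2) * control (f s)" for n s
        using norm_psi_scale_le[of u "step_fun (g n) s"] h0[of "r n" s] hf[of "r n" s] f0[of s]
        by (elim order_trans) (auto intro!: mult_left_mono control_mono simp: g_def)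
      then show "AE s in lborel. norm (\<psi> (u * step_fun (g n) s)) \<le> (1 + u^2) * control (f s)" for n
        by simp
    qed (use int in auto)
    moreover have "char (distr M borel (step_integral \<Lambda> (g n) UNIV)) u = exp (CLINT s|lborel. \<psi> (u * step_fun (g n) s))" for n
      by (simp add: char_step_integral gb)
    ultimately show "char (distr M borel (Y UNIV)) u = exp (CLINT s|lborel. \<psi> (u * f s))"
      by (simp only:) (rule LIMSEQ_unique)
  qed
qed

lemma integral_unique:
  assumes g: "approximating_steps M \<Lambda> f g" "approximating_steps M \<Lambda> f g'"
    and X: "tendsto_in_prob M (\<lambda>n. step_integral \<Lambda> (g n) UNIV) X"
      "tendsto_in_prob M (\<lambda>n. step_integral \<Lambda> (g' n) UNIV) X'"
  shows "AE \<omega> in M. X \<omega> = X' \<omega>"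
proof -
  define k where "k n = g n @ scale_step (-1) (g' n)" for n
  have gb: "bounded_steps (g n)" "bounded_steps (g' n)" for n
    using g by (auto simp: approximating_steps_def is_step_bounded)
  have kb: "bounded_steps (k n)" for n by (simp add: k_def gb)
  note meas = step_integral_measurable[OF kb]
  have k_eq: "step_integral \<Lambda> (k n) A = (\<lambda>\<omega>. step_integral \<Lambda> (g n) A \<omega> - step_integral \<Lambda> (g' n) A \<omega>)" for n A
    by (rule ext) (simp add: k_def)
  have k_lim: "\<exists>V. tendsto_in_prob M (\<lambda>n. step_integral \<Lambda> (k n) A) V" if A: "A \<in> sets borel" for A
  proof -
    obtain Y Y' where "tendsto_in_prob M (\<lambda>n. step_integral \<Lambda> (g n) A) Y" "tendsto_in_prob M (\<lambda>n. step_integral \<Lambda> (g' n) A) Y'"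
      using g A unfolding approximating_steps_def by blast
    then show ?thesis unfolding k_eq
      by (intro exI[of _ "\<lambda>\<omega>. Y \<omega> - Y' \<omega>"] tendsto_in_prob_diff[OF prob_space_axioms])
        (auto intro: step_integral_measurable gb A)
  qed
  have k0: "AE s in lborel. (\<lambda>n. control (step_fun (k n) s)) \<longlonglongrightarrow> 0"
  proof -
    have "AE s in lborel. (\<lambda>n. step_fun (g n) s) \<longlonglongrightarrow> f s" "AE s in lborel. (\<lambda>n. step_fun (g' n) s) \<longlonglongrightarrow> f s"
      using g by (auto simp: approximating_steps_def)
    then show ?thesis
    proof eventually_elim
      fix s assume "(\<lambda>n. step_fun (g n) s) \<longlonglongrightarrow> f s" "(\<lambda>n. step_fun (g' n) s) \<longlonglongrightarrow> f s"
      from tendsto_diff[OF this] show "(\<lambda>n. control (step_fun (k n) s)) \<longlonglongrightarrow> 0"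
        by (intro tendsto_control_0) (simp add: k_def)
    qed
  qed
  obtain A r r' where A: "A \<in> sets borel" and r: "strict_mono r" "strict_mono r'"
    and small: "(\<lambda>i. LINT s:A|lborel. control (step_fun (k (r i)) s)) \<longlonglongrightarrow> 0"
      "(\<lambda>i. LINT s:-A|lborel. control (step_fun (k (r' i)) s)) \<longlonglongrightarrow> 0"
    by (rule split_null_sequence[of "\<lambda>n s. control (step_fun (k n) s)", OF integrable_control_step[OF kb] control_nonneg k0])
  \<comment> \<open>Smallness is known along one subsequence only. Since the whole sequence
    converges in probability over \<open>B\<close>, the subsequence identifies the full limit; this
    is where convergence over every Borel set enters.\<close>
  have zero: "AE \<omega> in M. V \<omega> = 0"
    if B: "B \<in> sets borel" and r: "strict_mono r"
      and small: "(\<lambda>i. LINT s:B|lborel. control (step_fun (k (r i)) s)) \<longlonglongrightarrow> 0"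
      and V: "tendsto_in_prob M (\<lambda>n. step_integral \<Lambda> (k n) B) V" for B V r
  proof (rule tendsto_in_prob_zero[OF prob_space_axioms])
    show "tendsto_in_prob M (\<lambda>i. step_integral \<Lambda> (k (r i)) B) V"
      by (rule tendsto_in_prob_subseq[OF V r])
    show "step_integral \<Lambda> (k (r i)) B \<in> borel_measurable M" for i by (rule meas[OF B])
    fix u
    have "(\<lambda>i. (1 + u^2) * (LINT s:B|lborel. control (step_fun (k (r i)) s))) \<longlonglongrightarrow> 0"
      by (rule tendsto_mult_right_zero[OF small])
    then have "(\<lambda>i. 1 - char (distr M borel (step_integral \<Lambda> (k (r i)) B)) u) \<longlonglongrightarrow> 0"
      by (rule Lim_null_comparison[rotated]) (auto intro!: always_eventually char_step_integral_near_1 kb B)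
    from tendsto_diff[OF tendsto_const this, of 1]
    show "(\<lambda>i. char (distr M borel (step_integral \<Lambda> (k (r i)) B)) u) \<longlonglongrightarrow> 1" by simp
  qed
  have A': "- A \<in> sets borel" using A by auto
  obtain V where V: "tendsto_in_prob M (\<lambda>n. step_integral \<Lambda> (k n) A) V" using k_lim[OF A] by blast
  obtain V' where V': "tendsto_in_prob M (\<lambda>n. step_integral \<Lambda> (k n) (- A)) V'" using k_lim[OF A'] by blast
  have V0: "AE \<omega> in M. V \<omega> = 0" by (rule zero[OF A r(1) small(1) V])
  have V'0: "AE \<omega> in M. V' \<omega> = 0" by (rule zero[OF A' r(2) small(2) V'])
  \<comment> \<open>\<open>?W n\<close> vanishes almost surely by additivity, while its limit in
    probability is \<open>X - X' - V - V'\<close>.\<close>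
  let ?W = "\<lambda>n \<omega>. step_integral \<Lambda> (k n) UNIV \<omega> - step_integral \<Lambda> (k n) A \<omega> - step_integral \<Lambda> (k n) (- A) \<omega>"
  have "AE \<omega> in M. X \<omega> - X' \<omega> - V \<omega> - V' \<omega> = 0"
  proof (rule tendsto_in_prob_zero[OF prob_space_axioms])
    have [measurable]: "step_integral \<Lambda> (k n) UNIV \<in> borel_measurable M" "step_integral \<Lambda> (k n) A \<in> borel_measurable M"
      "step_integral \<Lambda> (k n) (- A) \<in> borel_measurable M" for n using meas A A' by auto
    show "?W n \<in> borel_measurable M" for n by measurable
    have "tendsto_in_prob M (\<lambda>n. step_integral \<Lambda> (k n) UNIV) (\<lambda>\<omega>. X \<omega> - X' \<omega>)"
      unfolding k_eq by (intro tendsto_in_prob_diff[OF prob_space_axioms] X) (auto intro: step_integral_measurable gb)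
    then show "tendsto_in_prob M ?W (\<lambda>\<omega>. X \<omega> - X' \<omega> - V \<omega> - V' \<omega>)"
      by (intro tendsto_in_prob_diff[OF prob_space_axioms] V V') auto
    have "distr M borel (?W n) = distr M borel (\<lambda>_. 0)" for n
      using step_integral_split[OF kb[of n] A] by (intro distr_cong_AE) (auto elim: eventually_mono)
    then show "(\<lambda>n. char (distr M borel (?W n)) u) \<longlonglongrightarrow> 1" for u
      by (simp add: char_def integral_return)
  qed
  with V0 V'0 show ?thesis by eventually_elim simp
qed

lemma has_rm_integral_char:
  assumes "f \<in> borel_measurable borel" "\<And>s. 0 \<le> f s" "integrable lborel (\<lambda>s. control (f s))"
    and X: "has_rm_integral M \<Lambda> f X"
  shows "char (distr M borel X) u = exp (CLINT s|lborel. \<psi> (u * f s))"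
proof -
  obtain g X' where g: "approximating_steps M \<Lambda> f g" and X': "tendsto_in_prob M (\<lambda>n. step_integral \<Lambda> (g n) UNIV) X'"
    and char: "\<And>u. char (distr M borel X') u = exp (CLINT s|lborel. \<psi> (u * f s))"
    using integral_exists[OF assms(1-3)] by blast
  obtain g' where g': "approximating_steps M \<Lambda> f g'" and Xg: "tendsto_in_prob M (\<lambda>n. step_integral \<Lambda> (g' n) UNIV) X"
    using X unfolding has_rm_integral_def by blast
  have "distr M borel X = distr M borel X'"
    using integral_unique[OF g' g Xg X'] X' Xg by (intro distr_cong_AE) (auto simp: tendsto_in_prob_def)
  then show ?thesis by (simp add: char)
qed

end

section \<open>The well-balanced kernel\<close>

lemma nn_integral_abs_diff:
  fixes g :: "real \<Rightarrow> ennreal"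
  assumes [measurable]: "g \<in> borel_measurable borel"
  shows "(\<integral>\<^sup>+s. g \<bar>t - s\<bar> \<partial>lborel) = 2 * (\<integral>\<^sup>+x. g x * indicator {0..} x \<partial>lborel)"
proof -
  have "(\<integral>\<^sup>+s. g \<bar>t - s\<bar> \<partial>lborel) = (\<integral>\<^sup>+x. g \<bar>x\<bar> \<partial>lborel)"
    by (subst nn_integral_real_affine[of _ 1 t]) auto
  also have "\<dots> = (\<integral>\<^sup>+x. g x * indicator {0..} x + g (- x) * indicator {0..} (- x) \<partial>lborel)"
  proof (rule nn_integral_cong_AE)
    \<comment> \<open>The point 0 is counted twice on the right-hand side.\<close>
    show "AE x in lborel. g \<bar>x\<bar> = g x * indicator {0..} x + g (- x) * indicator {0..} (- x)"
      using AE_lborel_singleton[of 0] by eventually_elim (auto simp: indicator_def)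
  qed
  also have "\<dots> = (\<integral>\<^sup>+x. g x * indicator {0..} x \<partial>lborel) + (\<integral>\<^sup>+x. g (- x) * indicator {0..} (- x) \<partial>lborel)"
    by (rule nn_integral_add) auto
  also have "(\<integral>\<^sup>+x. g (- x) * indicator {0..} (- x) \<partial>lborel) = (\<integral>\<^sup>+x. g x * indicator {0..} x \<partial>lborel)"
    by (subst (2) nn_integral_real_affine[of _ "-1" 0]) auto
  finally show ?thesis by (simp add: mult_2)
qed

lemma nn_integral_exp_abs:
  fixes c r t :: real
  assumes "0 < c" "0 \<le> r"
  shows "(\<integral>\<^sup>+s. ennreal (exp (- c * \<bar>t - s\<bar>)) * indicator {r..} \<bar>t - s\<bar> \<partial>lborel) = ennreal (2 * exp (- c * r) / c)"
proof -
  have "(\<integral>\<^sup>+s. ennreal (exp (- c * \<bar>t - s\<bar>)) * indicator {r..} \<bar>t - s\<bar> \<partial>lborel)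
      = 2 * (\<integral>\<^sup>+x. ennreal (exp (- c * x)) * indicator {r..} x * indicator {0..} x \<partial>lborel)"
    by (rule nn_integral_abs_diff[of "\<lambda>x. ennreal (exp (- c * x)) * indicator {r..} x"]) measurable
  also have "(\<integral>\<^sup>+x. ennreal (exp (- c * x)) * indicator {r..} x * indicator {0..} x \<partial>lborel)
      = (\<integral>\<^sup>+x. ennreal (exp (- c * x)) * indicator {r..} x \<partial>lborel)"
    using assms by (intro nn_integral_cong) (auto simp: indicator_def)
  also have "\<dots> = ennreal (0 - (- exp (- c * r) / c))"
  proof (rule nn_integral_FTC_atLeast)
    show "((\<lambda>x. - exp (- c * x) / c) \<longlongrightarrow> 0) at_top"
      using assms by real_asymp
  qed (use assms in \<open>auto intro!: derivative_eq_intros\<close>)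
  finally show ?thesis using assms by (simp flip: ennreal_mult' ennreal_numeral)
qed

lemma wbou_kernel_simps:
  "wbou_kernel lam t s > 0" "wbou_kernel lam t s \<noteq> 0"
  "0 \<le> lam \<Longrightarrow> wbou_kernel lam t s \<le> 1" "lam \<le> 0 \<Longrightarrow> 1 \<le> wbou_kernel lam t s"
  by (auto simp: wbou_kernel_def mult_nonneg_nonneg mult_nonpos_nonneg)

lemma wbou_kernel_measurable [measurable]: "wbou_kernel lam t \<in> borel_measurable borel"
  unfolding wbou_kernel_def by measurable

lemma wbou_kernel_ge_iff:
  assumes "0 < lam" "0 < x" shows "1 \<le> x * wbou_kernel lam t s \<longleftrightarrow> \<bar>t - s\<bar> \<le> ln x / lam"
proof -
  have "1 \<le> x * wbou_kernel lam t s \<longleftrightarrow> exp (lam * \<bar>t - s\<bar>) \<le> x"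
    using assms by (simp add: wbou_kernel_def exp_minus field_simps)
  also have "\<dots> \<longleftrightarrow> lam * \<bar>t - s\<bar> \<le> ln x" using assms by (simp add: ln_ge_iff)
  finally show ?thesis using assms by (simp add: field_simps)
qed

lemma nn_integral_wbou_kernel:
  assumes "0 < lam"
  shows "(\<integral>\<^sup>+s. ennreal (wbou_kernel lam t s) \<partial>lborel) = ennreal (2 / lam)"
    "(\<integral>\<^sup>+s. ennreal ((wbou_kernel lam t s)^2) \<partial>lborel) = ennreal (1 / lam)"
proof -
  have "(wbou_kernel lam t s)^2 = exp (- (2 * lam) * \<bar>t - s\<bar>)" for s
    by (simp add: wbou_kernel_def power2_eq_square flip: exp_add)
  then show "(\<integral>\<^sup>+s. ennreal (wbou_kernel lam t s) \<partial>lborel) = ennreal (2 / lam)"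
    "(\<integral>\<^sup>+s. ennreal ((wbou_kernel lam t s)^2) \<partial>lborel) = ennreal (1 / lam)"
    using nn_integral_exp_abs[of lam 0 t] nn_integral_exp_abs[of "2 * lam" 0 t] assms
    by (auto simp: wbou_kernel_def)
qed

text \<open>Multiplied by \<open>x\<close>, the value is \<open>2 / lam\<close> whatever
  \<open>x\<close> is. Therefore the drift correction sees only the masses of the two tails of
  \<open>\<nu>\<close>, and not a first moment, which might be infinite.\<close>

lemma nn_integral_wbou_kernel_tail:
  assumes "0 < lam" "1 \<le> x"
  shows "(\<integral>\<^sup>+s. ennreal (wbou_kernel lam t s) * indicator {s. x * wbou_kernel lam t s \<le> 1} s \<partial>lborel) = ennreal (2 / (lam * x))"
proof -
  have "x * wbou_kernel lam t s \<le> 1 \<longleftrightarrow> ln x / lam \<le> \<bar>t - s\<bar>" for s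
  proof -
    have "x * wbou_kernel lam t s \<le> 1 \<longleftrightarrow> x \<le> exp (lam * \<bar>t - s\<bar>)"
      by (simp add: wbou_kernel_def exp_minus field_simps)
    also have "\<dots> \<longleftrightarrow> ln x \<le> lam * \<bar>t - s\<bar>" using assms by (metis exp_le_cancel_iff exp_ln less_le_trans zero_less_one)
    finally show ?thesis using assms by (simp add: field_simps)
  qed
  then have "(\<integral>\<^sup>+s. ennreal (wbou_kernel lam t s) * indicator {s. x * wbou_kernel lam t s \<le> 1} s \<partial>lborel)
      = (\<integral>\<^sup>+s. ennreal (exp (- lam * \<bar>t - s\<bar>)) * indicator {ln x / lam..} \<bar>t - s\<bar> \<partial>lborel)"
    by (intro nn_integral_cong) (auto simp: wbou_kernel_def indicator_def)
  also have "\<dots> = ennreal (2 * exp (- lam * (ln x / lam)) / lam)"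
    using assms by (intro nn_integral_exp_abs) auto
  also have "2 * exp (- lam * (ln x / lam)) / lam = 2 / (lam * x)"
    using assms by (simp add: exp_minus field_simps)
  finally show ?thesis .
qed

lemma integral_wbou_kernel:
  assumes "0 < lam"
  shows "has_bochner_integral lborel (wbou_kernel lam t) (2 / lam)"
    "has_bochner_integral lborel (\<lambda>s. (wbou_kernel lam t s)^2) (1 / lam)"
  using nn_integral_wbou_kernel[OF assms, of t] assms
  by (auto intro!: has_bochner_integral_nn_integral simp: wbou_kernel_simps less_imp_le)

text \<open>
  This bound on the integral in \<open>s\<close> is where the logarithm in the moment condition comes from:
  \<open>\<bar>x\<bar> * wbou_kernel lam t s\<close> exceeds \<open>1\<close> exactly for \<open>\<bar>t - s\<bar> < ln \<bar>x\<bar> / lam\<close>.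
\<close>

lemma nn_integral_levy_kernel_wbou:
  assumes lam: "0 < lam"
  shows "(\<integral>\<^sup>+s. ennreal (levy_kernel x (wbou_kernel lam t s)) \<partial>lborel) \<le>
    ennreal (2 / lam) * ennreal (min 1 (x^2)) + ennreal (4 / lam) * (ennreal (ln \<bar>x\<bar>) * indicator {x. \<bar>x\<bar> > 1} x)"
proof (cases "\<bar>x\<bar> \<le> 1")
  case True
  then have x2: "x^2 \<le> 1" by (simp add: abs_square_le_1)
  have "(\<integral>\<^sup>+s. ennreal (levy_kernel x (wbou_kernel lam t s)) \<partial>lborel)
      = (\<integral>\<^sup>+s. ennreal (x^2) * ennreal ((wbou_kernel lam t s)^2) \<partial>lborel)"
    using True by (simp add: levy_kernel_def ennreal_mult)
  also have "\<dots> = ennreal (x^2) * ennreal (1 / lam)"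
    by (simp add: nn_integral_cmult nn_integral_wbou_kernel lam)
  also have "\<dots> = ennreal (x^2 * (1 / lam))" using lam by (intro ennreal_mult[symmetric]) simp_all
  also have "\<dots> \<le> ennreal (2 / lam * min 1 (x^2))"
    using lam x2 by (intro ennreal_leI) (simp add: field_simps)
  also have "\<dots> = ennreal (2 / lam) * ennreal (min 1 (x^2))" using lam by (intro ennreal_mult) auto
  finally show ?thesis by (simp add: add_increasing2)
next
  case False
  then have x: "1 < \<bar>x\<bar>" by simp
  have x2: "min 1 (x^2) = 1" using x by (simp add: abs_square_le_1[symmetric] min_def) (metis abs_square_less_1 leI less_asym)
  let ?f = "wbou_kernel lam t"
  let ?I = "indicator {t - ln \<bar>x\<bar> / lam..t + ln \<bar>x\<bar> / lam} :: real \<Rightarrow> ennreal"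
  \<comment> \<open>Where \<open>|x| * ?f s > 1\<close> the kernel is bounded by 2 on an interval of
    length \<open>2 * ln |x| / lam\<close>, which produces \<open>4 / lam\<close>. Elsewhere the
    linear bound integrates to \<open>2 / lam\<close>, the first term of the claim because
    \<open>min 1 (x^2) = 1\<close>.\<close>
  have "ennreal (levy_kernel x (?f s)) \<le> 2 * ?I s + ennreal \<bar>x\<bar> * (ennreal (?f s) * indicator {s. \<bar>x\<bar> * ?f s \<le> 1} s)" for s
  proof (cases "\<bar>x\<bar> * ?f s \<le> 1")
    case True
    have "levy_kernel x (?f s) \<le> \<bar>x\<bar> * ?f s" using x wbou_kernel_simps(1)[of lam t s] by (simp add: levy_kernel_def abs_mult)
    then have "ennreal (levy_kernel x (?f s)) \<le> ennreal \<bar>x\<bar> * ennreal (?f s)"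
      using wbou_kernel_simps(1)[of lam t s] by (simp add: ennreal_leI flip: ennreal_mult)
    then show ?thesis using True by (simp add: add_increasing)
  next
    case False
    then have "\<bar>t - s\<bar> \<le> ln \<bar>x\<bar> / lam" using wbou_kernel_ge_iff[OF lam, of "\<bar>x\<bar>" t s] x by simp
    then have "?I s = 1" by (auto simp: indicator_def abs_le_iff)
    moreover have "ennreal (levy_kernel x (?f s)) \<le> ennreal 2" using x by (intro ennreal_leI) (simp add: levy_kernel_def)
    ultimately show ?thesis by (simp add: add_increasing2)
  qed
  then have "(\<integral>\<^sup>+s. ennreal (levy_kernel x (?f s)) \<partial>lborel) \<le>
      (\<integral>\<^sup>+s. 2 * ?I s + ennreal \<bar>x\<bar> * (ennreal (?f s) * indicator {s. \<bar>x\<bar> * ?f s \<le> 1} s) \<partial>lborel)"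
    by (intro nn_integral_mono)
  also have "\<dots> = 2 * (\<integral>\<^sup>+s. ?I s \<partial>lborel) + ennreal \<bar>x\<bar> * (\<integral>\<^sup>+s. ennreal (?f s) * indicator {s. \<bar>x\<bar> * ?f s \<le> 1} s \<partial>lborel)"
    by (subst nn_integral_add) (auto simp: nn_integral_cmult)
  also have "(\<integral>\<^sup>+s. ?I s \<partial>lborel) = ennreal (2 * ln \<bar>x\<bar> / lam)"
    using x lam by (simp add: emeasure_lborel_Icc_eq)
  also have "(\<integral>\<^sup>+s. ennreal (?f s) * indicator {s. \<bar>x\<bar> * ?f s \<le> 1} s \<partial>lborel) = ennreal (2 / (lam * \<bar>x\<bar>))"
    using x by (intro nn_integral_wbou_kernel_tail lam) simp
  also have "2 * ennreal (2 * ln \<bar>x\<bar> / lam) = ennreal (4 / lam) * ennreal (ln \<bar>x\<bar>)"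
    using x lam by (simp flip: ennreal_mult ennreal_mult' ennreal_numeral)
  also have "ennreal \<bar>x\<bar> * ennreal (2 / (lam * \<bar>x\<bar>)) = ennreal (2 / lam)"
    using x lam by (simp flip: ennreal_mult)
  finally show ?thesis using x by (simp add: x2 add.commute)
qed

section \<open>The image of the Levy measure under the kernel\<close>

context levy_triplet
begin

interpretation pair: pair_sigma_finite \<nu> lborel ..

lemma pair_measurable: "g \<in> borel_measurable (borel \<Otimes>\<^sub>M borel) \<Longrightarrow> g \<in> borel_measurable (\<nu> \<Otimes>\<^sub>M lborel)"
  by (simp cong: measurable_cong_sets sets_pair_measure_cong)

lemma AE_pair_nonzero: "AE p in \<nu> \<Otimes>\<^sub>M lborel. fst p \<noteq> 0"
proof (rule AE_I)
  show "{p \<in> space (\<nu> \<Otimes>\<^sub>M lborel). \<not> fst p \<noteq> 0} \<subseteq> {0} \<times> UNIV" by auto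
  show "emeasure (\<nu> \<Otimes>\<^sub>M lborel) ({0} \<times> UNIV) = 0"
    using levy by (subst lborel.emeasure_pair_measure_Times) (auto simp: levy_measure_def)
  show "{0} \<times> UNIV \<in> sets (\<nu> \<Otimes>\<^sub>M lborel)" by (intro pair_measureI) auto
qed

text \<open>The kernel never vanishes and \<open>\<nu>\<close> has no mass at 0, so removing 0 from
  \<open>A\<close> changes only a null set. As an image measure, the object admits change of
  variables and Fubini.\<close>

lemma wbou_levy_measure_eq:
  "wbou_levy_measure lam \<nu> t = distr (\<nu> \<Otimes>\<^sub>M lborel) borel (\<lambda>(x, s). x * wbou_kernel lam t s)"
proof -
  let ?h = "\<lambda>(x, s). x * wbou_kernel lam t s"
  let ?D = "distr (\<nu> \<Otimes>\<^sub>M lborel) borel ?h"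
  have h [measurable]: "?h \<in> borel_measurable (\<nu> \<Otimes>\<^sub>M lborel)" by (intro pair_measurable) measurable
  have space: "space (\<nu> \<Otimes>\<^sub>M lborel) = UNIV"
    using sets_eq_imp_space_eq[OF sets_nu] by (simp add: space_pair_measure)
  have eq: "emeasure (\<nu> \<Otimes>\<^sub>M lborel) {(x, s). x * exp (- lam * \<bar>t - s\<bar>) \<in> A - {0}} = emeasure ?D A"
    if A: "A \<in> sets borel" for A
  proof -
    have "emeasure ?D A = emeasure (\<nu> \<Otimes>\<^sub>M lborel) (?h -` A \<inter> space (\<nu> \<Otimes>\<^sub>M lborel))"
      using A h by (rule emeasure_distr[rotated])
    also have "\<dots> = emeasure (\<nu> \<Otimes>\<^sub>M lborel) (?h -` (A - {0}) \<inter> space (\<nu> \<Otimes>\<^sub>M lborel))"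
    proof (rule emeasure_eq_AE)
      show "AE p in \<nu> \<Otimes>\<^sub>M lborel. p \<in> ?h -` A \<inter> space (\<nu> \<Otimes>\<^sub>M lborel) \<longleftrightarrow> p \<in> ?h -` (A - {0}) \<inter> space (\<nu> \<Otimes>\<^sub>M lborel)"
        using AE_pair_nonzero by eventually_elim (auto simp: wbou_kernel_simps)
    qed (rule measurable_sets[OF h], use A in simp)+
    also have "?h -` (A - {0}) \<inter> space (\<nu> \<Otimes>\<^sub>M lborel) = {(x, s). x * exp (- lam * \<bar>t - s\<bar>) \<in> A - {0}}"
      by (auto simp: space wbou_kernel_def)
    finally show ?thesis by simp
  qed
  have "wbou_levy_measure lam \<nu> t = measure_of UNIV (sets borel) (emeasure ?D)"
    unfolding wbou_levy_measure_def
  proof (rule measure_of_eq)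
    fix A :: "real set" assume "A \<in> sigma_sets UNIV (sets borel)"
    then have "A \<in> sets borel" using sets.sigma_sets_eq[of "borel :: real measure"] by simp
    then show "emeasure (\<nu> \<Otimes>\<^sub>M lborel) {(x, s). x * exp (- lam * \<bar>t - s\<bar>) \<in> A - {0}} = emeasure ?D A"
      by (rule eq)
  qed auto
  also have "\<dots> = ?D" using measure_of_of_measure[of ?D] by simp
  finally show ?thesis .
qed

lemma nn_integral_wbou_levy_measure:
  assumes [measurable]: "g \<in> borel_measurable borel"
  shows "(\<integral>\<^sup>+y. g y \<partial>wbou_levy_measure lam \<nu> t) = (\<integral>\<^sup>+x. \<integral>\<^sup>+s. g (x * wbou_kernel lam t s) \<partial>lborel \<partial>\<nu>)"
proof -
  have m: "(\<lambda>(x, s). x * wbou_kernel lam t s) \<in> borel_measurable (\<nu> \<Otimes>\<^sub>M lborel)"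
    by (intro pair_measurable) measurable
  have "(\<integral>\<^sup>+y. g y \<partial>wbou_levy_measure lam \<nu> t) = (\<integral>\<^sup>+p. g (case p of (x, s) \<Rightarrow> x * wbou_kernel lam t s) \<partial>(\<nu> \<Otimes>\<^sub>M lborel))"
    unfolding wbou_levy_measure_eq by (rule nn_integral_distr[OF m]) simp
  also have "\<dots> = (\<integral>\<^sup>+x. \<integral>\<^sup>+s. g (x * wbou_kernel lam t s) \<partial>lborel \<partial>\<nu>)"
    using m by (subst lborel.nn_integral_fst[symmetric]) auto
  finally show ?thesis .
qed

text \<open>For \<open>|x| > 1\<close> the scaled jump has absolute value at least 1 on an interval
  of length \<open>2 * ln |x| / lam\<close>, where the truncated square equals 1.\<close>

lemma log_moment_if_levy_measure:
  assumes lam: "0 < lam" and lm: "levy_measure (wbou_levy_measure lam \<nu> t)"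
  shows "(\<integral>\<^sup>+x\<in>{x. \<bar>x\<bar> > 1}. ennreal (ln \<bar>x\<bar>) \<partial>\<nu>) < \<infinity>"
proof -
  let ?f = "wbou_kernel lam t"
  have "ennreal (2 / lam) * (ennreal (ln \<bar>x\<bar>) * indicator {x. \<bar>x\<bar> > 1} x) \<le> (\<integral>\<^sup>+s. ennreal (min 1 ((x * ?f s)^2)) \<partial>lborel)" for x
  proof (cases "1 < \<bar>x\<bar>")
    case True
    have "ennreal (2 / lam) * (ennreal (ln \<bar>x\<bar>) * indicator {x. \<bar>x\<bar> > 1} x) = ennreal (2 * ln \<bar>x\<bar> / lam)"
      using True lam by (simp flip: ennreal_mult)
    also have "\<dots> = (\<integral>\<^sup>+s. indicator {t - ln \<bar>x\<bar> / lam..t + ln \<bar>x\<bar> / lam} s \<partial>lborel)"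
      using True lam by (simp add: emeasure_lborel_Icc_eq)
    also have "\<dots> \<le> (\<integral>\<^sup>+s. ennreal (min 1 ((x * ?f s)^2)) \<partial>lborel)"
    proof (intro nn_integral_mono)
      fix s
      show "indicator {t - ln \<bar>x\<bar> / lam..t + ln \<bar>x\<bar> / lam} s \<le> ennreal (min 1 ((x * ?f s)^2))"
      proof (cases "s \<in> {t - ln \<bar>x\<bar> / lam..t + ln \<bar>x\<bar> / lam}")
        case s: True
        then have "\<bar>t - s\<bar> \<le> ln \<bar>x\<bar> / lam" by (auto simp: abs_le_iff)
        then have "1 \<le> \<bar>x * ?f s\<bar>" using wbou_kernel_ge_iff[OF lam, of "\<bar>x\<bar>" t s] True wbou_kernel_simps(1)[of lam t s]
          by (simp add: abs_mult)
        then have "1 \<le> (x * ?f s)^2" by (metis abs_1 abs_le_square_iff one_power2)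
        then show ?thesis using s by (simp add: min_def)
      qed simp
    qed
    finally show ?thesis .
  qed simp
  then have "(\<integral>\<^sup>+x. ennreal (2 / lam) * (ennreal (ln \<bar>x\<bar>) * indicator {x. \<bar>x\<bar> > 1} x) \<partial>\<nu>) \<le>
      (\<integral>\<^sup>+x. \<integral>\<^sup>+s. ennreal (min 1 ((x * ?f s)^2)) \<partial>lborel \<partial>\<nu>)"
    by (intro nn_integral_mono)
  also have "\<dots> = (\<integral>\<^sup>+y. ennreal (min 1 (y^2)) \<partial>wbou_levy_measure lam \<nu> t)"
    by (subst nn_integral_wbou_levy_measure) auto
  also have "\<dots> < \<infinity>" using lm by (simp add: levy_measure_def)
  also have "(\<integral>\<^sup>+x. ennreal (2 / lam) * (ennreal (ln \<bar>x\<bar>) * indicator {x. \<bar>x\<bar> > 1} x) \<partial>\<nu>)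
      = ennreal (2 / lam) * (\<integral>\<^sup>+x\<in>{x. \<bar>x\<bar> > 1}. ennreal (ln \<bar>x\<bar>) \<partial>\<nu>)"
    by (rule nn_integral_cmult) simp
  finally show ?thesis using lam by (auto simp: ennreal_mult_less_top)
qed

text \<open>For \<open>lam \<le> 0\<close> the kernel is at least 1 at all times, so every nonzero
  jump contributes an infinite amount to the truncated second moment of the image.\<close>

lemma null_if_levy_measure:
  assumes lam: "lam \<le> 0" and lm: "levy_measure (wbou_levy_measure lam \<nu> t)"
  shows "emeasure \<nu> UNIV = 0"
proof -
  let ?f = "wbou_kernel lam t"
  have "(\<integral>\<^sup>+x. \<infinity> * ennreal (min 1 (x^2)) \<partial>\<nu>) \<le> (\<integral>\<^sup>+x. \<integral>\<^sup>+s. ennreal (min 1 ((x * ?f s)^2)) \<partial>lborel \<partial>\<nu>)"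
  proof (intro nn_integral_mono)
    fix x
    have "\<infinity> * ennreal (min 1 (x^2)) = (\<integral>\<^sup>+s. ennreal (min 1 (x^2)) \<partial>(lborel :: real measure))"
      by (simp add: mult.commute)
    also have "\<dots> \<le> (\<integral>\<^sup>+s. ennreal (min 1 ((x * ?f s)^2)) \<partial>lborel)"
    proof (intro nn_integral_mono ennreal_leI min.mono order_refl)
      fix s
      have "1 \<le> (?f s)^2" using wbou_kernel_simps(4)[OF lam] by (simp add: one_le_power)
      then show "x^2 \<le> (x * ?f s)^2" by (simp add: power_mult_distrib mult_le_cancel_left1)
    qed
    finally show "\<infinity> * ennreal (min 1 (x^2)) \<le> (\<integral>\<^sup>+s. ennreal (min 1 ((x * ?f s)^2)) \<partial>lborel)" .
  qed
  also have "\<dots> = (\<integral>\<^sup>+y. ennreal (min 1 (y^2)) \<partial>wbou_levy_measure lam \<nu> t)"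
    by (subst nn_integral_wbou_levy_measure) auto
  also have "\<dots> < \<infinity>" using lm by (simp add: levy_measure_def)
  \<comment> \<open>In \<open>ennreal\<close> an infinite factor is compatible with a finite product
    only if the other factor is 0.\<close>
  finally have "\<infinity> * (\<integral>\<^sup>+x. ennreal (min 1 (x^2)) \<partial>\<nu>) < \<infinity>" by (simp add: nn_integral_cmult)
  then have "(\<integral>\<^sup>+x. ennreal (min 1 (x^2)) \<partial>\<nu>) = 0" by (auto simp: ennreal_mult_less_top)
  then have "AE x in \<nu>. ennreal (min 1 (x^2)) = 0" by (subst (asm) nn_integral_0_iff_AE) auto
  moreover have "AE x in \<nu>. x \<noteq> 0"
    using levy by (intro AE_I[of _ _ "{0}"]) (auto simp: levy_measure_def)
  ultimately have "AE x in \<nu>. False" by eventually_elim (auto simp: min_def split: if_splits)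
  then show ?thesis
    using sets_eq_imp_space_eq[OF sets_nu] by (auto simp: AE_iff_measurable[OF sets.top] dest: AE_E)
qed

end

section \<open>Infinite divisibility through roots of the characteristic function\<close>

lemma (in real_distribution) sum_components_measurable:
  "(\<lambda>x. \<Sum>i<n::nat. x i) \<in> borel_measurable (\<Pi>\<^sub>M i\<in>{..<n}. M)"
proof (intro borel_measurable_sum)
  fix i assume "i \<in> {..<n}"
  then have "(\<lambda>x. x i) \<in> (\<Pi>\<^sub>M i\<in>{..<n}. M) \<rightarrow>\<^sub>M M" by (rule measurable_component_singleton)
  then show "(\<lambda>x. x i) \<in> borel_measurable (\<Pi>\<^sub>M i\<in>{..<n}. M)"
    using measurable_cong_sets[OF refl events_eq_borel] by blast
qed

lemma char_sum_PiM:
  assumes "real_distribution \<mu>"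
  shows "char (distr (\<Pi>\<^sub>M i\<in>{..<n::nat}. \<mu>) borel (\<lambda>x. \<Sum>i<n. x i)) u = char \<mu> u ^ n"
proof -
  interpret real_distribution \<mu> by fact
  interpret product_sigma_finite "\<lambda>_::nat. \<mu>" ..
  note m = sum_components_measurable[of n]
  have "char (distr (\<Pi>\<^sub>M i\<in>{..<n}. \<mu>) borel (\<lambda>x. \<Sum>i<n. x i)) u
      = (CLINT x|(\<Pi>\<^sub>M i\<in>{..<n}. \<mu>). iexp (u * (\<Sum>i<n. x i)))"
    unfolding char_def by (rule integral_distr[OF m]) simp
  also have "\<dots> = (CLINT x|(\<Pi>\<^sub>M i\<in>{..<n}. \<mu>). (\<Prod>i<n. iexp (u * x i)))"
    by (simp only: exp_sum[OF finite_lessThan, symmetric] sum_distrib_left of_real_sum)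
  also have "\<dots> = (\<Prod>i<n. CLINT x|\<mu>. iexp (u * x))"
    by (rule product_integral_prod) (auto intro!: integrable_const_bound[where B=1])
  finally show ?thesis by (simp add: char_def)
qed

text \<open>The roots are required to be characteristic functions of laws themselves; the n-fold
  convolution of such a law is then \<open>\<mu>\<close> by uniqueness.\<close>

lemma infinitely_divisible_if_char_roots:
  assumes \<mu>: "real_distribution \<mu>"
    and roots: "\<And>n::nat. 1 \<le> n \<Longrightarrow> \<exists>\<mu>'. real_distribution \<mu>' \<and> (\<forall>u. char \<mu> u = char \<mu>' u ^ n)"
  shows "infinitely_divisible \<mu>"
  unfolding infinitely_divisible_def
proof (intro allI impI)
  fix n :: nat assume "1 \<le> n"
  then obtain \<mu>' where \<mu>': "real_distribution \<mu>'" and eq: "\<And>u. char \<mu> u = char \<mu>' u ^ n" using roots by blast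
  interpret \<mu>': real_distribution \<mu>' by fact
  interpret product_prob_space "\<lambda>_::nat. \<mu>'" "{..<n}" ..
  note m = \<mu>'.sum_components_measurable[of n]
  have "\<mu> = distr (\<Pi>\<^sub>M i\<in>{..<n}. \<mu>') borel (\<lambda>x. \<Sum>i<n. x i)"
    by (rule Levy_uniqueness[OF \<mu>])
      (auto intro!: prob_space.real_distribution_distr[OF _ m] prob_space_axioms simp: fun_eq_iff char_sum_PiM[OF \<mu>'] eq)
  with \<mu>' show "\<exists>\<mu>'. real_distribution \<mu>' \<and> \<mu> = distr (\<Pi>\<^sub>M i\<in>{..<n}. \<mu>') borel (\<lambda>x. \<Sum>i<n. x i)" by blast
qed

section \<open>The exponent of the integral and its triplet\<close>

context levy_triplet
begin

interpretation pair: pair_sigma_finite \<nu> lborel ..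

lemma integrable_levy_kernel_wbou:
  assumes lam: "0 < lam" and log: "(\<integral>\<^sup>+x\<in>{x. \<bar>x\<bar> > 1}. ennreal (ln \<bar>x\<bar>) \<partial>\<nu>) < \<infinity>"
  shows "integrable (\<nu> \<Otimes>\<^sub>M lborel) (\<lambda>(x, s). levy_kernel x (wbou_kernel lam t s))"
proof (rule integrableI_bounded)
  show m: "(\<lambda>(x, s). levy_kernel x (wbou_kernel lam t s)) \<in> borel_measurable (\<nu> \<Otimes>\<^sub>M lborel)"
    by (intro pair_measurable) measurable
  have "(\<integral>\<^sup>+p. ennreal (norm (case p of (x, s) \<Rightarrow> levy_kernel x (wbou_kernel lam t s))) \<partial>(\<nu> \<Otimes>\<^sub>M lborel))
      = (\<integral>\<^sup>+p. ennreal (case p of (x, s) \<Rightarrow> levy_kernel x (wbou_kernel lam t s)) \<partial>(\<nu> \<Otimes>\<^sub>M lborel))"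
    by (intro nn_integral_cong) (auto simp: levy_kernel_nonneg abs_of_nonneg)
  also have "\<dots> = (\<integral>\<^sup>+x. \<integral>\<^sup>+s. ennreal (levy_kernel x (wbou_kernel lam t s)) \<partial>lborel \<partial>\<nu>)"
    using m by (subst lborel.nn_integral_fst[symmetric]) auto
  also have "\<dots> \<le> (\<integral>\<^sup>+x. ennreal (2 / lam) * ennreal (min 1 (x^2)) +
      ennreal (4 / lam) * (ennreal (ln \<bar>x\<bar>) * indicator {x. \<bar>x\<bar> > 1} x) \<partial>\<nu>)"
    by (intro nn_integral_mono nn_integral_levy_kernel_wbou lam)
  also have "\<dots> = ennreal (2 / lam) * (\<integral>\<^sup>+x. ennreal (min 1 (x^2)) \<partial>\<nu>) +
      ennreal (4 / lam) * (\<integral>\<^sup>+x\<in>{x. \<bar>x\<bar> > 1}. ennreal (ln \<bar>x\<bar>) \<partial>\<nu>)"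
    by (subst nn_integral_add) (auto simp: nn_integral_cmult)
  also have "\<dots> < \<infinity>" using log levy by (auto simp: levy_measure_def ennreal_mult_less_top)
  finally show "(\<integral>\<^sup>+p. ennreal (norm (case p of (x, s) \<Rightarrow> levy_kernel x (wbou_kernel lam t s))) \<partial>(\<nu> \<Otimes>\<^sub>M lborel)) < \<infinity>" .
qed

lemma integrable_control_wbou:
  assumes lam: "0 < lam" and log: "(\<integral>\<^sup>+x\<in>{x. \<bar>x\<bar> > 1}. ennreal (ln \<bar>x\<bar>) \<partial>\<nu>) < \<infinity>"
  shows "integrable lborel (\<lambda>s. control (wbou_kernel lam t s))"
proof -
  have "integrable lborel (\<lambda>s. \<integral>x. levy_kernel x (wbou_kernel lam t s) \<partial>\<nu>)"
    using integrable_levy_kernel_wbou[OF assms] by (rule pair.integrable_snd)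
  then show ?thesis
    using integral_wbou_kernel[OF lam, of t] unfolding control_def
    by (intro Bochner_Integration.integrable_add integrable_mult_right)
      (auto simp: has_bochner_integral_iff wbou_kernel_simps less_imp_le abs_of_pos)
qed

lemma levy_measure_wbou:
  assumes lam: "0 < lam" and log: "(\<integral>\<^sup>+x\<in>{x. \<bar>x\<bar> > 1}. ennreal (ln \<bar>x\<bar>) \<partial>\<nu>) < \<infinity>"
  shows "levy_measure (wbou_levy_measure lam \<nu> t)"
  unfolding levy_measure_def
proof (intro conjI)
  show "sets (wbou_levy_measure lam \<nu> t) = sets borel" by (simp add: wbou_levy_measure_eq)
  have m: "(\<lambda>(x, s). x * wbou_kernel lam t s) \<in> borel_measurable (\<nu> \<Otimes>\<^sub>M lborel)"
    by (intro pair_measurable) measurable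
  have "AE y in wbou_levy_measure lam \<nu> t. y \<noteq> 0"
    unfolding wbou_levy_measure_eq
    by (subst AE_distr_iff[OF m]) (use AE_pair_nonzero in \<open>auto simp: wbou_kernel_simps split_beta\<close>)
  then show "emeasure (wbou_levy_measure lam \<nu> t) {0} = 0"
    by (subst (asm) AE_iff_measurable[of "{0}"]) (auto simp: wbou_levy_measure_eq)
  have "(\<integral>\<^sup>+y. ennreal (min 1 (y^2)) \<partial>wbou_levy_measure lam \<nu> t)
      = (\<integral>\<^sup>+x. \<integral>\<^sup>+s. ennreal (min 1 ((x * wbou_kernel lam t s)^2)) \<partial>lborel \<partial>\<nu>)"
    by (subst nn_integral_wbou_levy_measure) auto
  also have "\<dots> \<le> (\<integral>\<^sup>+x. \<integral>\<^sup>+s. ennreal (levy_kernel x (wbou_kernel lam t s)) \<partial>lborel \<partial>\<nu>)"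
    using wbou_kernel_simps lam
    by (intro nn_integral_mono ennreal_leI min_le_levy_kernel) (auto simp: abs_of_pos)
  also have "\<dots> = (\<integral>\<^sup>+p. ennreal (norm (case p of (x, s) \<Rightarrow> levy_kernel x (wbou_kernel lam t s))) \<partial>(\<nu> \<Otimes>\<^sub>M lborel))"
    using integrable_levy_kernel_wbou[OF assms, of t, THEN borel_measurable_integrable]
    by (subst lborel.nn_integral_fst[symmetric]) (auto simp: levy_kernel_nonneg abs_of_nonneg)
  also have "\<dots> < \<infinity>" using integrable_levy_kernel_wbou[OF assms, of t] by (simp add: integrable_iff_bounded)
  finally show "(\<integral>\<^sup>+y. ennreal (min 1 (y^2)) \<partial>wbou_levy_measure lam \<nu> t) < \<infinity>" .
qed

lemma integral_sign_tail:
  "integrable \<nu> (\<lambda>x. indicator {1<..} x - indicator {..<-1} x :: real)"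
  "(\<integral>x. indicator {1<..} x - indicator {..<-1} x \<partial>\<nu>) = measure \<nu> {1<..} - measure \<nu> {..<-1}"
proof -
  have ind: "integrable \<nu> (indicator S :: real \<Rightarrow> real)" if S: "S \<in> sets borel" "\<And>x. x \<in> S \<Longrightarrow> 1 < \<bar>x\<bar>" for S
  proof (rule Bochner_Integration.integrable_bound[OF integrable_min])
    show "AE x in \<nu>. norm (indicator S x :: real) \<le> norm (min 1 (x^2))"
    proof (intro AE_I2)
      fix x show "norm (indicator S x :: real) \<le> norm (min 1 (x^2))"
      proof (cases "x \<in> S")
        case True
        then have "1 \<le> x^2" using S(2)[OF True] abs_le_square_iff[of 1 x] by simp
        then show ?thesis by (simp add: indicator_def)
      qed simp
    qed
  qed (use S in simp)
  have "integrable \<nu> (indicator {1<..} :: real \<Rightarrow> real)" "integrable \<nu> (indicator {..<-1} :: real \<Rightarrow> real)"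
    by (rule ind; auto)+
  then show "integrable \<nu> (\<lambda>x. indicator {1<..} x - indicator {..<-1} x :: real)"
    "(\<integral>x. indicator {1<..} x - indicator {..<-1} x \<partial>\<nu>) = measure \<nu> {1<..} - measure \<nu> {..<-1}"
    using sets_eq_imp_space_eq[OF sets_nu] by auto
qed

text \<open>
  Since the kernel is at most \<open>1\<close>, replacing the truncation \<open>\<bar>x\<bar> \<le> 1\<close> by \<open>\<bar>x * f s\<bar> \<le> 1\<close> only affects
  the pairs with \<open>\<bar>x\<bar> > 1\<close> and \<open>\<bar>x * f s\<bar> \<le> 1\<close>; their contribution is the correction of the drift.
\<close>

lemma integral_psi_wbou:
  assumes lam: "0 < lam" and log: "(\<integral>\<^sup>+x\<in>{x. \<bar>x\<bar> > 1}. ennreal (ln \<bar>x\<bar>) \<partial>\<nu>) < \<infinity>"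
  shows "(CLINT s|lborel. \<psi> (u * wbou_kernel lam t s)) =
    levy_exponent (wbou_drift lam a \<nu>) (b / lam) (wbou_levy_measure lam \<nu> t) u"
proof -
  let ?f = "wbou_kernel lam t"
  let ?P = "\<nu> \<Otimes>\<^sub>M lborel"
  let ?m = "measure \<nu> {1<..} - measure \<nu> {..<-1}"
  \<comment> \<open>\<open>J\<close> truncates at \<open>|x| \<le> 1\<close>, as in the exponent of
    \<open>L\<close>; \<open>K\<close> truncates at the scaled jump, as in the exponent of the image
    measure. \<open>D\<close> is the discrepancy without the factor \<open>\<i> * u\<close>.\<close>
  define J where "J x s = levy_integrand (u * ?f s) x" for x s
  define K where "K x s = levy_integrand u (x * ?f s)" for x s
  define D where "D x s = indicator {x. 1 < \<bar>x\<bar>} x * x * (?f s * indicator {s. \<bar>x\<bar> * ?f s \<le> 1} s)" for x s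
  have f: "0 < ?f s" "?f s \<le> 1" for s using wbou_kernel_simps lam by auto
  have kint: "integrable ?P (\<lambda>(x, s). c * levy_kernel x (?f s))" for c
    using integrable_mult_right[OF integrable_levy_kernel_wbou[OF assms, of t], of c] by (simp add: split_beta')
  have intJ: "complex_integrable ?P (\<lambda>(x, s). J x s)"
  proof (rule Bochner_Integration.integrable_bound[OF kint[of "1 + u^2"]])
    show "(\<lambda>(x, s). J x s) \<in> borel_measurable ?P" unfolding J_def by (intro pair_measurable) measurable
    show "AE p in ?P. norm (case p of (x, s) \<Rightarrow> J x s) \<le> norm (case p of (x, s) \<Rightarrow> (1 + u^2) * levy_kernel x (?f s))"
      using order_trans[OF norm_levy_integrand_le levy_kernel_scale]
      by (intro AE_I2) (auto simp: J_def levy_kernel_nonneg abs_mult abs_of_nonneg)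
  qed
  have intK: "complex_integrable ?P (\<lambda>(x, s). K x s)"
  proof (rule Bochner_Integration.integrable_bound[OF kint[of "2 + u^2"]])
    show "(\<lambda>(x, s). K x s) \<in> borel_measurable ?P" unfolding K_def by (intro pair_measurable) measurable
    have "norm (K x s) \<le> (2 + u^2) * levy_kernel x (?f s)" for x s
    proof -
      have "norm (K x s) \<le> levy_kernel (x * ?f s) u" unfolding K_def by (rule norm_levy_integrand_le)
      also have "\<dots> \<le> (2 + u^2) * min 1 ((x * ?f s)^2)" by (rule levy_kernel_le_min)
      also have "\<dots> \<le> (2 + u^2) * levy_kernel x (?f s)"
        using f[of s] by (intro mult_left_mono min_le_levy_kernel) auto
      finally show ?thesis .
    qed
    then show "AE p in ?P. norm (case p of (x, s) \<Rightarrow> K x s) \<le> norm (case p of (x, s) \<Rightarrow> (2 + u^2) * levy_kernel x (?f s))"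
      by (intro AE_I2) (auto simp: levy_kernel_nonneg abs_mult abs_of_nonneg)
  qed
  have JK: "J x s - K x s = \<i> * of_real (u * D x s)" for x s
  proof -
    have "\<bar>x\<bar> * ?f s \<le> \<bar>x\<bar> * 1" using f by (intro mult_left_mono) auto
    then have le: "\<bar>x * ?f s\<bar> \<le> \<bar>x\<bar>" "\<bar>x * ?f s\<bar> = \<bar>x\<bar> * ?f s"
      using f(1)[of s] by (auto simp: abs_mult)
    have i: "indicator {-1..1} z = (if \<bar>z\<bar> \<le> 1 then 1 else 0 :: real)" for z :: real
      by (auto simp: indicator_def abs_le_iff)
    have "D x s = x * ?f s * (indicator {-1..1} (x * ?f s) - indicator {-1..1} x)"
      unfolding i D_def using le by (auto simp: indicator_def)
    then show ?thesis
      unfolding J_def K_def levy_integrand_truncation by (rule arg_cong[where f="\<lambda>z. \<i> * of_real (u * z)", OF sym])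
  qed
  have intD: "integrable ?P (\<lambda>(x, s). J x s - K x s)"
    using Bochner_Integration.integrable_diff[OF intJ intK] by (simp only: split_beta')
  \<comment> \<open>For \<open>|x| > 1\<close> the integral of \<open>D x\<close> is
    \<open>x * (2 / (lam * |x|))\<close>, that is \<open>2 / lam\<close> times the sign of
    \<open>x\<close>.\<close>
  have inner: "(CLINT s|lborel. J x s - K x s) = \<i> * of_real (u * (2 / lam) * (indicator {1<..} x - indicator {..<-1} x))" for x
  proof (cases "1 < \<bar>x\<bar>")
    case True
    have "has_bochner_integral lborel (\<lambda>s. ?f s * indicator {s. \<bar>x\<bar> * ?f s \<le> 1} s) (2 / (lam * \<bar>x\<bar>))"
    proof (rule has_bochner_integral_nn_integral)
      show "(\<integral>\<^sup>+s. ennreal (?f s * indicator {s. \<bar>x\<bar> * ?f s \<le> 1} s) \<partial>lborel) = ennreal (2 / (lam * \<bar>x\<bar>))"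
        using nn_integral_wbou_kernel_tail[OF lam, of "\<bar>x\<bar>" t] True f
        by (simp add: ennreal_mult less_imp_le ennreal_indicator)
    qed (use f lam True in \<open>auto simp: less_imp_le\<close>)
    then have "(\<integral>s. D x s \<partial>lborel) = x * (2 / (lam * \<bar>x\<bar>))"
      using True by (simp add: D_def has_bochner_integral_iff)
    also have "\<dots> = 2 / lam * (indicator {1<..} x - indicator {..<-1} x)"
      using True by (auto simp: indicator_def abs_if)
    finally show ?thesis unfolding JK by (simp add: mult.assoc flip: of_real_mult)
  next
    case False
    then show ?thesis unfolding JK by (auto simp: D_def indicator_def)
  qed
  have "(CLINT p|?P. case p of (x, s) \<Rightarrow> J x s - K x s) = (CLINT x|\<nu>. CLINT s|lborel. J x s - K x s)"
    by (rule pair.integral_fst[OF intD, symmetric])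
  also have "\<dots> = (CLINT x|\<nu>. \<i> * of_real (u * (2 / lam) * (indicator {1<..} x - indicator {..<-1} x)))"
    by (simp only: inner)
  also have "\<dots> = \<i> * of_real (u * (2 / lam) * ?m)"
    using integral_sign_tail by (simp only: integral_mult_right_zero integral_complex_of_real)
  finally have D: "(CLINT p|?P. case p of (x, s) \<Rightarrow> J x s - K x s) = \<i> * of_real (u * (2 / lam) * ?m)" .
  have "(CLINT p|?P. case p of (x, s) \<Rightarrow> J x s) = (CLINT p|?P. case p of (x, s) \<Rightarrow> K x s) + \<i> * of_real (u * (2 / lam) * ?m)"
    using Bochner_Integration.integral_diff[OF intJ intK] unfolding D[symmetric] by (simp add: split_beta')
  also have "(CLINT p|?P. case p of (x, s) \<Rightarrow> K x s) = (CLINT y|wbou_levy_measure lam \<nu> t. levy_integrand u y)"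
  proof -
    have m: "(\<lambda>(x, s). x * ?f s) \<in> borel_measurable ?P" by (intro pair_measurable) measurable
    show ?thesis unfolding wbou_levy_measure_eq K_def
      by (subst integral_distr[OF m]) (auto simp: split_beta')
  qed
  finally have J: "(CLINT p|?P. case p of (x, s) \<Rightarrow> J x s) =
      (CLINT y|wbou_levy_measure lam \<nu> t. levy_integrand u y) + \<i> * of_real (u * (2 / lam) * ?m)" .
  note ints = integral_wbou_kernel[OF lam, of t, unfolded has_bochner_integral_iff]
  have intJ': "complex_integrable lborel (\<lambda>s. CLINT x|\<nu>. J x s)"
    using intJ by (rule pair.integrable_snd)
  have "(CLINT s|lborel. \<psi> (u * ?f s)) =
      (CLINT s|lborel. \<i> * of_real (u * a) * of_real (?f s) - of_real (b * u^2 / 2) * of_real ((?f s)^2) + (CLINT x|\<nu>. J x s))"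
    by (intro Bochner_Integration.integral_cong refl) (simp add: levy_exponent_eq J_def power_mult_distrib mult_ac)
  also have "\<dots> = \<i> * of_real (u * a) * of_real (2 / lam) - of_real (b * u^2 / 2) * of_real (1 / lam) + (CLINT s|lborel. CLINT x|\<nu>. J x s)"
    using ints intJ' by (simp del: of_real_mult of_real_divide of_real_power)
  also have "(CLINT s|lborel. CLINT x|\<nu>. J x s) = (CLINT p|?P. case p of (x, s) \<Rightarrow> J x s)"
    by (rule pair.integral_snd[OF intJ])
  also have "\<i> * of_real (u * a) * of_real (2 / lam) - of_real (b * u^2 / 2) * of_real (1 / lam) + (CLINT p|?P. case p of (x, s) \<Rightarrow> J x s)
      = levy_exponent (wbou_drift lam a \<nu>) (b / lam) (wbou_levy_measure lam \<nu> t) u"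
    unfolding J levy_exponent_eq wbou_drift_def by (simp add: algebra_simps)
  finally show ?thesis .
qed

lemma integral_psi_wbou_scale:
  assumes "1 \<le> n"
  shows "(CLINT s|lborel. \<psi> (u * wbou_kernel lam t s)) = of_nat n * (CLINT s|lborel. \<psi> (u * wbou_kernel (real n * lam) t s))"
proof -
  \<comment> \<open>The substitution is the dilation by \<open>n\<close> with centre
    \<open>t\<close>, which multiplies \<open>|t - s|\<close> by \<open>n\<close>.\<close>
  have "(CLINT s|lborel. \<psi> (u * wbou_kernel lam t s)) = \<bar>real n\<bar> *\<^sub>R (CLINT s|lborel. \<psi> (u * wbou_kernel lam t (t - real n * t + real n * s)))"
    using assms by (intro lborel_integral_real_affine) simp
  moreover have "wbou_kernel lam t (t - real n * t + real n * s) = wbou_kernel (real n * lam) t s" for s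
  proof -
    have "t - (t - real n * t + real n * s) = real n * (t - s)" by (simp add: algebra_simps)
    then show ?thesis by (simp add: wbou_kernel_def abs_mult mult_ac)
  qed
  ultimately show ?thesis by (simp add: scaleR_conv_of_real)
qed

end

context levy_random_measure
begin

lemma wbou_sufficient:
  assumes lam: "0 < lam" and log: "(\<integral>\<^sup>+x\<in>{x. \<bar>x\<bar> > 1}. ennreal (ln \<bar>x\<bar>) \<partial>\<nu>) < \<infinity>"
  shows "rm_integrable M \<Lambda> (wbou_kernel lam t)"
    and "has_rm_integral M \<Lambda> (wbou_kernel lam t) X \<Longrightarrow> infinitely_divisible (distr M borel X)"
    and "has_rm_integral M \<Lambda> (wbou_kernel lam t) X \<Longrightarrow>
      has_char_triplet (distr M borel X) (wbou_drift lam a \<nu>) (b / lam) (wbou_levy_measure lam \<nu> t)"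
proof -
  \<comment> \<open>The rate \<open>l\<close> is kept general: \<open>lam\<close> gives
    integrability, and \<open>n * lam\<close> supplies the n-th root of the law.\<close>
  have exists: "\<exists>g X. approximating_steps M \<Lambda> (wbou_kernel l t) g \<and> X \<in> borel_measurable M \<and>
      (\<forall>u. char (distr M borel X) u = exp (CLINT s|lborel. \<psi> (u * wbou_kernel l t s)))" if l: "0 < l" for l
  proof -
    obtain g X where "approximating_steps M \<Lambda> (wbou_kernel l t) g" "tendsto_in_prob M (\<lambda>n. step_integral \<Lambda> (g n) UNIV) X"
      "\<And>u. char (distr M borel X) u = exp (CLINT s|lborel. \<psi> (u * wbou_kernel l t s))"
      using integral_exists[OF wbou_kernel_measurable less_imp_le[OF wbou_kernel_simps(1)] integrable_control_wbou[OF l log]]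
      by blast
    then show ?thesis by (auto simp: tendsto_in_prob_def)
  qed
  show "rm_integrable M \<Lambda> (wbou_kernel lam t)" using exists[OF lam] by (auto simp: rm_integrable_def)
  assume X: "has_rm_integral M \<Lambda> (wbou_kernel lam t) X"
  have [measurable]: "X \<in> borel_measurable M" using X by (auto simp: has_rm_integral_def tendsto_in_prob_def)
  have char: "char (distr M borel X) u = exp (CLINT s|lborel. \<psi> (u * wbou_kernel lam t s))" for u
    by (rule has_rm_integral_char[OF wbou_kernel_measurable less_imp_le[OF wbou_kernel_simps(1)] integrable_control_wbou[OF lam log] X])
  show "has_char_triplet (distr M borel X) (wbou_drift lam a \<nu>) (b / lam) (wbou_levy_measure lam \<nu> t)"
    unfolding has_char_triplet_def char integral_psi_wbou[OF lam log]
    using levy_measure_wbou[OF lam log] b_nonneg lam by simp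
  show "infinitely_divisible (distr M borel X)"
  proof (rule infinitely_divisible_if_char_roots)
    show "real_distribution (distr M borel X)" by (rule real_distribution_distr) simp
    fix n :: nat assume n: "1 \<le> n"
    then have "0 < real n * lam" using lam by simp
    from exists[OF this] obtain X' where X': "X' \<in> borel_measurable M"
      and char': "\<And>u. char (distr M borel X') u = exp (CLINT s|lborel. \<psi> (u * wbou_kernel (real n * lam) t s))" by blast
    have "char (distr M borel X) u = char (distr M borel X') u ^ n" for u
      unfolding char char' by (subst integral_psi_wbou_scale[OF n]) (rule exp_of_nat_mult)
    with X' show "\<exists>\<mu>'. real_distribution \<mu>' \<and> (\<forall>u. char (distr M borel X) u = char \<mu>' u ^ n)"
      by (intro exI[of _ "distr M borel X'"]) (auto intro: real_distribution_distr)
  qed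
qed

end

section \<open>Necessity\<close>

text \<open>Beyond \<open>N\<close>, the events that \<open>c n\<close> or \<open>c N\<close> is
  further than 1 from \<open>Y\<close> have probability below 1/2 each. Some sample point avoids
  both, and there the constants differ by at most 2.\<close>

lemma tendsto_in_prob_const_bounded:
  assumes P: "prob_space M" and Z: "\<And>n. Z n \<in> borel_measurable M" and c: "\<And>n. AE \<omega> in M. Z n \<omega> = c n"
    and lim: "tendsto_in_prob M Z Y"
  shows "\<exists>K. \<forall>\<^sub>F n in sequentially. \<bar>c n :: real\<bar> \<le> K"
proof -
  interpret prob_space M by fact
  have [measurable]: "Y \<in> borel_measurable M" using lim by (simp add: tendsto_in_prob_def)
  have lim': "tendsto_in_prob M (\<lambda>n \<omega>. c n) Y"
    by (rule tendsto_in_prob_cong_AE[OF P Z _ c lim]) simp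
  let ?B = "\<lambda>n. {\<omega> \<in> space M. 1 < \<bar>c n - Y \<omega>\<bar>}"
  have "(\<lambda>n. measure M (?B n)) \<longlonglongrightarrow> 0" using lim' by (simp add: tendsto_in_prob_def)
  then have "\<forall>\<^sub>F n in sequentially. measure M (?B n) < 1 / 2" by (rule order_tendstoD) simp
  then obtain N where N: "\<And>n. N \<le> n \<Longrightarrow> measure M (?B n) < 1 / 2" by (auto simp: eventually_sequentially)
  have "\<bar>c n\<bar> \<le> \<bar>c N\<bar> + 2" if n: "N \<le> n" for n
  proof -
    have "measure M (?B n \<union> ?B N) \<le> measure M (?B n) + measure M (?B N)" by (intro measure_Un_le) auto
    also have "\<dots> < measure M (space M)" using N[OF n] N[of N] by (simp add: prob_space)
    finally have "?B n \<union> ?B N \<noteq> space M" by auto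
    then obtain \<omega> where "\<omega> \<in> space M" "\<omega> \<notin> ?B n" "\<omega> \<notin> ?B N" by blast
    then have "\<bar>c n - Y \<omega>\<bar> \<le> 1" "\<bar>c N - Y \<omega>\<bar> \<le> 1" by auto
    then show ?thesis by linarith
  qed
  then show ?thesis unfolding eventually_sequentially by blast
qed

lemma integrable_step_fun:
  assumes g: "bounded_steps g"
  shows "integrable lborel (step_fun g)" "integrable lborel (\<lambda>s. (step_fun g s)^2)"
proof -
  obtain K R where K: "0 \<le> K" "\<And>s. \<bar>step_fun g s\<bar> \<le> K * indicator {-R..R} s"
    using step_fun_bound[OF g] by blast
  have [measurable]: "step_fun g \<in> borel_measurable borel" by (rule step_fun_measurable[OF g])
  have int: "integrable lborel (\<lambda>s. c * indicator {-R..R} s)" for c :: real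
    by (intro integrable_mult_right integrable_real_indicator) (auto simp: emeasure_lborel_Icc_eq)
  show "integrable lborel (step_fun g)"
    by (rule Bochner_Integration.integrable_bound[OF int[of K]]) (use K in auto)
  have "norm ((step_fun g s)^2) \<le> norm (K^2 * indicator {-R..R} s)" for s
  proof -
    have "\<bar>step_fun g s\<bar>^2 \<le> (K * indicator {-R..R} s)^2" using K(2) by (intro power_mono) auto
    also have "\<dots> = K^2 * indicator {-R..R} s" by (cases "s \<in> {-R..R}") simp_all
    finally show ?thesis by simp
  qed
  then show "integrable lborel (\<lambda>s. (step_fun g s)^2)"
    by (intro Bochner_Integration.integrable_bound[OF int[of "K^2"]]) auto
qed

text \<open>
  If the integrals of \<open>g n\<close> over every Borel set stay bounded, then so does the measure of each of the
  sets \<open>A\<close> and \<open>-A\<close> given by the gliding hump, because along a subsequence \<open>g n\<close> is close in mean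
  to \<open>f \<ge> 1\<close> on \<open>A \<inter> {-n..n}\<close>.
\<close>

lemma unbounded_integral_on_some_set:
  fixes f :: "real \<Rightarrow> real"
  assumes g: "\<And>n. integrable lborel (g n)" and lim: "AE s in lborel. (\<lambda>n. g n s) \<longlonglongrightarrow> f s"
    and f: "\<And>s. 1 \<le> f s" and f_int: "\<And>n::nat. integrable lborel (\<lambda>s. indicator {-real n..real n} s * f s)"
    and bounded: "\<And>A. A \<in> sets borel \<Longrightarrow> \<exists>K. \<forall>\<^sub>F n in sequentially. \<bar>LINT s:A|lborel. g n s\<bar> \<le> K"
  shows False
proof -
  \<comment> \<open>As \<open>f \<ge> 1\<close>, it is not integrable over the line. Cutting it to a
    growing window restores integrability, and the difference to \<open>g n\<close> still tends to 0
    pointwise.\<close>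
  let ?f = "\<lambda>n s. indicator {-real n..real n} s * f s"
  let ?q = "\<lambda>n s. \<bar>g n s - ?f n s\<bar>"
  have q_int: "integrable lborel (?q n)" for n
    by (intro integrable_abs Bochner_Integration.integrable_diff g f_int)
  have q0: "AE s in lborel. (\<lambda>n. ?q n s) \<longlonglongrightarrow> 0"
    using lim
  proof eventually_elim
    fix s assume s: "(\<lambda>n. g n s) \<longlonglongrightarrow> f s"
    obtain N where N: "\<bar>s\<bar> \<le> real N" using real_arch_simple by blast
    have "\<forall>\<^sub>F n in sequentially. \<bar>g n s - f s\<bar> = ?q n s"
      unfolding eventually_sequentially
    proof (intro exI allI impI)
      fix n assume "N \<le> n"
      then have "- real n \<le> s" "s \<le> real n" using N by linarith+
      then show "\<bar>g n s - f s\<bar> = ?q n s" by simp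
    qed
    moreover have "(\<lambda>n. \<bar>g n s - f s\<bar>) \<longlonglongrightarrow> 0"
      using tendsto_rabs_zero[OF LIM_zero[OF s]] .
    ultimately show "(\<lambda>n. ?q n s) \<longlonglongrightarrow> 0" by (rule Lim_transform_eventually[rotated])
  qed
  obtain A r r' where A: "A \<in> sets borel" and r: "strict_mono r" "strict_mono r'"
    and small: "(\<lambda>i. LINT s:A|lborel. ?q (r i) s) \<longlonglongrightarrow> 0" "(\<lambda>i. LINT s:-A|lborel. ?q (r' i) s) \<longlonglongrightarrow> 0"
    by (rule split_null_sequence[of ?q, OF q_int abs_ge_zero q0])
  have finite: "emeasure lborel B < \<infinity>"
    if B [measurable]: "B \<in> sets borel" and r: "strict_mono r" and small: "(\<lambda>i. LINT s:B|lborel. ?q (r i) s) \<longlonglongrightarrow> 0" for B r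
  proof -
    have set_int: "integrable lborel (\<lambda>s. indicator B s * h s)" if "integrable lborel h" for h :: "real \<Rightarrow> real"
      using integrable_mult_indicator[OF _ that, of B] by simp
    obtain K where "\<forall>\<^sub>F n in sequentially. \<bar>LINT s:B|lborel. g n s\<bar> \<le> K" using bounded[OF B] by blast
    then have "\<forall>\<^sub>F i in sequentially. \<bar>LINT s:B|lborel. g (r i) s\<bar> \<le> K"
      by (rule eventually_subseq[OF r])
    moreover have "\<forall>\<^sub>F i in sequentially. (LINT s:B|lborel. ?q (r i) s) < 1"
      using small by (rule order_tendstoD) simp
    \<comment> \<open>Since \<open>f \<ge> 1\<close>, the measure is at most the integral of
      \<open>f\<close> over the window part of \<open>B\<close>. This is bounded by \<open>K\<close>
      for \<open>g (r i)\<close> plus 1 for the error.\<close>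
    ultimately have "\<forall>\<^sub>F i in sequentially. measure lborel (B \<inter> {-real (r i)..real (r i)}) \<le> K + 1"
    proof eventually_elim
      fix i assume 1: "\<bar>LINT s:B|lborel. g (r i) s\<bar> \<le> K" and 2: "(LINT s:B|lborel. ?q (r i) s) < 1"
      let ?I = "{-real (r i)..real (r i)}"
      have fin: "emeasure lborel (B \<inter> ?I) < \<infinity>"
        by (rule le_less_trans[OF emeasure_mono[of _ ?I]]) (auto simp: emeasure_lborel_Icc_eq)
      have "measure lborel (B \<inter> ?I) = (\<integral>s. indicator (B \<inter> ?I) s \<partial>lborel)" by simp
      also have "\<dots> \<le> (\<integral>s. indicator B s * ?f (r i) s \<partial>lborel)"
        using fin f by (intro integral_mono set_int f_int integrable_real_indicator) (auto simp: indicator_def)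
      also have "\<dots> \<le> (\<integral>s. indicator B s * g (r i) s + indicator B s * ?q (r i) s \<partial>lborel)"
      proof (intro integral_mono set_int f_int Bochner_Integration.integrable_add g q_int)
        fix s
        have "?f (r i) s \<le> g (r i) s + ?q (r i) s" by linarith
        then show "indicator B s * ?f (r i) s \<le> indicator B s * g (r i) s + indicator B s * ?q (r i) s"
          unfolding distrib_left[symmetric] by (intro mult_left_mono) auto
      qed
      also have "\<dots> = (LINT s:B|lborel. g (r i) s) + (LINT s:B|lborel. ?q (r i) s)"
        by (simp only: Bochner_Integration.integral_add[OF set_int[OF g] set_int[OF q_int]] set_lebesgue_integral_def real_scaleR_def)
      finally show "measure lborel (B \<inter> ?I) \<le> K + 1" using 1 2 by linarith
    qed
    then obtain N where N: "\<And>i. N \<le> i \<Longrightarrow> measure lborel (B \<inter> {-real (r i)..real (r i)}) \<le> K + 1"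
      by (auto simp: eventually_sequentially)
    have "emeasure lborel (B \<inter> {-real n..real n}) \<le> ennreal (K + 1)" for n :: nat
    proof -
      let ?i = "max n N"
      have n: "n \<le> r ?i" using seq_suble[OF r, of ?i] by linarith
      have "emeasure lborel (B \<inter> {-real n..real n}) \<le> emeasure lborel (B \<inter> {-real (r ?i)..real (r ?i)})"
        using n by (intro emeasure_mono) auto
      also have "\<dots> = ennreal (measure lborel (B \<inter> {-real (r ?i)..real (r ?i)}))"
      proof (rule emeasure_eq_ennreal_measure)
        have "emeasure lborel (B \<inter> {-real (r ?i)..real (r ?i)}) \<le> emeasure lborel {-real (r ?i)..real (r ?i)}"
          by (intro emeasure_mono) auto
        then show "emeasure lborel (B \<inter> {-real (r ?i)..real (r ?i)}) \<noteq> \<top>"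
          by (auto simp: emeasure_lborel_Icc_eq top_unique)
      qed
      also have "\<dots> \<le> ennreal (K + 1)" by (intro ennreal_leI N) simp
      finally show ?thesis .
    qed
    moreover have "(\<Union>n::nat. B \<inter> {-real n..real n}) = B"
    proof -
      have "\<exists>n::nat. s \<in> {-real n..real n}" for s
      proof -
        obtain n where "\<bar>s\<bar> \<le> real n" using real_arch_simple by blast
        then have "- real n \<le> s" "s \<le> real n" by linarith+
        then show ?thesis by auto
      qed
      then show ?thesis by blast
    qed
    moreover have "(SUP n. emeasure lborel (B \<inter> {-real n..real n})) = emeasure lborel (\<Union>n::nat. B \<inter> {-real n..real n})"
      by (rule SUP_emeasure_incseq) (auto simp: incseq_def)
    ultimately have "emeasure lborel B \<le> ennreal (K + 1)"
      using SUP_least[of UNIV "\<lambda>n::nat. emeasure lborel (B \<inter> {-real n..real n})" "ennreal (K + 1)"] by simp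
    also have "\<dots> < \<infinity>" by simp
    finally show ?thesis .
  qed
  have "emeasure lborel (UNIV :: real set) \<le> emeasure lborel A + emeasure lborel (- A)"
    using emeasure_subadditive[of A lborel "- A"] A by simp
  also have "\<dots> < \<infinity>" using finite[OF A r(1) small(1)] finite[OF _ r(2) small(2)] A by simp
  finally show False by simp
qed

lemma (in levy_triplet) psi_null:
  assumes "emeasure \<nu> UNIV = 0"
  shows "\<psi> u = \<i> * of_real (u * a) - of_real (b * u^2 / 2)"
proof -
  have "AE x in \<nu>. False"
    using assms sets_eq_imp_space_eq[OF sets_nu] by (intro AE_I[of _ _ UNIV]) auto
  then have "(CLINT x|\<nu>. levy_integrand u x) = (CLINT x|\<nu>. 0)"
    by (intro integral_cong_AE) (auto elim: eventually_mono)
  then show ?thesis by (simp add: levy_exponent_eq)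
qed

context levy_random_measure
begin

text \<open>The drift only rotates the characteristic function, so its modulus at 1 is
  \<open>exp\<close> of \<open>- b / 2\<close> times the squared L2 norm of the step function. A
  nonzero limit keeps these norms bounded, whereas \<open>f \<ge> 1\<close> has infinite L2
  norm.\<close>

lemma no_gaussian_integral:
  assumes null: "emeasure \<nu> UNIV = 0" and b: "0 < b" and f: "\<And>s. 1 \<le> f s"
    and g: "approximating_steps M \<Lambda> f g" and X: "tendsto_in_prob M (\<lambda>n. step_integral \<Lambda> (g n) UNIV) X"
    and nonzero: "char (distr M borel X) 1 \<noteq> 0"
  shows False
proof -
  have gb: "bounded_steps (g n)" for n using g by (auto simp: approximating_steps_def is_step_bounded)
  have [measurable]: "step_fun (g n) \<in> borel_measurable borel" for n by (rule step_fun_measurable[OF gb])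
  define I where "I n = (\<integral>s. (step_fun (g n) s)^2 \<partial>lborel)" for n
  define p where "p = norm (char (distr M borel X) 1)"
  have p: "0 < p" using nonzero by (simp add: p_def)
  have norm_char: "norm (char (distr M borel (step_integral \<Lambda> (g n) UNIV)) 1) = exp (- (b / 2) * I n)" for n
  proof -
    have "(CLINT s|lborel. \<psi> (1 * (indicator UNIV s * step_fun (g n) s))) =
        (CLINT s|lborel. \<i> * of_real a * of_real (step_fun (g n) s) - of_real (b / 2) * of_real ((step_fun (g n) s)^2))"
      by (intro Bochner_Integration.integral_cong refl) (simp add: psi_null[OF null])
    also have "\<dots> = \<i> * of_real a * of_real (\<integral>s. step_fun (g n) s \<partial>lborel) - of_real (b / 2) * of_real (I n)"
      using integrable_step_fun[OF gb, of n] unfolding I_def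
      by (simp del: of_real_power of_real_divide)
    finally show ?thesis by (simp add: char_step_integral gb)
  qed
  have "(\<lambda>n. norm (char (distr M borel (step_integral \<Lambda> (g n) UNIV)) 1)) \<longlonglongrightarrow> p"
    unfolding p_def
    by (intro tendsto_norm char_tendsto_in_prob[OF prob_space_axioms _ X] step_integral_measurable gb) simp
  then have "\<forall>\<^sub>F n in sequentially. p / 2 < exp (- (b / 2) * I n)"
    unfolding norm_char using p by (intro order_tendstoD) auto
  then have "\<forall>\<^sub>F n in sequentially. I n \<le> - 2 / b * ln (p / 2)"
  proof eventually_elim
    fix n assume "p / 2 < exp (- (b / 2) * I n)"
    then have "ln (p / 2) < ln (exp (- (b / 2) * I n))" using p by (subst ln_less_cancel_iff) auto
    then have "ln (p / 2) < - (b / 2) * I n" by (simp only: ln_exp)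
    then show "I n \<le> - 2 / b * ln (p / 2)" using b by (simp add: field_simps)
  qed
  then have bound: "\<forall>\<^sub>F n in sequentially. (\<integral>\<^sup>+s. ennreal ((step_fun (g n) s)^2) \<partial>lborel) \<le> ennreal (- 2 / b * ln (p / 2))"
  proof eventually_elim
    fix n assume "I n \<le> - 2 / b * ln (p / 2)"
    moreover have "(\<integral>\<^sup>+s. ennreal ((step_fun (g n) s)^2) \<partial>lborel) = ennreal (I n)"
      unfolding I_def by (intro nn_integral_eq_integral integrable_step_fun gb) auto
    ultimately show "(\<integral>\<^sup>+s. ennreal ((step_fun (g n) s)^2) \<partial>lborel) \<le> ennreal (- 2 / b * ln (p / 2))"
      by (simp only: ennreal_leI)
  qed
  have "(\<infinity>::ennreal) = (\<integral>\<^sup>+s. 1 \<partial>(lborel :: real measure))" by simp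
  also have "\<dots> \<le> (\<integral>\<^sup>+s. liminf (\<lambda>n. ennreal ((step_fun (g n) s)^2)) \<partial>lborel)"
  proof (rule nn_integral_mono_AE)
    have "AE s in lborel. (\<lambda>n. step_fun (g n) s) \<longlonglongrightarrow> f s" using g by (simp add: approximating_steps_def)
    then show "AE s in lborel. 1 \<le> liminf (\<lambda>n. ennreal ((step_fun (g n) s)^2))"
    proof eventually_elim
      fix s assume "(\<lambda>n. step_fun (g n) s) \<longlonglongrightarrow> f s"
      then have "(\<lambda>n. ennreal ((step_fun (g n) s)^2)) \<longlonglongrightarrow> ennreal ((f s)^2)"
        by (intro tendsto_ennrealI tendsto_power)
      then have "liminf (\<lambda>n. ennreal ((step_fun (g n) s)^2)) = ennreal ((f s)^2)"
        by (intro lim_imp_Liminf) simp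
      moreover have "1 \<le> (f s)^2" using f by (simp add: one_le_power)
      ultimately show "1 \<le> liminf (\<lambda>n. ennreal ((step_fun (g n) s)^2))" by simp
    qed
  qed
  also have "\<dots> \<le> liminf (\<lambda>n. \<integral>\<^sup>+s. ennreal ((step_fun (g n) s)^2) \<partial>lborel)"
    by (rule nn_integral_liminf) simp
  also have "\<dots> \<le> liminf (\<lambda>n. ennreal (- 2 / b * ln (p / 2)))" by (rule Liminf_mono[OF bound])
  also have "\<dots> = ennreal (- 2 / b * ln (p / 2))" by (rule Liminf_const) simp
  finally show False by (simp add: top_unique)
qed

text \<open>Integrals are now constants and all characteristic functions have modulus 1, so the
  previous argument gives nothing. Convergence over the whole line is not contradictory: steps equal
  to 1 on \<open>{-n..n}\<close> and -1 on \<open>{n<..3*n}\<close> tend to 1 pointwise, yet have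
  integral 0. Other sets \<open>A\<close> must be brought in.\<close>

lemma no_drift_integral:
  assumes null: "emeasure \<nu> UNIV = 0" and b: "b = 0" and a: "a \<noteq> 0" and f: "\<And>s. 1 \<le> f s"
    and f_int: "\<And>n::nat. integrable lborel (\<lambda>s. indicator {-real n..real n} s * f s)"
    and g: "approximating_steps M \<Lambda> f g"
  shows False
proof (rule unbounded_integral_on_some_set[where f=f and g="\<lambda>n. step_fun (g n)"])
  have gb: "bounded_steps (g n)" for n using g by (auto simp: approximating_steps_def is_step_bounded)
  show "integrable lborel (step_fun (g n))" for n by (rule integrable_step_fun[OF gb])
  show "AE s in lborel. (\<lambda>n. step_fun (g n) s) \<longlonglongrightarrow> f s" using g by (simp add: approximating_steps_def)
  fix A :: "real set" assume A: "A \<in> sets borel"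
  let ?c = "\<lambda>n. LINT s:A|lborel. step_fun (g n) s"
  have psi0: "\<psi> v = \<i> * of_real (v * a)" for v using psi_null[OF null, of v] b by simp
  have "AE \<omega> in M. step_integral \<Lambda> (g n) A \<omega> = a * ?c n" for n
  proof (rule AE_eq_const_if_char[OF prob_space_axioms])
    show "step_integral \<Lambda> (g n) A \<in> borel_measurable M" by (rule step_integral_measurable[OF gb A])
    fix u
    have "(CLINT s|lborel. \<psi> (u * (indicator A s * step_fun (g n) s))) =
        (CLINT s|lborel. \<i> * of_real (u * a) * of_real (indicator A s * step_fun (g n) s))"
      by (simp add: psi0)
    also have "\<dots> = \<i> * of_real (u * a) * (CLINT s|lborel. of_real (indicator A s * step_fun (g n) s))"
      by (rule integral_mult_right_zero)
    also have "(CLINT s|lborel. of_real (indicator A s * step_fun (g n) s)) = of_real (?c n)"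
      by (simp add: set_lebesgue_integral_def flip: integral_complex_of_real del: of_real_mult)
    finally show "char (distr M borel (step_integral \<Lambda> (g n) A)) u = iexp (u * (a * ?c n))"
      by (simp add: char_step_integral gb A mult.assoc)
  qed
  moreover obtain Y where "tendsto_in_prob M (\<lambda>n. step_integral \<Lambda> (g n) A) Y"
    using g A by (auto simp: approximating_steps_def)
  ultimately have "\<exists>K. \<forall>\<^sub>F n in sequentially. \<bar>a * ?c n\<bar> \<le> K"
    by (rule tendsto_in_prob_const_bounded[OF prob_space_axioms step_integral_measurable[OF gb A]])
  then obtain K where "\<forall>\<^sub>F n in sequentially. \<bar>a * ?c n\<bar> \<le> K" ..
  then have "\<forall>\<^sub>F n in sequentially. \<bar>?c n\<bar> \<le> K / \<bar>a\<bar>"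
    by eventually_elim (use a in \<open>simp add: abs_mult field_simps\<close>)
  then show "\<exists>K. \<forall>\<^sub>F n in sequentially. \<bar>?c n\<bar> \<le> K" ..
qed (use f f_int in auto)

text \<open>The argument draws on the Levy measure in the triplet and on \<open>char\<close> being
  nonzero at 1. Leaving \<open>c\<close> and \<open>v\<close> arbitrary avoids the quotients by
  \<open>lam\<close>, which are 0 by convention at \<open>lam = 0\<close> and carry no information
  there.\<close>

lemma wbou_necessary:
  assumes nondegenerate: "\<not> (lam \<le> 0 \<and> a = 0 \<and> b = 0 \<and> emeasure \<nu> UNIV = 0)"
    and int: "rm_integrable M \<Lambda> (wbou_kernel lam t)"
    and triplet: "\<And>X. has_rm_integral M \<Lambda> (wbou_kernel lam t) X \<Longrightarrow>
      has_char_triplet (distr M borel X) c v (wbou_levy_measure lam \<nu> t)"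
  shows "0 < lam \<and> (\<integral>\<^sup>+x\<in>{x. \<bar>x\<bar> > 1}. ennreal (ln \<bar>x\<bar>) \<partial>\<nu>) < \<infinity>"
proof -
  obtain g where g: "approximating_steps M \<Lambda> (wbou_kernel lam t) g" using int by (auto simp: rm_integrable_def)
  moreover have "(UNIV :: real set) \<in> sets borel" by simp
  ultimately obtain X where X: "tendsto_in_prob M (\<lambda>n. step_integral \<Lambda> (g n) UNIV) X"
    unfolding approximating_steps_def by blast
  have "has_rm_integral M \<Lambda> (wbou_kernel lam t) X" using g X by (auto simp: has_rm_integral_def)
  then have trip: "has_char_triplet (distr M borel X) c v (wbou_levy_measure lam \<nu> t)" by (rule triplet)
  then have lm: "levy_measure (wbou_levy_measure lam \<nu> t)" and nonzero: "char (distr M borel X) 1 \<noteq> 0"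
    by (auto simp: has_char_triplet_def)
  have "0 < lam"
  proof (rule ccontr)
    assume "\<not> 0 < lam"
    then have lam: "lam \<le> 0" by simp
    have null: "emeasure \<nu> UNIV = 0" by (rule null_if_levy_measure[OF lam lm])
    note f = wbou_kernel_simps(4)[OF lam]
    have "b = 0" using no_gaussian_integral[OF null _ f g X nonzero] b_nonneg by force
    moreover have "integrable lborel (\<lambda>s. indicator {-real n..real n} s * wbou_kernel lam t s)" for n :: nat
    proof -
      have "continuous_on {-real n..real n} (wbou_kernel lam t)"
        unfolding wbou_kernel_def by (intro continuous_intros)
      from borel_integrable_compact[OF compact_Icc this] show ?thesis
        by (simp add: set_integrable_def)
    qed
    ultimately have "a = 0" using no_drift_integral[OF null _ _ f _ g] by blast
    with \<open>b = 0\<close> null lam nondegenerate show False by simp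
  qed
  then show ?thesis using log_moment_if_levy_measure lm by blast
qed

end

text \<open>If \<open>lam \<le> 0\<close> and the triplet of \<open>L\<close> is zero, all integrals
  vanish almost surely and have the stated zero triplet, so the left-hand side holds although
  \<open>lam > 0\<close> fails. The hypothesis \<open>nondegenerate\<close> excludes exactly this
  case.\<close>

theorem lemma2p1:
  fixes M :: "'a measure" and L :: "real \<Rightarrow> 'a \<Rightarrow> real" and \<Lambda> :: "real set \<Rightarrow> 'a \<Rightarrow> real"
    and \<gamma> \<sigma>2 lam :: real and \<nu> :: "real measure"
  assumes "two_sided_levy_process M L \<gamma> \<sigma>2 \<nu>"
    and "associated_random_measure M L \<Lambda>"
    and nondegenerate: "\<not> (lam \<le> 0 \<and> \<gamma> = 0 \<and> \<sigma>2 = 0 \<and> emeasure \<nu> UNIV = 0)"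
  shows "(\<forall>t\<ge>0. rm_integrable M \<Lambda> (wbou_kernel lam t) \<and>
            (\<forall>X. has_rm_integral M \<Lambda> (wbou_kernel lam t) X \<longrightarrow>
               infinitely_divisible (distr M borel X) \<and>
               has_char_triplet (distr M borel X)
                 (wbou_drift lam \<gamma> \<nu>) (\<sigma>2 / lam) (wbou_levy_measure lam \<nu> t)))
         \<longleftrightarrow> lam > 0 \<and> (\<integral>\<^sup>+x\<in>{x. \<bar>x\<bar> > 1}. ennreal (ln \<bar>x\<bar>) \<partial>\<nu>) < \<infinity>"
    (is "?L \<longleftrightarrow> ?R")
proof -
  interpret levy_random_measure M \<Lambda> \<gamma> \<sigma>2 \<nu> by (rule levy_random_measureI[OF assms(1,2)])
  show ?thesis
  proof
    assume ?L
    \<comment> \<open>The single time \<open>t = 0\<close> already yields necessity.\<close>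
    then show ?R by (intro wbou_necessary[OF nondegenerate, of 0]) auto
  next
    assume ?R
    then show ?L using wbou_sufficient by blast
  qed
qed

end
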